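(* Let $p:\mathcal D\to\mathcal C$ be a functor and let $\mathcal P,\mathcal N$ be two subsets of arrows of $\mathcal C$. (i) If $\mathcal C$ is both $\mathcal P$-factorization preordered and $\mathcal N$-factorization preordered, then arrows of $\mathrm{Bif}(p,\mathcal P,\mathcal N)$ are canonically represented by maximally multifocused derivations: for all formulas $S,T$ over $A,B$ and $f:A\to B$ there is a one-to-one correspondence between arrows $S\to T$ of $\mathrm{Bif}(p,\mathcal P,\mathcal N)$ lying over $f$ and maximally multifocused derivations of $S\Rightarrow_f^{\bot_{\mathsf i}}T$. Moreover permutation equivalence of derivations is decidable. (ii) If moreover $\mathcal D$ is relatively locally finite and $\mathcal C$ has locally finite slices and coslices, then $\mathrm{Bif}(p,\mathcal P,\mathcal N)$ is relatively locally finite and logical equivalence of formulas is decidable.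
   Context: Composition is in diagrammatic order. For a subset $\mathcal W$ of arrows, $\mathcal C$ is $\mathcal W$-factorization preordered if for all composable $f\in\mathcal W$, $g,h$ (parallel, arbitrary), $k\in\mathcal W$: $fg=fh$ and $gk=hk$ imply $g=h$. A category with a functor $q$ to $\mathcal C$ is relatively locally finite if for each arrow $f$ of $\mathcal C$ and objects $X,Y$ over its endpoints, the set of arrows $X\to Y$ over $f$ is finite; $\mathcal D$ is considered relative to $p$ and $\mathrm{Bif}(p,\mathcal P,\mathcal N)$ relative to its projection to $\mathcal C$. "Locally finite" means finite homsets. Decidability is understood effectively: objects and arrows are finite data, composition and $p$ are computable, equality of arrows and membership in $\mathcal P,\mathcal N$ are decidable, and hypotheses are interpreted constructively (existence of diagonal fillers in commuting squares is decidable, with a filler computable; finite sets of arrows in hypotheses can be enumerated). Calculus. Formulas: each object $X$ of $\mathcal D$ is an atomic formula over $p(X)$; if $S$ is over $A$ and $f:A\to B$ is in $\mathcal P$ then $f^+S$ is a formula over $B$; if $T$ is over $C$ and $g:B\to C$ is in $\mathcal N$ then $g^-T$ is a formula over $B$. Derivations $\alpha:S\Rightarrow_h T$ (with $h$ any arrow of $\mathcal C$) are generated by: each $\delta:X\to Y$ in $\mathcal D$ with $p(\delta)=f$ gives $X\Rightarrow_f Y$; if $\alpha:S\Rightarrow_{fg}T$ then $\mathsf L^+_{f,g}(\alpha):f^+S\Rightarrow_g T$; if $\alpha:S'\Rightarrow_{f'}S$ then $\mathsf R^+_f(\alpha):S'\Rightarrow_{f'f}f^+S$; if $\alpha:T\Rightarrow_{g'}T'$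 then $\mathsf L^-_g(\alpha):g^-T\Rightarrow_{gg'}T'$; if $\alpha:S\Rightarrow_{fg}T$ then $\mathsf R^-_{f,g}(\alpha):S\Rightarrow_f g^-T$. Permutation equivalence $\sim$ is the least equivalence relation on derivations of each sequent closed under these rules and containing (whenever valid) $\mathsf R^+_h\mathsf L^-_f\alpha\sim\mathsf L^-_f\mathsf R^+_h\alpha$ ($\alpha$ over $g$); $\mathsf R^+_h\mathsf L^+_{f,g}\alpha\sim\mathsf L^+_{f,gh}\mathsf R^+_h\alpha$ ($\alpha$ over $fg$); $\mathsf R^-_{fg,h}\mathsf L^-_f\alpha\sim\mathsf L^-_f\mathsf R^-_{g,h}\alpha$ ($\alpha$ over $gh$); $\mathsf R^-_{g,h}\mathsf L^+_{f,gh}\alpha\sim\mathsf L^+_{f,g}\mathsf R^-_{fg,h}\alpha$ ($\alpha$ over $fgh$). $\mathrm{Bif}(p,\mathcal P,\mathcal N)$ is the category whose objects are formulas and whose arrows are $\sim$-classes of derivations, with projection to $\mathcal C$ sending $S\Rightarrow_h T$ to $h$. Identities: the axiom $\mathrm{id}_X$; $\mathrm{id}_{f^+S}=\mathsf L^+_{f,\mathrm{id}}\mathsf R^+_f(\mathrm{id}_S)$; $\mathrm{id}_{g^-T}=\mathsf R^-_{\mathrm{id},g}\mathsf L^-_g(\mathrm{id}_T)$. Composition $\alpha\cdot\beta$ (defined up to $\sim$): composition in $\mathcal D$ on axioms; $\mathsf R^+_f(\alpha)\cdot\mathsf L^+_{f,h}(\beta)=\alpha\cdot\beta$; $\mathsf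 R^-_{g,f}(\alpha)\cdot\mathsf L^-_f(\beta)=\alpha\cdot\beta$; $\mathsf L^-_f(\alpha)\cdot\beta=\mathsf L^-_f(\alpha\cdot\beta)$; $\mathsf L^+_{f,g}(\alpha)\cdot\beta=\mathsf L^+_{f,gh}(\alpha\cdot\beta)$ ($\beta$ over $h$); $\alpha\cdot\mathsf R^+_f(\beta)=\mathsf R^+_f(\alpha\cdot\beta)$; $\alpha\cdot\mathsf R^-_{h,f}(\beta)=\mathsf R^-_{gh,f}(\alpha\cdot\beta)$ ($\alpha$ over $g$). It is the free $(\mathcal P,\mathcal N)$-fibration on $p$ (free functor over $\mathcal C$ with chosen $+$-cartesian liftings of arrows in $\mathcal P$ and $-$-cartesian liftings of arrows in $\mathcal N$). Two formulas over the same object $A$ are logically equivalent if they are isomorphic via arrows lying over $\mathrm{id}_A$. Maximally multifocused derivations. A formula is positive if its outermost connective is some $f^+$, negative if it is some $g^-$. For a finite sequence $\pi=(f_0,\dots,f_n)$ of composable arrows (all in $\mathcal P$ when used positively, all in $\mathcal N$ when used negatively), $\pi^+S=f_n^+\cdots f_0^+S$, $\pi^-S=f_0^-\cdots f_n^-S$, $\epsilon^\pm S=S$ for the empty sequence $\epsilon$; inside base arrows $\pi$ denotes the composite. $N,M$ range over non-positive formulas, $P,Q$ over non-negative formulas. For arrows with $ab=cd$ write $(a,b)\le(c,d)$ if there is $e$ in $\mathcal C$ with $c=ae$, $b=ed$. Annotated sequents $S\Rightarrow_h^qT$ carry a pre-inversion state $q\in\{\bot_{\mathsf i},\mathsf L,\mathsf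 R\}$ or a pre-focus state $q_{\mathsf f}$ of the form $\bot_{\mathsf f}$, $\mathsf L[\pi,f]$, $\mathsf R[f,\rho]$. Rules: - Axiom: $X\Rightarrow_f^{q_{\mathsf f}}Y$ for $\delta:X\to Y$ in $\mathcal D$ with $p(\delta)=f$. - Inversion: from $N\Rightarrow_{\pi f\rho}^{q'}P$ infer $\pi^+N\Rightarrow_f^q\rho^-P$, $q$ pre-inversion, $\pi$ empty iff the left side of the conclusion is non-positive, $\rho$ empty iff the right side of the conclusion is non-negative, and $q'=\bot_{\mathsf f}$ if $q=\bot_{\mathsf i}$, $q'=\mathsf L[\pi,f]$ if $q=\mathsf L$ (then $\rho=\epsilon$), $q'=\mathsf R[f,\rho]$ if $q=\mathsf R$ (then $\pi=\epsilon$). - Left focus ($\sigma\ne\epsilon$): from $P\Rightarrow_g^{\mathsf L}Q$ infer $\sigma^-P\Rightarrow_{\sigma g}^{q_{\mathsf f}}Q$, provided $q_{\mathsf f}=\mathsf R[f,\rho]$ implies $(\sigma,g)\not\le(f,\rho)$. - Right focus ($\tau\ne\epsilon$): from $N\Rightarrow_g^{\mathsf R}M$ infer $N\Rightarrow_{g\tau}^{q_{\mathsf f}}\tau^+M$, provided $q_{\mathsf f}=\mathsf L[\pi,f]$ implies $(\pi,f)\not\le(g,\tau)$. - Bi-focus ($\sigma,\tau\ne\epsilon$): from $P\Rightarrow_g^{\bot_{\mathsf i}}N$ infer $\sigma^-P\Rightarrow_{\sigma g\tau}^{q_{\mathsf f}}\tau^+N$, provided $q_{\mathsf f}=\mathsf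 L[\pi,f]$ implies $(\pi,f)\not\le(\sigma g,\tau)$ and $q_{\mathsf f}=\mathsf R[f,\rho]$ implies $(\sigma,g\tau)\not\le(f,\rho)$. *)

theory Defs
  imports "HOL-Library.Nat_Bijection"
begin

section \<open>Categories and functors\<close>

text \<open>Composition is in diagrammatic order and is only meaningful on composable arrows.\<close>

record ('o, 'a) cat =
  Obj :: "'o set"
  Arr :: "'a set"
  Dom :: "'a \<Rightarrow> 'o"
  Cod :: "'a \<Rightarrow> 'o"
  Id :: "'o \<Rightarrow> 'a"
  Comp :: "'a \<Rightarrow> 'a \<Rightarrow> 'a" (infixl "\<cdot>\<index>" 70)

locale category =
  fixes C :: "('o, 'a) cat" (structure)
  assumes Dom_in: "f \<in> Arr C \<Longrightarrow> Dom C f \<in> Obj C"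
    and Cod_in: "f \<in> Arr C \<Longrightarrow> Cod C f \<in> Obj C"
    and Id_in: "A \<in> Obj C \<Longrightarrow> Id C A \<in> Arr C"
    and Dom_Id: "A \<in> Obj C \<Longrightarrow> Dom C (Id C A) = A"
    and Cod_Id: "A \<in> Obj C \<Longrightarrow> Cod C (Id C A) = A"
    and Comp_in: "\<lbrakk>f \<in> Arr C; g \<in> Arr C; Cod C f = Dom C g\<rbrakk> \<Longrightarrow> f \<cdot> g \<in> Arr C"
    and Dom_Comp: "\<lbrakk>f \<in> Arr C; g \<in> Arr C; Cod C f = Dom C g\<rbrakk> \<Longrightarrow> Dom C (f \<cdot> g) = Dom C f"
    and Cod_Comp: "\<lbrakk>f \<in> Arr C; g \<in> Arr C; Cod C f = Dom C g\<rbrakk> \<Longrightarrow> Cod C (f \<cdot> g) = Cod C g"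
    and Id_left: "f \<in> Arr C \<Longrightarrow> Id C (Dom C f) \<cdot> f = f"
    and Id_right: "f \<in> Arr C \<Longrightarrow> f \<cdot> Id C (Cod C f) = f"
    and assoc: "\<lbrakk>f \<in> Arr C; g \<in> Arr C; h \<in> Arr C; Cod C f = Dom C g; Cod C g = Dom C h\<rbrakk>
      \<Longrightarrow> (f \<cdot> g) \<cdot> h = f \<cdot> (g \<cdot> h)"

record ('x, 'd, 'o, 'a) ftr =
  fobj :: "'x \<Rightarrow> 'o"
  farr :: "'d \<Rightarrow> 'a"

locale cat_functor = dom: category D + cod: category C
  for D :: "('x, 'd) cat" and C :: "('o, 'a) cat" and p :: "('x, 'd, 'o, 'a) ftr" +
  assumes fobj_in: "X \<in> Obj D \<Longrightarrow> fobj p X \<in> Obj C"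
    and farr_in: "\<delta> \<in> Arr D \<Longrightarrow> farr p \<delta> \<in> Arr C"
    and Dom_farr: "\<delta> \<in> Arr D \<Longrightarrow> Dom C (farr p \<delta>) = fobj p (Dom D \<delta>)"
    and Cod_farr: "\<delta> \<in> Arr D \<Longrightarrow> Cod C (farr p \<delta>) = fobj p (Cod D \<delta>)"
    and farr_Id: "X \<in> Obj D \<Longrightarrow> farr p (Id D X) = Id C (fobj p X)"
    and farr_Comp: "\<lbrakk>\<delta> \<in> Arr D; \<epsilon> \<in> Arr D; Cod D \<delta> = Dom D \<epsilon>\<rbrakk>
      \<Longrightarrow> farr p (\<delta> \<cdot>\<^bsub>D\<^esub> \<epsilon>) = farr p \<delta> \<cdot>\<^bsub>C\<^esub> farr p \<epsilon>"

definition hom :: "('o, 'a) cat \<Rightarrow> 'o \<Rightarrow> 'o \<Rightarrow> 'a set" where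
  "hom C A B = {f \<in> Arr C. Dom C f = A \<and> Cod C f = B}"

definition hom_over :: "('x, 'd) cat \<Rightarrow> ('x, 'd, 'o, 'a) ftr \<Rightarrow> 'x \<Rightarrow> 'a \<Rightarrow> 'x \<Rightarrow> 'd set" where
  "hom_over E q X f Y = {\<delta> \<in> hom E X Y. farr q \<delta> = f}"

definition locally_finite :: "('o, 'a) cat \<Rightarrow> bool" where
  "locally_finite C \<longleftrightarrow> (\<forall>A \<in> Obj C. \<forall>B \<in> Obj C. finite (hom C A B))"

definition relatively_locally_finite ::
  "('o, 'a) cat \<Rightarrow> ('x, 'd) cat \<Rightarrow> ('x, 'd, 'o, 'a) ftr \<Rightarrow> bool" where
  "relatively_locally_finite C E q \<longleftrightarrow>
    (\<forall>f \<in> Arr C. \<forall>X \<in> Obj E. \<forall>Y \<in> Obj E.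
       fobj q X = Dom C f \<longrightarrow> fobj q Y = Cod C f \<longrightarrow> finite (hom_over E q X f Y))"

text \<open>An arrow of a slice is a triple \<open>(f, e, g)\<close> with \<open>e : f \<rightarrow> g\<close>, i.e. \<open>e g = f\<close>;
  in a coslice \<open>f e = g\<close>.\<close>

definition slice :: "('o, 'a) cat \<Rightarrow> 'o \<Rightarrow> ('a, 'a \<times> 'a \<times> 'a) cat" where
  "slice C A = \<lparr>
    Obj = {f \<in> Arr C. Cod C f = A},
    Arr = {(f, e, g). f \<in> Arr C \<and> e \<in> Arr C \<and> g \<in> Arr C \<and> Cod C f = A \<and> Cod C g = A \<and>
                      Cod C e = Dom C g \<and> e \<cdot>\<^bsub>C\<^esub> g = f},
    Dom = (\<lambda>(f, e, g). f),
    Cod = (\<lambda>(f, e, g). g),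
    Id = (\<lambda>f. (f, Id C (Dom C f), f)),
    Comp = (\<lambda>(f, e, g) (g', e', h). (f, e \<cdot>\<^bsub>C\<^esub> e', h))\<rparr>"

definition coslice :: "('o, 'a) cat \<Rightarrow> 'o \<Rightarrow> ('a, 'a \<times> 'a \<times> 'a) cat" where
  "coslice C A = \<lparr>
    Obj = {f \<in> Arr C. Dom C f = A},
    Arr = {(f, e, g). f \<in> Arr C \<and> e \<in> Arr C \<and> g \<in> Arr C \<and> Dom C f = A \<and> Dom C g = A \<and>
                      Cod C f = Dom C e \<and> f \<cdot>\<^bsub>C\<^esub> e = g},
    Dom = (\<lambda>(f, e, g). f),
    Cod = (\<lambda>(f, e, g). g),
    Id = (\<lambda>f. (f, Id C (Cod C f), f)),
    Comp = (\<lambda>(f, e, g) (g', e', h). (f, e \<cdot>\<^bsub>C\<^esub> e', h))\<rparr>"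

definition locally_finite_slices :: "('o, 'a) cat \<Rightarrow> bool" where
  "locally_finite_slices C \<longleftrightarrow> (\<forall>A \<in> Obj C. locally_finite (slice C A))"

definition locally_finite_coslices :: "('o, 'a) cat \<Rightarrow> bool" where
  "locally_finite_coslices C \<longleftrightarrow> (\<forall>A \<in> Obj C. locally_finite (coslice C A))"

definition factorization_preordered :: "('o, 'a) cat \<Rightarrow> 'a set \<Rightarrow> bool" where
  "factorization_preordered C W \<longleftrightarrow>
    (\<forall>f \<in> W. \<forall>g \<in> Arr C. \<forall>h \<in> Arr C. \<forall>k \<in> W.
       Cod C f = Dom C g \<longrightarrow> Dom C g = Dom C h \<longrightarrow> Cod C g = Cod C h \<longrightarrow> Cod C g = Dom C k \<longrightarrow>
       f \<cdot>\<^bsub>C\<^esub> g = f \<cdot>\<^bsub>C\<^esub> h \<longrightarrow> g \<cdot>\<^bsub>C\<^esub> k = h \<cdot>\<^bsub>C\<^esub> k \<longrightarrow> g = h)"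


section \<open>Formulas and derivations\<close>

text \<open>\<open>Pos f S\<close> is \<open>f\<^sup>+ S\<close>, and \<open>Neg g T\<close> is \<open>g\<^sup>- T\<close>.\<close>

datatype ('x, 'a) fm =
  Atom 'x
| Pos 'a "('x, 'a) fm"
| Neg 'a "('x, 'a) fm"

datatype ('d, 'a) der =
  Ax 'd
| LP 'a 'a "('d, 'a) der"
| RP 'a "('d, 'a) der"
| LN 'a "('d, 'a) der"
| RN 'a 'a "('d, 'a) der"

fun positive :: "('x, 'a) fm \<Rightarrow> bool" where
  "positive (Pos _ _) = True"
| "positive _ = False"

fun negative :: "('x, 'a) fm \<Rightarrow> bool" where
  "negative (Neg _ _) = True"
| "negative _ = False"

text \<open>For \<open>\<pi> = [f\<^sub>0, \<dots>, f\<^sub>n]\<close>: \<open>Poss \<pi> S = f\<^sub>n\<^sup>+ \<dots> f\<^sub>0\<^sup>+ S\<close> and \<open>Negs \<pi> S = f\<^sub>0\<^sup>- \<dots> f\<^sub>n\<^sup>- S\<close>.\<close>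

definition Poss :: "'a list \<Rightarrow> ('x, 'a) fm \<Rightarrow> ('x, 'a) fm" where
  "Poss \<pi> S = fold Pos \<pi> S"

definition Negs :: "'a list \<Rightarrow> ('x, 'a) fm \<Rightarrow> ('x, 'a) fm" where
  "Negs \<pi> S = foldr Neg \<pi> S"

text \<open>Pre-inversion states \<open>IBot\<close>, \<open>IL\<close>, \<open>IR\<close> and pre-focus states \<open>FBot\<close>, \<open>FL \<pi> f\<close>, \<open>FR f \<rho>\<close>.\<close>

datatype 'a state = IBot | IL | IR | FBot | FL "'a list" 'a | FR 'a "'a list"

fun pre_focus :: "'a state \<Rightarrow> bool" where
  "pre_focus FBot = True"
| "pre_focus (FL _ _) = True"
| "pre_focus (FR _ _) = True"
| "pre_focus _ = False"

text \<open>The state annotations are not stored in a multifocused derivation: they are determined by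
  the state of the end sequent.\<close>

datatype ('d, 'a) mmf =
  MAx 'd
| Inv "'a list" 'a "'a list" "('d, 'a) mmf"
| LFoc "'a list" "('d, 'a) mmf"
| RFoc "('d, 'a) mmf" "'a list"
| BFoc "'a list" "('d, 'a) mmf" "'a list"

locale bif =
  fixes C :: "('o, 'a) cat" (structure)
    and D :: "('x, 'd) cat"
    and p :: "('x, 'd, 'o, 'a) ftr"
    and \<P> \<N> :: "'a set"
begin

inductive formula :: "('x, 'a) fm \<Rightarrow> 'o \<Rightarrow> bool" where
  "X \<in> Obj D \<Longrightarrow> formula (Atom X) (fobj p X)"
| "\<lbrakk>f \<in> \<P>; formula S (Dom C f)\<rbrakk> \<Longrightarrow> formula (Pos f S) (Cod C f)"
| "\<lbrakk>g \<in> \<N>; formula T (Cod C g)\<rbrakk> \<Longrightarrow> formula (Neg g T) (Dom C g)"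

inductive derives :: "('d, 'a) der \<Rightarrow> ('x, 'a) fm \<Rightarrow> 'a \<Rightarrow> ('x, 'a) fm \<Rightarrow> bool" where
  Ax: "\<delta> \<in> Arr D \<Longrightarrow> derives (Ax \<delta>) (Atom (Dom D \<delta>)) (farr p \<delta>) (Atom (Cod D \<delta>))"
| LP: "\<lbrakk>f \<in> \<P>; g \<in> Arr C; Cod C f = Dom C g; formula S (Dom C f); derives \<alpha> S (f \<cdot> g) T\<rbrakk>
    \<Longrightarrow> derives (LP f g \<alpha>) (Pos f S) g T"
| RP: "\<lbrakk>f \<in> \<P>; Cod C f' = Dom C f; derives \<alpha> S' f' S\<rbrakk>
    \<Longrightarrow> derives (RP f \<alpha>) S' (f' \<cdot> f) (Pos f S)"
| LN: "\<lbrakk>g \<in> \<N>; Cod C g = Dom C g'; derives \<alpha> T g' T'\<rbrakk>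
    \<Longrightarrow> derives (LN g \<alpha>) (Neg g T) (g \<cdot> g') T'"
| RN: "\<lbrakk>f \<in> Arr C; g \<in> \<N>; Cod C f = Dom C g; formula T (Cod C g); derives \<alpha> S (f \<cdot> g) T\<rbrakk>
    \<Longrightarrow> derives (RN f g \<alpha>) S f (Neg g T)"

text \<open>The premises say that both sides are derivations of one and the same sequent.\<close>

inductive permeq :: "('d, 'a) der \<Rightarrow> ('d, 'a) der \<Rightarrow> bool" (infix "\<sim>" 50) where
  refl: "derives \<alpha> S h T \<Longrightarrow> \<alpha> \<sim> \<alpha>"
| sym: "\<alpha> \<sim> \<beta> \<Longrightarrow> \<beta> \<sim> \<alpha>"
| trans: "\<lbrakk>\<alpha> \<sim> \<beta>; \<beta> \<sim> \<gamma>\<rbrakk> \<Longrightarrow> \<alpha> \<sim> \<gamma>"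
| cong_LP: "\<lbrakk>derives (LP f g \<alpha>) S h T; derives (LP f g \<beta>) S h T; \<alpha> \<sim> \<beta>\<rbrakk> \<Longrightarrow> LP f g \<alpha> \<sim> LP f g \<beta>"
| cong_RP: "\<lbrakk>derives (RP f \<alpha>) S h T; derives (RP f \<beta>) S h T; \<alpha> \<sim> \<beta>\<rbrakk> \<Longrightarrow> RP f \<alpha> \<sim> RP f \<beta>"
| cong_LN: "\<lbrakk>derives (LN g \<alpha>) S h T; derives (LN g \<beta>) S h T; \<alpha> \<sim> \<beta>\<rbrakk> \<Longrightarrow> LN g \<alpha> \<sim> LN g \<beta>"
| cong_RN: "\<lbrakk>derives (RN f g \<alpha>) S h T; derives (RN f g \<beta>) S h T; \<alpha> \<sim> \<beta>\<rbrakk> \<Longrightarrow> RN f g \<alpha> \<sim> RN f g \<beta>"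
| RP_LN: "\<lbrakk>derives (RP h (LN f \<alpha>)) S k T; derives (LN f (RP h \<alpha>)) S k T\<rbrakk>
    \<Longrightarrow> RP h (LN f \<alpha>) \<sim> LN f (RP h \<alpha>)"
| RP_LP: "\<lbrakk>derives (RP h (LP f g \<alpha>)) S k T; derives (LP f (g \<cdot> h) (RP h \<alpha>)) S k T\<rbrakk>
    \<Longrightarrow> RP h (LP f g \<alpha>) \<sim> LP f (g \<cdot> h) (RP h \<alpha>)"
| RN_LN: "\<lbrakk>derives (RN (f \<cdot> g) h (LN f \<alpha>)) S k T; derives (LN f (RN g h \<alpha>)) S k T\<rbrakk>
    \<Longrightarrow> RN (f \<cdot> g) h (LN f \<alpha>) \<sim> LN f (RN g h \<alpha>)"
| RN_LP: "\<lbrakk>derives (RN g h (LP f (g \<cdot> h) \<alpha>)) S k T; derives (LP f g (RN (f \<cdot> g) h \<alpha>)) S k T\<rbrakk>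
    \<Longrightarrow> RN g h (LP f (g \<cdot> h) \<alpha>) \<sim> LP f g (RN (f \<cdot> g) h \<alpha>)"


section \<open>The category of formulas and derivations modulo permutation\<close>

primrec ident :: "('x, 'a) fm \<Rightarrow> ('d, 'a) der" where
  "ident (Atom X) = Ax (Id D X)"
| "ident (Pos f S) = LP f (Id C (Cod C f)) (RP f (ident S))"
| "ident (Neg g T) = RN (Id C (Dom C g)) g (LN g (ident T))"

text \<open>The clauses for composition overlap, and their results then agree only up to \<open>\<sim>\<close>;
  hence a relation.\<close>

inductive cut :: "('d, 'a) der \<Rightarrow> ('d, 'a) der \<Rightarrow> ('d, 'a) der \<Rightarrow> bool" where
  "cut (Ax \<delta>) (Ax \<epsilon>) (Ax (\<delta> \<cdot>\<^bsub>D\<^esub> \<epsilon>))"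
| "cut \<alpha> \<beta> \<gamma> \<Longrightarrow> cut (RP f \<alpha>) (LP f h \<beta>) \<gamma>"
| "cut \<alpha> \<beta> \<gamma> \<Longrightarrow> cut (RN g f \<alpha>) (LN f \<beta>) \<gamma>"
| "cut \<alpha> \<beta> \<gamma> \<Longrightarrow> cut (LN f \<alpha>) \<beta> (LN f \<gamma>)"
| "\<lbrakk>derives \<beta> S h T; cut \<alpha> \<beta> \<gamma>\<rbrakk> \<Longrightarrow> cut (LP f g \<alpha>) \<beta> (LP f (g \<cdot> h) \<gamma>)"
| "cut \<alpha> \<beta> \<gamma> \<Longrightarrow> cut \<alpha> (RP f \<beta>) (RP f \<gamma>)"
| "\<lbrakk>derives \<alpha> S g T; cut \<alpha> \<beta> \<gamma>\<rbrakk> \<Longrightarrow> cut \<alpha> (RN h f \<beta>) (RN (g \<cdot> h) f \<gamma>)"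

definition perm_class :: "('d, 'a) der \<Rightarrow> ('d, 'a) der set" where
  "perm_class \<alpha> = {\<beta>. \<alpha> \<sim> \<beta>}"

definition Bif :: "(('x, 'a) fm, ('d, 'a) der set) cat" where
  "Bif = \<lparr>
    Obj = {S. \<exists>A. formula S A},
    Arr = {\<alpha>. \<exists>S h T. derives \<alpha> S h T} // {(\<alpha>, \<beta>). \<alpha> \<sim> \<beta>},
    Dom = (\<lambda>F. THE S. \<exists>\<alpha> \<in> F. \<exists>h T. derives \<alpha> S h T),
    Cod = (\<lambda>F. THE T. \<exists>\<alpha> \<in> F. \<exists>S h. derives \<alpha> S h T),
    Id = (\<lambda>S. perm_class (ident S)),
    Comp = (\<lambda>F G. \<Union>{perm_class \<gamma> | \<gamma>. \<exists>\<alpha> \<in> F. \<exists>\<beta> \<in> G. cut \<alpha> \<beta> \<gamma>})\<rparr>"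

definition Bif_proj :: "(('x, 'a) fm, ('d, 'a) der set, 'o, 'a) ftr" where
  "Bif_proj = \<lparr>
    fobj = (\<lambda>S. THE A. formula S A),
    farr = (\<lambda>F. THE h. \<exists>\<alpha> \<in> F. \<exists>S T. derives \<alpha> S h T)\<rparr>"

definition logically_equivalent :: "('x, 'a) fm \<Rightarrow> ('x, 'a) fm \<Rightarrow> bool" where
  "logically_equivalent S T \<longleftrightarrow>
    (\<exists>A. formula S A \<and> formula T A \<and>
      (\<exists>F \<in> hom_over Bif Bif_proj S (Id C A) T. \<exists>G \<in> hom_over Bif Bif_proj T (Id C A) S.
         F \<cdot>\<^bsub>Bif\<^esub> G = Id Bif S \<and> G \<cdot>\<^bsub>Bif\<^esub> F = Id Bif T))"


section \<open>Maximally multifocused derivations\<close>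

text \<open>\<open>pre \<pi> f\<close> and \<open>post f \<rho>\<close> are the base arrows written \<open>\<pi>f\<close> and \<open>f\<rho>\<close>; in particular
  \<open>pre \<pi> (Id (Dom f))\<close> is the composite of \<open>\<pi>\<close> even when \<open>\<pi>\<close> is empty.\<close>

definition pre :: "'a list \<Rightarrow> 'a \<Rightarrow> 'a" where
  "pre \<pi> f = foldr (\<cdot>) \<pi> f"

definition post :: "'a \<Rightarrow> 'a list \<Rightarrow> 'a" where
  "post f \<rho> = foldl (\<cdot>) f \<rho>"

fun path :: "'a set \<Rightarrow> 'o \<Rightarrow> 'a list \<Rightarrow> 'o \<Rightarrow> bool" where
  "path W A [] B \<longleftrightarrow> A = B"
| "path W A (f # \<pi>) B \<longleftrightarrow> f \<in> W \<and> Dom C f = A \<and> path W (Cod C f) \<pi> B"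

definition square_le :: "'a \<times> 'a \<Rightarrow> 'a \<times> 'a \<Rightarrow> bool" where
  "square_le = (\<lambda>(a, b) (c, d). a \<cdot> b = c \<cdot> d \<and>
     (\<exists>e \<in> hom C (Cod C a) (Dom C d). c = a \<cdot> e \<and> b = e \<cdot> d))"

inductive mmf_derives ::
  "('d, 'a) mmf \<Rightarrow> ('x, 'a) fm \<Rightarrow> 'a \<Rightarrow> 'a state \<Rightarrow> ('x, 'a) fm \<Rightarrow> bool" where
  Axiom: "\<lbrakk>\<delta> \<in> Arr D; pre_focus q\<rbrakk>
    \<Longrightarrow> mmf_derives (MAx \<delta>) (Atom (Dom D \<delta>)) (farr p \<delta>) q (Atom (Cod D \<delta>))"
| Inversion: "\<lbrakk>f \<in> Arr C; path \<P> A \<pi> (Dom C f); path \<N> (Cod C f) \<rho> B;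
     \<not> positive N; \<not> negative P; formula N A; formula P B;
     q = IBot \<and> q' = FBot \<or> q = IL \<and> q' = FL \<pi> f \<and> \<rho> = [] \<or> q = IR \<and> q' = FR f \<rho> \<and> \<pi> = [];
     mmf_derives d N (post (pre \<pi> f) \<rho>) q' P\<rbrakk>
    \<Longrightarrow> mmf_derives (Inv \<pi> f \<rho> d) (Poss \<pi> N) f q (Negs \<rho> P)"
| Left_focus: "\<lbrakk>\<sigma> \<noteq> []; path \<N> A \<sigma> (Dom C g); \<not> negative P; \<not> negative Q; pre_focus q;
     \<forall>f \<rho>. q = FR f \<rho> \<longrightarrow>
       \<not> square_le (pre \<sigma> (Id C (Dom C g)), g) (f, post (Id C (Cod C f)) \<rho>);
     mmf_derives d P g IL Q\<rbrakk>
    \<Longrightarrow> mmf_derives (LFoc \<sigma> d) (Negs \<sigma> P) (pre \<sigma> g) q Q"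
| Right_focus: "\<lbrakk>\<tau> \<noteq> []; path \<P> (Cod C g) \<tau> B; \<not> positive N; \<not> positive M; pre_focus q;
     \<forall>\<pi> f. q = FL \<pi> f \<longrightarrow>
       \<not> square_le (pre \<pi> (Id C (Dom C f)), f) (g, post (Id C (Cod C g)) \<tau>);
     mmf_derives d N g IR M\<rbrakk>
    \<Longrightarrow> mmf_derives (RFoc d \<tau>) N (post g \<tau>) q (Poss \<tau> M)"
| Bi_focus: "\<lbrakk>\<sigma> \<noteq> []; \<tau> \<noteq> []; path \<N> A \<sigma> (Dom C g); path \<P> (Cod C g) \<tau> B;
     \<not> negative P; \<not> positive N; pre_focus q;
     \<forall>\<pi> f. q = FL \<pi> f \<longrightarrow>
       \<not> square_le (pre \<pi> (Id C (Dom C f)), f) (pre \<sigma> g, post (Id C (Cod C g)) \<tau>);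
     \<forall>f \<rho>. q = FR f \<rho> \<longrightarrow>
       \<not> square_le (pre \<sigma> (Id C (Dom C g)), post g \<tau>) (f, post (Id C (Cod C f)) \<rho>);
     mmf_derives d P g IBot N\<rbrakk>
    \<Longrightarrow> mmf_derives (BFoc \<sigma> d \<tau>) (Negs \<sigma> P) (post (pre \<sigma> g) \<tau>) q (Poss \<tau> N)"

text \<open>The underlying derivation of a multifocused derivation. Each multifocused rule is expanded
  into a sequence of rules of the basic calculus, in one fixed order (right rules are applied
  before left rules in an inversion, and in a bi-focus); other orders give equivalent results.
  \<open>expand_LP \<pi> g \<alpha>\<close> turns \<open>\<alpha> : S \<Rightarrow>\<^sub>\<pi>\<^sub>g T\<close> into a derivation of \<open>\<pi>\<^sup>+ S \<Rightarrow>\<^sub>g T\<close>, and dually for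
  \<open>expand_RN\<close>.\<close>

fun expand_LP :: "'a list \<Rightarrow> 'a \<Rightarrow> ('d, 'a) der \<Rightarrow> ('d, 'a) der" where
  "expand_LP [] g \<alpha> = \<alpha>"
| "expand_LP (f # \<pi>) g \<alpha> = expand_LP \<pi> g (LP f (pre \<pi> g) \<alpha>)"

fun expand_RN :: "'a \<Rightarrow> 'a list \<Rightarrow> ('d, 'a) der \<Rightarrow> ('d, 'a) der" where
  "expand_RN f [] \<alpha> = \<alpha>"
| "expand_RN f (g # \<rho>) \<alpha> = RN f g (expand_RN (f \<cdot> g) \<rho> \<alpha>)"

primrec underlying :: "('d, 'a) mmf \<Rightarrow> ('d, 'a) der" where
  "underlying (MAx \<delta>) = Ax \<delta>"
| "underlying (Inv \<pi> f \<rho> d) = expand_LP \<pi> f (expand_RN (pre \<pi> f) \<rho> (underlying d))"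
| "underlying (LFoc \<sigma> d) = foldr LN \<sigma> (underlying d)"
| "underlying (RFoc d \<tau>) = fold RP \<tau> (underlying d)"
| "underlying (BFoc \<sigma> d \<tau>) = foldr LN \<sigma> (fold RP \<tau> (underlying d))"

end


section \<open>Computability\<close>

definition minimization :: "(nat \<Rightarrow> nat option) \<Rightarrow> nat option" where
  "minimization f =
    (if \<exists>n. f n = Some 0 \<and> (\<forall>m<n. \<exists>v. f m = Some (Suc v))
     then Some (LEAST n. f n = Some 0) else None)"

text \<open>Unary partial recursive functions, with tuples of arguments coded by \<open>prod_encode\<close>.\<close>

inductive partial_recursive :: "(nat \<Rightarrow> nat option) \<Rightarrow> bool" where
  zero: "partial_recursive (\<lambda>_. Some 0)"
| succ: "partial_recursive (\<lambda>n. Some (Suc n))"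
| left: "partial_recursive (\<lambda>n. Some (fst (prod_decode n)))"
| right: "partial_recursive (\<lambda>n. Some (snd (prod_decode n)))"
| pair: "\<lbrakk>partial_recursive f; partial_recursive g\<rbrakk> \<Longrightarrow>
    partial_recursive (\<lambda>n. Option.bind (f n) (\<lambda>a. Option.bind (g n) (\<lambda>b. Some (prod_encode (a, b)))))"
| comp: "\<lbrakk>partial_recursive f; partial_recursive g\<rbrakk> \<Longrightarrow>
    partial_recursive (\<lambda>n. Option.bind (g n) f)"
| prec: "\<lbrakk>partial_recursive f; partial_recursive g\<rbrakk> \<Longrightarrow>
    partial_recursive (\<lambda>n. case prod_decode n of (a, k) \<Rightarrow>
      rec_nat (f a) (\<lambda>y r. Option.bind r (\<lambda>i. g (prod_encode (a, prod_encode (y, i))))) k)"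
| min: "partial_recursive f \<Longrightarrow>
    partial_recursive (\<lambda>a. minimization (\<lambda>n. f (prod_encode (a, n))))"

text \<open>Algorithms only have to be correct, and to terminate, on (codes of) legitimate inputs:
  \<open>I\<close> is the set of these inputs, \<open>enc\<close> codes them as numbers, and \<open>R i m\<close> says that the output
  \<open>m\<close> is correct for \<open>i\<close>.\<close>

definition solvable :: "'i set \<Rightarrow> ('i \<Rightarrow> nat) \<Rightarrow> ('i \<Rightarrow> nat \<Rightarrow> bool) \<Rightarrow> bool" where
  "solvable I enc R \<longleftrightarrow>
    (\<exists>r. partial_recursive r \<and> (\<forall>i \<in> I. \<exists>m. r (enc i) = Some m \<and> R i m))"

definition decidable :: "'i set \<Rightarrow> ('i \<Rightarrow> nat) \<Rightarrow> ('i \<Rightarrow> bool) \<Rightarrow> bool" where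
  "decidable I enc Q \<longleftrightarrow> solvable I enc (\<lambda>i m. m = (if Q i then 1 else 0))"

definition enc3 :: "nat \<times> nat \<times> nat \<Rightarrow> nat" where
  "enc3 = (\<lambda>(a, b, c). prod_encode (a, prod_encode (b, c)))"

definition enc4 :: "nat \<times> nat \<times> nat \<times> nat \<Rightarrow> nat" where
  "enc4 = (\<lambda>(a, b, c, d). prod_encode (a, enc3 (b, c, d)))"

text \<open>A notation for the objects and arrows of a category: \<open>ocode\<close> and \<open>acode\<close> are the sets of
  valid codes, and \<open>oden\<close> and \<open>aden\<close> give the denoted object or arrow. Something may have several
  codes, and validity of codes need not be decidable.\<close>

record ('o, 'a) notat =
  ocode :: "nat set"
  oden :: "nat \<Rightarrow> 'o"
  acode :: "nat set"
  aden :: "nat \<Rightarrow> 'a"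

definition effective_category :: "('o, 'a) cat \<Rightarrow> ('o, 'a) notat \<Rightarrow> bool" where
  "effective_category C R \<longleftrightarrow>
    oden R ` ocode R = Obj C \<and> aden R ` acode R = Arr C \<and>
    solvable (acode R) id (\<lambda>m n. n \<in> ocode R \<and> oden R n = Dom C (aden R m)) \<and>
    solvable (acode R) id (\<lambda>m n. n \<in> ocode R \<and> oden R n = Cod C (aden R m)) \<and>
    solvable (ocode R) id (\<lambda>m n. n \<in> acode R \<and> aden R n = Id C (oden R m)) \<and>
    solvable {(m, n). m \<in> acode R \<and> n \<in> acode R \<and> Cod C (aden R m) = Dom C (aden R n)} prod_encode
      (\<lambda>(m, n) k. k \<in> acode R \<and> aden R k = aden R m \<cdot>\<^bsub>C\<^esub> aden R n) \<and>
    decidable (acode R \<times> acode R) prod_encode (\<lambda>(m, n). aden R m = aden R n)"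

definition effective_functor ::
  "('x, 'd, 'o, 'a) ftr \<Rightarrow> ('x, 'd) notat \<Rightarrow> ('o, 'a) notat \<Rightarrow> bool" where
  "effective_functor p RD RC \<longleftrightarrow>
    solvable (ocode RD) id (\<lambda>m n. n \<in> ocode RC \<and> oden RC n = fobj p (oden RD m)) \<and>
    solvable (acode RD) id (\<lambda>m n. n \<in> acode RC \<and> aden RC n = farr p (aden RD m))"

text \<open>A square \<open>a b = c d\<close> has the diagonal filler \<open>e\<close> if \<open>c = a e\<close> and \<open>b = e d\<close>. The output is
  \<open>0\<close> if there is no filler, and \<open>Suc k\<close> for some code \<open>k\<close> of a filler otherwise.\<close>

definition effective_fillers :: "('o, 'a) cat \<Rightarrow> ('o, 'a) notat \<Rightarrow> bool" where
  "effective_fillers C R \<longleftrightarrow>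
    solvable
      {(a, b, c, d). {a, b, c, d} \<subseteq> acode R \<and>
         Cod C (aden R a) = Dom C (aden R b) \<and> Cod C (aden R c) = Dom C (aden R d) \<and>
         Dom C (aden R a) = Dom C (aden R c) \<and> Cod C (aden R b) = Cod C (aden R d) \<and>
         aden R a \<cdot>\<^bsub>C\<^esub> aden R b = aden R c \<cdot>\<^bsub>C\<^esub> aden R d}
      enc4
      (\<lambda>(a, b, c, d) m.
         let fillers = {e \<in> hom C (Cod C (aden R a)) (Dom C (aden R d)).
                          aden R c = aden R a \<cdot>\<^bsub>C\<^esub> e \<and> aden R b = e \<cdot>\<^bsub>C\<^esub> aden R d}
         in if fillers = {} then m = 0 else \<exists>k \<in> acode R. m = Suc k \<and> aden R k \<in> fillers)"

definition effective_data ::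
  "('o, 'a) cat \<Rightarrow> ('x, 'd) cat \<Rightarrow> ('x, 'd, 'o, 'a) ftr \<Rightarrow> 'a set \<Rightarrow> 'a set \<Rightarrow>
   ('o, 'a) notat \<Rightarrow> ('x, 'd) notat \<Rightarrow> bool" where
  "effective_data C D p \<P> \<N> RC RD \<longleftrightarrow>
    effective_category C RC \<and> effective_category D RD \<and> effective_functor p RD RC \<and>
    decidable (acode RC) id (\<lambda>n. aden RC n \<in> \<P>) \<and>
    decidable (acode RC) id (\<lambda>n. aden RC n \<in> \<N>) \<and>
    effective_fillers C RC"

text \<open>\<open>m\<close> codes a list of codes that enumerates the set \<open>E\<close>.\<close>

definition enumerates :: "('o, 'a) notat \<Rightarrow> nat \<Rightarrow> 'a set \<Rightarrow> bool" where
  "enumerates R m E \<longleftrightarrow> set (list_decode m) \<subseteq> acode R \<and> aden R ` set (list_decode m) = E"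

definition effective_relative_homs ::
  "('o, 'a) cat \<Rightarrow> ('x, 'd) cat \<Rightarrow> ('x, 'd, 'o, 'a) ftr \<Rightarrow> ('o, 'a) notat \<Rightarrow> ('x, 'd) notat \<Rightarrow> bool"
  where
  "effective_relative_homs C D p RC RD \<longleftrightarrow>
    solvable
      {(x, f, y). x \<in> ocode RD \<and> f \<in> acode RC \<and> y \<in> ocode RD \<and>
         fobj p (oden RD x) = Dom C (aden RC f) \<and> fobj p (oden RD y) = Cod C (aden RC f)}
      enc3
      (\<lambda>(x, f, y) m. enumerates RD m (hom_over D p (oden RD x) (aden RC f) (oden RD y)))"

definition effective_slices :: "('o, 'a) cat \<Rightarrow> ('o, 'a) notat \<Rightarrow> bool" where
  "effective_slices C R \<longleftrightarrow>
    solvable {(f, g). f \<in> acode R \<and> g \<in> acode R \<and> Cod C (aden R f) = Cod C (aden R g)} prod_encode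
      (\<lambda>(f, g) m. enumerates R m
         {e. (aden R f, e, aden R g) \<in> hom (slice C (Cod C (aden R f))) (aden R f) (aden R g)})"

definition effective_coslices :: "('o, 'a) cat \<Rightarrow> ('o, 'a) notat \<Rightarrow> bool" where
  "effective_coslices C R \<longleftrightarrow>
    solvable {(f, g). f \<in> acode R \<and> g \<in> acode R \<and> Dom C (aden R f) = Dom C (aden R g)} prod_encode
      (\<lambda>(f, g) m. enumerates R m
         {e. (aden R f, e, aden R g) \<in> hom (coslice C (Dom C (aden R f))) (aden R f) (aden R g)})"

text \<open>Formulas and derivations are presented to algorithms as trees labelled by codes of objects
  and arrows, which are then numbered.\<close>

primrec enc_fm :: "(nat, nat) fm \<Rightarrow> nat" where
  "enc_fm (Atom x) = prod_encode (0, x)"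
| "enc_fm (Pos f S) = prod_encode (1, prod_encode (f, enc_fm S))"
| "enc_fm (Neg g T) = prod_encode (2, prod_encode (g, enc_fm T))"

primrec enc_der :: "(nat, nat) der \<Rightarrow> nat" where
  "enc_der (Ax d) = prod_encode (0, d)"
| "enc_der (LP f g \<alpha>) = prod_encode (1, enc3 (f, g, enc_der \<alpha>))"
| "enc_der (RP f \<alpha>) = prod_encode (2, prod_encode (f, enc_der \<alpha>))"
| "enc_der (LN g \<alpha>) = prod_encode (3, prod_encode (g, enc_der \<alpha>))"
| "enc_der (RN f g \<alpha>) = prod_encode (4, enc3 (f, g, enc_der \<alpha>))"

context bif
begin

definition fm_codes :: "('o, 'a) notat \<Rightarrow> ('x, 'd) notat \<Rightarrow> (nat, nat) fm set" where
  "fm_codes RC RD = {s. set1_fm s \<subseteq> ocode RD \<and> set2_fm s \<subseteq> acode RC \<and>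
     (\<exists>A. formula (map_fm (oden RD) (aden RC) s) A)}"

definition der_codes :: "('o, 'a) notat \<Rightarrow> ('x, 'd) notat \<Rightarrow> (nat, nat) der set" where
  "der_codes RC RD = {t. set1_der t \<subseteq> acode RD \<and> set2_der t \<subseteq> acode RC \<and>
     (\<exists>S h T. derives (map_der (aden RD) (aden RC) t) S h T)}"

definition permeq_decidable :: "('o, 'a) notat \<Rightarrow> ('x, 'd) notat \<Rightarrow> bool" where
  "permeq_decidable RC RD \<longleftrightarrow>
    decidable (der_codes RC RD \<times> der_codes RC RD)
      (\<lambda>(t, u). prod_encode (enc_der t, enc_der u))
      (\<lambda>(t, u). map_der (aden RD) (aden RC) t \<sim> map_der (aden RD) (aden RC) u)"

definition logical_equivalence_decidable :: "('o, 'a) notat \<Rightarrow> ('x, 'd) notat \<Rightarrow> bool" where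
  "logical_equivalence_decidable RC RD \<longleftrightarrow>
    decidable (fm_codes RC RD \<times> fm_codes RC RD)
      (\<lambda>(s, t). prod_encode (enc_fm s, enc_fm t))
      (\<lambda>(s, t). logically_equivalent (map_fm (oden RD) (aden RC) s) (map_fm (oden RD) (aden RC) t))"

end

end

theory Submission
  imports Defs
begin

text \<open>Permutation equivalence is generated by exchanging a left rule with an adjacent right rule.
  Oriented so that left rules move down, every exchange is deterministic: the only one that needs
  a choice, an \<open>RN\<close> passing an \<open>LN\<close>, asks for a diagonal filler of a square whose outer sides lie
  in \<open>\<N>\<close>, and such a filler is unique. Inserting the rules of a derivation one after the other
  therefore yields a normal form that is constant on equivalence classes and is computable when
  fillers are. The normal forms show that all four rules are cancellable up to equivalence (for
  \<open>RP\<close> this uses uniqueness of fillers in \<open>\<P>\<close>), and that a derivation which is equivalent both to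
  one ending in \<open>RP\<close> and to one ending in \<open>LN\<close> is equivalent to one ending in both.

  From this the multifocused derivations are classified by the outermost blocks of the sequent: after
  inversion, a derivation ends, up to equivalence, in the whole left block, in the whole right
  block, or in both, and the maximality conditions on multifocused derivations say exactly that a
  block that could be moved down has been moved down.

  For the decidability of logical equivalence no metatheory of composition is needed: finiteness of
  slices and coslices makes the sets of derivations and of composites of representatives finite and
  enumerable, and the two equations between classes are checked on all representatives.\<close>

section \<open>Partial recursive functions\<close>

text \<open>Two of the four exchanges lose an arrow: moving \<open>LP\<close> below
  \<open>RP\<close> replaces \<open>g\<close> by \<open>g \<cdot> h\<close>, and moving
  \<open>RN\<close> below \<open>LN\<close> replaces \<open>g\<close> by \<open>f \<cdot> g\<close>.
  Going back means recovering \<open>g\<close> from both composites \<open>f \<cdot> g\<close> and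
  \<open>g \<cdot> h\<close>, that is, filling a square whose outer sides \<open>f\<close> and
  \<open>h\<close> lie in \<P> in the first case and in \<N> in the second; the two preorder
  hypotheses say that such fillers are unique. When left rules move down, the first exchange is met
  in its composing direction and the second in its recovering direction. This is why \<N> enters the
  definition of normal forms, while \<P> enters only when insertion of \<open>RP\<close> is shown to
  be injective. The maximality conditions ask for the same fillers along whole blocks: with a
  filler, the block of the next focus could slide below the preceding inversion. Multifocused
  derivations are never computed with; the algorithms compare normal forms.\<close>

abbreviation total_recursive :: "(nat \<Rightarrow> nat) \<Rightarrow> bool" where
  "total_recursive f \<equiv> partial_recursive (\<lambda>n. Some (f n))"

lemma partial_recursive_comp_total:
  "\<lbrakk>partial_recursive f; total_recursive g\<rbrakk> \<Longrightarrow> partial_recursive (\<lambda>n. f (g n))"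
  using partial_recursive.comp[of f "\<lambda>n. Some (g n)"] by simp

lemma total_recursive_pair:
  "\<lbrakk>total_recursive f; total_recursive g\<rbrakk> \<Longrightarrow> total_recursive (\<lambda>n. prod_encode (f n, g n))"
  using partial_recursive.pair[of "\<lambda>n. Some (f n)" "\<lambda>n. Some (g n)"] by simp

lemma total_recursive_id: "total_recursive (\<lambda>n. n)"
  using total_recursive_pair[OF partial_recursive.left partial_recursive.right] by simp

lemma total_recursive_fst: "total_recursive f \<Longrightarrow> total_recursive (\<lambda>n. fst (prod_decode (f n)))"
  by (rule partial_recursive_comp_total[OF partial_recursive.left])

lemma total_recursive_snd: "total_recursive f \<Longrightarrow> total_recursive (\<lambda>n. snd (prod_decode (f n)))"
  by (rule partial_recursive_comp_total[OF partial_recursive.right])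

lemma total_recursive_Suc: "total_recursive f \<Longrightarrow> total_recursive (\<lambda>n. Suc (f n))"
  by (rule partial_recursive_comp_total[OF partial_recursive.succ])

lemma total_recursive_const: "total_recursive (\<lambda>_. k)"
  by (induction k) (simp_all add: partial_recursive.zero total_recursive_Suc)

lemma partial_recursive_bind:
  assumes "partial_recursive k" "partial_recursive h"
  shows "partial_recursive (\<lambda>n. Option.bind (k n) (\<lambda>i. h (prod_encode (n, i))))"
  using partial_recursive.comp[OF assms(2) partial_recursive.pair[OF total_recursive_id assms(1)]]
  by (simp add: Option.bind_assoc)

lemma partial_recursive_rec:
  assumes "partial_recursive f" "partial_recursive g" "total_recursive a" "total_recursive k"
  shows "partial_recursive (\<lambda>n. rec_nat (f (a n))
           (\<lambda>y r. Option.bind r (\<lambda>i. g (prod_encode (a n, prod_encode (y, i))))) (k n))"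
  using partial_recursive_comp_total[OF partial_recursive.prec[OF assms(1,2)]
      total_recursive_pair[OF assms(3,4)]] by simp

lemma total_recursive_rec:
  assumes "total_recursive f" "total_recursive g" "total_recursive a" "total_recursive k"
  shows "total_recursive (\<lambda>n. rec_nat (f (a n))
           (\<lambda>y i. g (prod_encode (a n, prod_encode (y, i)))) (k n))"
proof -
  have "rec_nat (Some u) (\<lambda>y r. Option.bind r (\<lambda>i. Some (h y i))) m = Some (rec_nat u h m)"
    for u m and h :: "nat \<Rightarrow> nat \<Rightarrow> nat" by (induction m) simp_all
  with partial_recursive_rec[OF assms] show ?thesis by simp
qed

lemma total_recursive_add:
  assumes "total_recursive f" "total_recursive g"
  shows "total_recursive (\<lambda>n. f n + g n)"
proof -
  have "rec_nat a (\<lambda>y i. Suc i) k = a + k" for a k by (induction k) simp_all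
  with total_recursive_rec[OF total_recursive_id
      total_recursive_Suc[OF total_recursive_snd[OF total_recursive_snd[OF total_recursive_id]]] assms]
  show ?thesis by simp
qed

lemma total_recursive_pred:
  assumes "total_recursive f"
  shows "total_recursive (\<lambda>n. f n - 1)"
proof -
  have "rec_nat 0 (\<lambda>y i. y) k = k - 1" for k :: nat by (induction k) simp_all
  with total_recursive_rec[OF total_recursive_const[of 0]
      total_recursive_fst[OF total_recursive_snd[OF total_recursive_id]] total_recursive_id assms]
  show ?thesis by simp
qed

lemma total_recursive_diff:
  assumes "total_recursive f" "total_recursive g"
  shows "total_recursive (\<lambda>n. f n - g n)"
proof -
  have "rec_nat a (\<lambda>y i. i - 1) k = a - k" for a k :: nat by (induction k) simp_all
  with total_recursive_rec[OF total_recursive_id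
      total_recursive_pred[OF total_recursive_snd[OF total_recursive_snd[OF total_recursive_id]]] assms]
  show ?thesis by simp
qed

lemmas total_recursive_intros = total_recursive_pair total_recursive_fst total_recursive_snd
  total_recursive_Suc total_recursive_diff total_recursive_add total_recursive_const total_recursive_id

text \<open>The branches must not be evaluated eagerly, since they may be undefined; the branch that is
  not taken is skipped by a recursion of length 0.\<close>

lemma partial_recursive_guard:
  assumes "total_recursive c" "partial_recursive f"
  shows "partial_recursive (\<lambda>n. if c n = 0 then Some 0 else f n)"
proof -
  have "partial_recursive (\<lambda>n. rec_nat (Some 0)
          (\<lambda>y r. Option.bind r (\<lambda>i. f (fst (prod_decode (prod_encode (n, prod_encode (y, i)))))))
          (1 - (1 - c n)))"
    by (rule partial_recursive_rec[of "\<lambda>_. Some 0" "\<lambda>n. f (fst (prod_decode n))" "\<lambda>n. n"])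
      (intro total_recursive_intros assms partial_recursive_comp_total[OF assms(2)])+
  moreover have "rec_nat (Some 0) (\<lambda>y r. Option.bind r (\<lambda>i. v)) (1 - (1 - m))
      = (if m = 0 then Some 0 else v)" for m :: nat and v :: "nat option"
    by (cases m) simp_all
  ultimately show ?thesis by simp
qed

text \<open>The branches are guarded by complementary tests and their values are added: the branch
  not taken contributes 0 even where it is undefined. Equality is tested by the sum of both
  truncated differences.\<close>

lemma partial_recursive_if:
  assumes "total_recursive u" "total_recursive v" "partial_recursive f" "partial_recursive g"
  shows "partial_recursive (\<lambda>n. if u n = v n then f n else g n)"
proof -
  define c where "c n = (u n - v n) + (v n - u n)" for n
  have c: "total_recursive c" unfolding c_def by (intro total_recursive_intros assms)
  have c': "total_recursive (\<lambda>n. 1 - c n)" by (intro total_recursive_intros c)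
  have add: "partial_recursive (\<lambda>n. Some (fst (prod_decode n) + snd (prod_decode n)))"
    by (intro total_recursive_intros)
  have "partial_recursive (\<lambda>n. Option.bind (if 1 - c n = 0 then Some 0 else f n)
      (\<lambda>a. Option.bind (if c n = 0 then Some 0 else g n) (\<lambda>b. Some (a + b))))"
    using partial_recursive.comp[OF add partial_recursive.pair[OF
          partial_recursive_guard[OF c' assms(3)] partial_recursive_guard[OF c assms(4)]]]
    by (simp add: Option.bind_assoc)
  moreover have "Option.bind (if 1 - c n = 0 then Some 0 else f n)
      (\<lambda>a. Option.bind (if c n = 0 then Some 0 else g n) (\<lambda>b. Some (a + b)))
    = (if u n = v n then f n else g n)" for n
  proof (cases "u n = v n")
    case True
    then show ?thesis by (simp add: c_def)
  next
    case False
    then have "c n \<noteq> 0" by (auto simp: c_def)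
    with False show ?thesis by (simp add: Suc_leI)
  qed
  ultimately show ?thesis by simp
qed


section \<open>Computable functions between represented sets\<close>

text \<open>A representation \<open>A\<close> relates elements to their codes; the elements without a code lie outside
  the represented set. An element may have several codes, and a computable function has to
  respect this by being a function of the element alone.\<close>

type_synonym 'a rep = "nat \<Rightarrow> 'a \<Rightarrow> bool"

definition computable :: "'a rep \<Rightarrow> 'b rep \<Rightarrow> ('a \<Rightarrow> 'b) \<Rightarrow> bool" where
  "computable A B f \<longleftrightarrow>
    (\<exists>r. partial_recursive r \<and> (\<forall>n x. A n x \<longrightarrow> (\<exists>m. r n = Some m \<and> B m (f x))))"

text \<open>Operations such as composition are computable only where they are meaningful; narrowing
  the represented set expresses this while the functions themselves stay total.\<close>

definition restrict :: "'a rep \<Rightarrow> ('a \<Rightarrow> bool) \<Rightarrow> 'a rep" where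
  "restrict A P n x \<longleftrightarrow> A n x \<and> P x"

definition rnat :: "nat rep" where
  "rnat n k \<longleftrightarrow> n = k"

definition rbool :: "bool rep" where
  "rbool n b \<longleftrightarrow> n = (if b then 1 else 0)"

definition rprod :: "'a rep \<Rightarrow> 'b rep \<Rightarrow> ('a \<times> 'b) rep" where
  "rprod A B n z \<longleftrightarrow> A (fst (prod_decode n)) (fst z) \<and> B (snd (prod_decode n)) (snd z)"

text \<open>The output convention of \<open>effective_fillers\<close>: 0 for failure,
  \<open>Suc k\<close> for a witness with code \<open>k\<close>.\<close>

definition roption :: "'a rep \<Rightarrow> 'a option rep" where
  "roption A n z \<longleftrightarrow> (case z of None \<Rightarrow> n = 0 | Some x \<Rightarrow> \<exists>m. n = Suc m \<and> A m x)"

definition rlist :: "'a rep \<Rightarrow> 'a list rep" where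
  "rlist A n xs \<longleftrightarrow> list_all2 A (list_decode n) xs"

text \<open>As in \<open>enumerates\<close>, any order, repetitions and different codes of the same
  element are allowed, so unions are formed by appending lists, without an equality test.\<close>

definition rset :: "'a rep \<Rightarrow> 'a set rep" where
  "rset A n X \<longleftrightarrow> (\<exists>xs. rlist A n xs \<and> set xs = X)"

lemma computableE:
  assumes "computable A B f"
  obtains r where "partial_recursive r" "\<And>n x. A n x \<Longrightarrow> \<exists>m. r n = Some m \<and> B m (f x)"
  using assms unfolding computable_def by blast

lemma computableI:
  assumes "partial_recursive r" "\<And>n x. A n x \<Longrightarrow> \<exists>m. r n = Some m \<and> B m (f x)"
  shows "computable A B f"
  using assms unfolding computable_def by blast

lemma computable_totalI:
  assumes "total_recursive r" "\<And>n x. A n x \<Longrightarrow> B (r n) (f x)"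
  shows "computable A B f"
  using assms by (intro computableI[of "\<lambda>n. Some (r n)"]) auto

lemma computable_cong:
  assumes "computable A' B f" "\<And>n x. A n x \<Longrightarrow> A' n x \<and> f x = g x"
  shows "computable A B g"
  using assms unfolding computable_def by metis

lemma computable_restrict: "computable A B f \<Longrightarrow> computable (restrict A P) B f"
  unfolding computable_def restrict_def by blast

text \<open>Passage from the specification of a given algorithm, whose output may be any correct
  code, to a function of the denoted elements. \<open>decidable_computable\<close> goes the other
  way at the end.\<close>

lemma computable_solvable:
  assumes "solvable I enc R" "\<And>n x. A n x \<Longrightarrow> \<exists>i\<in>I. enc i = n \<and> (\<forall>m. R i m \<longrightarrow> B m (f x))"
  shows "computable A B f"
  using assms unfolding computable_def solvable_def by metis

lemma computable_decidable:
  assumes "decidable I enc Q" "\<And>n x. A n x \<Longrightarrow> \<exists>i\<in>I. enc i = n \<and> Q i = P x"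
  shows "computable A rbool P"
  using assms(1) unfolding decidable_def
  by (rule computable_solvable) (use assms(2) in \<open>auto simp: rbool_def\<close>)

lemma decidable_computable:
  assumes "computable A rbool P" "\<And>i. i \<in> I \<Longrightarrow> \<exists>x. A (enc i) x \<and> P x = Q i"
  shows "decidable I enc Q"
proof -
  obtain r where r: "partial_recursive r" "\<And>n x. A n x \<Longrightarrow> \<exists>m. r n = Some m \<and> rbool m (P x)"
    using assms(1) by (rule computableE) blast
  have "\<exists>m. r (enc i) = Some m \<and> m = (if Q i then 1 else 0)" if "i \<in> I" for i
    using assms(2)[OF that] r(2) unfolding rbool_def by metis
  with r(1) show ?thesis unfolding decidable_def solvable_def by blast
qed

lemma computable_comp:
  assumes "computable A B f" "computable B C g"
  shows "computable A C (\<lambda>x. g (f x))"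
proof -
  obtain r where r: "partial_recursive r" "\<And>n x. A n x \<Longrightarrow> \<exists>m. r n = Some m \<and> B m (f x)"
    using assms(1) by (rule computableE) blast
  obtain s where s: "partial_recursive s" "\<And>n x. B n x \<Longrightarrow> \<exists>m. s n = Some m \<and> C m (g x)"
    using assms(2) by (rule computableE) blast
  show ?thesis
    by (rule computableI[OF partial_recursive.comp[OF s(1) r(1)]]) (use r(2) s(2) in fastforce)
qed

lemma computable_id: "computable A A (\<lambda>x. x)"
  by (rule computable_totalI[OF total_recursive_id])

lemma computable_pair:
  assumes "computable A B f" "computable A C g"
  shows "computable A (rprod B C) (\<lambda>x. (f x, g x))"
proof -
  obtain r where r: "partial_recursive r" "\<And>n x. A n x \<Longrightarrow> \<exists>m. r n = Some m \<and> B m (f x)"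
    using assms(1) by (rule computableE) blast
  obtain s where s: "partial_recursive s" "\<And>n x. A n x \<Longrightarrow> \<exists>m. s n = Some m \<and> C m (g x)"
    using assms(2) by (rule computableE) blast
  show ?thesis
    by (rule computableI[OF partial_recursive.pair[OF r(1) s(1)]])
      (use r(2) s(2) in \<open>fastforce simp: rprod_def\<close>)
qed

lemma computable_fst: "computable A (rprod B C) f \<Longrightarrow> computable A B (\<lambda>x. fst (f x))"
  by (erule computable_comp, rule computable_totalI[OF partial_recursive.left]) (simp add: rprod_def)

lemma computable_snd: "computable A (rprod B C) f \<Longrightarrow> computable A C (\<lambda>x. snd (f x))"
  by (erule computable_comp, rule computable_totalI[OF partial_recursive.right]) (simp add: rprod_def)

lemma computable_comp_pair:
  assumes "computable (rprod B C) D (\<lambda>z. h (fst z) (snd z))" "computable A B f" "computable A C g"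
  shows "computable A D (\<lambda>x. h (f x) (g x))"
  using computable_comp[OF computable_pair[OF assms(2,3)] assms(1)] by simp

lemma computable_nat_const: "computable A rnat (\<lambda>_. k)"
  by (rule computable_totalI[OF total_recursive_const[of k]]) (simp add: rnat_def)

lemma computable_bool_const: "computable A rbool (\<lambda>_. b)"
  by (rule computable_totalI[OF total_recursive_const[of "if b then 1 else 0"]]) (simp add: rbool_def)

text \<open>The continuation \<open>h\<close> sees the code of the argument together with a code of
  \<open>e x\<close>. Case distinctions are instances in which \<open>h\<close> inspects the
  latter.\<close>

lemma computable_bind:
  assumes "computable A T e" "partial_recursive h"
    and "\<And>n x m. \<lbrakk>A n x; T m (e x)\<rbrakk> \<Longrightarrow> \<exists>k. h (prod_encode (n, m)) = Some k \<and> B k (F x)"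
  shows "computable A B F"
proof -
  obtain r where r: "partial_recursive r" "\<And>n x. A n x \<Longrightarrow> \<exists>m. r n = Some m \<and> T m (e x)"
    using assms(1) by (rule computableE) blast
  show ?thesis
  proof (rule computableI[OF partial_recursive_bind[OF r(1) assms(2)]])
    fix n x assume "A n x"
    then show "\<exists>m. Option.bind (r n) (\<lambda>i. h (prod_encode (n, i))) = Some m \<and> B m (F x)"
      using r(2) assms(3) by fastforce
  qed
qed

text \<open>Each branch is required only where it is taken, so that a decidable test can protect an
  operation that is computable only on legal inputs.\<close>

lemma computable_if_restrict:
  assumes "computable A rbool b" "computable (restrict A b) B f"
    and "computable (restrict A (\<lambda>x. \<not> b x)) B g"
  shows "computable A B (\<lambda>x. if b x then f x else g x)"
proof -
  obtain r where r: "partial_recursive r"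
      "\<And>n x. restrict A b n x \<Longrightarrow> \<exists>m. r n = Some m \<and> B m (f x)"
    using assms(2) by (rule computableE) blast
  obtain s where s: "partial_recursive s"
      "\<And>n x. restrict A (\<lambda>x. \<not> b x) n x \<Longrightarrow> \<exists>m. s n = Some m \<and> B m (g x)"
    using assms(3) by (rule computableE) blast
  show ?thesis
  proof (rule computable_bind[OF assms(1)])
    show "partial_recursive (\<lambda>n. if snd (prod_decode n) = 0
        then s (fst (prod_decode n)) else r (fst (prod_decode n)))"
      by (intro partial_recursive_if total_recursive_intros partial_recursive_comp_total[OF r(1)]
          partial_recursive_comp_total[OF s(1)])
  qed (use r(2) s(2) in \<open>auto simp: rbool_def restrict_def split: if_splits\<close>)
qed

lemma computable_if:
  "\<lbrakk>computable A rbool b; computable A B f; computable A B g\<rbrakk>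
    \<Longrightarrow> computable A B (\<lambda>x. if b x then f x else g x)"
  by (intro computable_if_restrict computable_restrict)

lemma computable_not: "computable A rbool b \<Longrightarrow> computable A rbool (\<lambda>x. \<not> b x)"
  by (rule computable_cong[OF computable_if[OF _ computable_bool_const[of _ False]
        computable_bool_const[of _ True]]]) auto

lemma computable_conj_restrict:
  assumes "computable A rbool b" "computable (restrict A b) rbool c"
  shows "computable A rbool (\<lambda>x. b x \<and> c x)"
  by (rule computable_cong[OF computable_if_restrict[OF assms computable_bool_const[of _ False]]]) auto

lemma computable_conj:
  "\<lbrakk>computable A rbool b; computable A rbool c\<rbrakk> \<Longrightarrow> computable A rbool (\<lambda>x. b x \<and> c x)"
  by (intro computable_conj_restrict computable_restrict)

lemma computable_None: "computable A (roption B) (\<lambda>_. None)"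
  by (rule computable_totalI[OF total_recursive_const[of 0]]) (simp add: roption_def)

lemma computable_Some: "computable A B f \<Longrightarrow> computable A (roption B) (\<lambda>x. Some (f x))"
  by (erule computable_comp, rule computable_totalI[OF partial_recursive.succ]) (simp add: roption_def)

lemma computable_case_option:
  assumes "computable A (roption T) e" "computable A B f"
    and "computable (rprod A T) B (\<lambda>z. g (fst z) (snd z))"
  shows "computable A B (\<lambda>x. case e x of None \<Rightarrow> f x | Some y \<Rightarrow> g x y)"
proof -
  obtain r where r: "partial_recursive r" "\<And>n x. A n x \<Longrightarrow> \<exists>m. r n = Some m \<and> B m (f x)"
    using assms(2) by (rule computableE) blast
  obtain s where s: "partial_recursive s"
      "\<And>n z. rprod A T n z \<Longrightarrow> \<exists>m. s n = Some m \<and> B m (g (fst z) (snd z))"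
    using assms(3) by (rule computableE) blast
  let ?h = "\<lambda>n. if snd (prod_decode n) = 0 then r (fst (prod_decode n))
    else s (prod_encode (fst (prod_decode n), snd (prod_decode n) - 1))"
  show ?thesis
  proof (rule computable_bind[OF assms(1)])
    show "partial_recursive ?h"
      by (intro partial_recursive_if total_recursive_intros partial_recursive_comp_total[OF r(1)]
          partial_recursive_comp_total[OF s(1)])
    fix n x m assume "A n x" "roption T m (e x)"
    then show "\<exists>k. ?h (prod_encode (n, m)) = Some k \<and> B k (case e x of None \<Rightarrow> f x | Some y \<Rightarrow> g x y)"
      using r(2)[of n x] s(2)[of "prod_encode (n, m - 1)" "(x, the (e x))"]
      by (auto simp: roption_def rprod_def split: option.splits)
  qed
qed

lemma computable_Nil: "computable A (rlist B) (\<lambda>_. [])"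
  by (rule computable_totalI[OF total_recursive_const[of 0]]) (simp add: rlist_def)

lemma computable_Cons:
  assumes "computable A B f" "computable A (rlist B) g"
  shows "computable A (rlist B) (\<lambda>x. f x # g x)"
proof (rule computable_comp_pair[OF computable_totalI[OF partial_recursive.succ] assms])
  fix n and z :: "'b \<times> 'b list" assume "rprod B (rlist B) n z"
  then show "rlist B (Suc n) (fst z # snd z)"
    by (cases "prod_decode n") (auto simp: rlist_def rprod_def)
qed

lemma computable_case_list:
  assumes "computable A (rlist T) e" "computable A B f"
    and "computable (rprod A (rprod T (rlist T))) B (\<lambda>z. g (fst z) (fst (snd z)) (snd (snd z)))"
  shows "computable A B (\<lambda>x. case e x of [] \<Rightarrow> f x | y # ys \<Rightarrow> g x y ys)"
proof -
  obtain r where r: "partial_recursive r" "\<And>n x. A n x \<Longrightarrow> \<exists>m. r n = Some m \<and> B m (f x)"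
    using assms(2) by (rule computableE) blast
  obtain s where s: "partial_recursive s"
      "\<And>n z. rprod A (rprod T (rlist T)) n z
        \<Longrightarrow> \<exists>m. s n = Some m \<and> B m (g (fst z) (fst (snd z)) (snd (snd z)))"
    using assms(3) by (rule computableE) blast
  let ?h = "\<lambda>n. if snd (prod_decode n) = 0 then r (fst (prod_decode n))
    else s (prod_encode (fst (prod_decode n), snd (prod_decode n) - 1))"
  show ?thesis
  proof (rule computable_bind[OF assms(1)])
    show "partial_recursive ?h"
      by (intro partial_recursive_if total_recursive_intros partial_recursive_comp_total[OF r(1)]
          partial_recursive_comp_total[OF s(1)])
    fix n x m assume A: "A n x" "rlist T m (e x)"
    show "\<exists>k. ?h (prod_encode (n, m)) = Some k \<and> B k (case e x of [] \<Rightarrow> f x | y # ys \<Rightarrow> g x y ys)"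
    proof (cases m)
      case 0
      with A have "e x = []" by (simp add: rlist_def)
      with 0 A r(2) show ?thesis by simp
    next
      case (Suc i)
      with A obtain y ys where "e x = y # ys" "T (fst (prod_decode i)) y" "rlist T (snd (prod_decode i)) ys"
        by (auto simp: rlist_def list_all2_Cons1 split: prod.splits)
      with Suc A s(2)[of "prod_encode (n, i)" "(x, y, ys)"] show ?thesis by (simp add: rprod_def)
    qed
  qed
qed

text \<open>Descent and ascent are separated. Minimization finds the first \<open>k\<close> with
  \<open>b ((d ^^ k) x)\<close>; a primitive recursion of length \<open>k\<close> then applies
  \<open>g\<close> on the way back, recomputing its argument from the root at each level instead of
  keeping a stack. Termination is asked only of represented \<open>x\<close>, because in the
  branching case it comes from the finiteness of a coded set.\<close>

lemma computable_linear_recursion: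
  assumes b: "computable A rbool b" and f: "computable A B f" and d: "computable A A d"
    and g: "computable (rprod A B) B (\<lambda>z. g (fst z) (snd z))"
    and F: "\<And>x. F x = (if b x then f x else g x (F (d x)))"
    and stops: "\<And>n x. A n x \<Longrightarrow> \<exists>k. b ((d ^^ k) x)"
  shows "computable A B F"
proof -
  obtain rb where rb: "partial_recursive rb" "\<And>n x. A n x \<Longrightarrow> \<exists>m. rb n = Some m \<and> rbool m (b x)"
    using b by (rule computableE) blast
  obtain rf where rf: "partial_recursive rf" "\<And>n x. A n x \<Longrightarrow> \<exists>m. rf n = Some m \<and> B m (f x)"
    using f by (rule computableE) blast
  obtain rd where rd: "partial_recursive rd" "\<And>n x. A n x \<Longrightarrow> \<exists>m. rd n = Some m \<and> A m (d x)"
    using d by (rule computableE) blast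
  obtain rg where rg: "partial_recursive rg"
      "\<And>n z. rprod A B n z \<Longrightarrow> \<exists>m. rg n = Some m \<and> B m (g (fst z) (snd z))"
    using g by (rule computableE) blast
  define it where "it n k = rec_nat (Some n) (\<lambda>_ r. Option.bind r rd) k" for n k
  have pr_it: "partial_recursive (\<lambda>n. it (u n) (v n))" if "total_recursive u" "total_recursive v" for u v
  proof -
    have "partial_recursive (\<lambda>n. rd (snd (prod_decode (snd (prod_decode n)))))"
      by (intro partial_recursive_comp_total[OF rd(1)] total_recursive_intros)
    from partial_recursive_rec[OF total_recursive_id this that] show ?thesis by (simp add: it_def)
  qed
  have it: "\<exists>m. it n k = Some m \<and> A m ((d ^^ k) x)" if "A n x" for n x k
    using that by (induction k) (use rd(2) in \<open>fastforce simp: it_def\<close>)+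
  \<comment> \<open>Minimization searches for the value 0, hence the negated test
    \<open>1 - v\<close>.\<close>
  define test where "test n = Option.bind (it (fst (prod_decode n)) (snd (prod_decode n)))
    (\<lambda>m. Option.bind (rb m) (\<lambda>v. Some (1 - v)))" for n
  have pr_test: "partial_recursive test"
    unfolding test_def
    by (intro partial_recursive.comp partial_recursive.comp[OF _ rb(1)] pr_it total_recursive_intros)
  define K where "K n = minimization (\<lambda>k. test (prod_encode (n, k)))" for n
  have K: "K n = Some (LEAST k. b ((d ^^ k) x))" if "A n x" for n x
  proof -
    have t: "test (prod_encode (n, k)) = Some (if b ((d ^^ k) x) then 0 else 1)" for k
      using it[OF that, of k] rb(2) by (fastforce simp: test_def rbool_def)
    obtain j where "b ((d ^^ j) x)" using stops \<open>A n x\<close> by blast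
    then have "b ((d ^^ (LEAST k. b ((d ^^ k) x))) x)" by (rule LeastI)
    moreover have "\<not> b ((d ^^ m) x)" if "m < (LEAST k. b ((d ^^ k) x))" for m
      using not_less_Least[OF that] .
    ultimately have "\<exists>k. b ((d ^^ k) x) \<and> (\<forall>m<k. \<not> b ((d ^^ m) x))" by blast
    then have "\<exists>k. test (prod_encode (n, k)) = Some 0 \<and>
        (\<forall>m<k. \<exists>v. test (prod_encode (n, m)) = Some (Suc v))"
      by (simp add: t) blast
    moreover have "(LEAST k. test (prod_encode (n, k)) = Some 0) = (LEAST k. b ((d ^^ k) x))"
      by (rule arg_cong[of _ _ Least]) (simp add: t fun_eq_iff)
    ultimately show ?thesis unfolding K_def minimization_def by simp
  qed
  \<comment> \<open>After \<open>y\<close> rounds the value at \<open>(d ^^ (k - y)) x\<close> is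
    known; the next round needs the argument one level closer to the root,
    \<open>(d ^^ (k - Suc y)) x\<close>.\<close>
  define rF where "rF n = rec_nat
      (Option.bind (it (fst (prod_decode n)) (snd (prod_decode n))) rf)
      (\<lambda>y r. Option.bind r (\<lambda>i. Option.bind
         (it (fst (prod_decode n)) (snd (prod_decode n) - Suc y)) (\<lambda>m. rg (prod_encode (m, i)))))
      (snd (prod_decode n))" for n
  have pr_rF: "partial_recursive rF"
  proof -
    have *: "partial_recursive (\<lambda>n. Option.bind (it (fst (prod_decode n)) (snd (prod_decode n))) rf)"
      by (intro partial_recursive.comp[OF rf(1)] pr_it total_recursive_intros)
    let ?a = "\<lambda>n. fst (prod_decode n)" and ?y = "\<lambda>n. fst (prod_decode (snd (prod_decode n)))"
      and ?i = "\<lambda>n. snd (prod_decode (snd (prod_decode n)))"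
    have "partial_recursive (\<lambda>n. Option.bind (Option.bind
        (it (fst (prod_decode (?a n))) (snd (prod_decode (?a n)) - Suc (?y n)))
        (\<lambda>m. Option.bind (Some (?i n)) (\<lambda>i. Some (prod_encode (m, i))))) rg)"
      by (intro partial_recursive.comp[OF rg(1)] partial_recursive.pair pr_it total_recursive_intros)
    then have "partial_recursive (\<lambda>n. Option.bind 
        (it (fst (prod_decode (?a n))) (snd (prod_decode (?a n)) - Suc (?y n)))
        (\<lambda>m. rg (prod_encode (m, ?i n))))" by (simp add: Option.bind_assoc)
    from partial_recursive_rec[OF * this total_recursive_id partial_recursive.right]
    show ?thesis by (simp add: rF_def[abs_def])
  qed
  show ?thesis
  proof (rule computableI)
    have "partial_recursive K" unfolding K_def[abs_def] using pr_test by (rule partial_recursive.min)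
    then show "partial_recursive (\<lambda>n. Option.bind (K n) (\<lambda>k. rF (prod_encode (n, k))))"
      by (rule partial_recursive_bind[OF _ pr_rF])
    fix n x assume n: "A n x"
    define k where "k = (LEAST k. b ((d ^^ k) x))"
    obtain j where "b ((d ^^ j) x)" using stops n by blast
    then have bk: "b ((d ^^ k) x)" unfolding k_def by (rule LeastI)
    have nb: "\<not> b ((d ^^ m) x)" if "m < k" for m
      using not_less_Least that unfolding k_def by metis
    define R where "R = rec_nat (Option.bind (it n k) rf)
      (\<lambda>y r. Option.bind r (\<lambda>i. Option.bind (it n (k - Suc y)) (\<lambda>m. rg (prod_encode (m, i)))))"
    have "i \<le> k \<Longrightarrow> \<exists>m. R i = Some m \<and> B m (F ((d ^^ (k - i)) x))" for i
    proof (induction i)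
      case 0
      obtain m where "it n k = Some m" "A m ((d ^^ k) x)" using it[OF n] by blast
      with rf(2) bk F[of "(d ^^ k) x"] show ?case by (simp add: R_def)
    next
      case (Suc i)
      then obtain v where v: "R i = Some v" "B v (F ((d ^^ (k - i)) x))" by auto
      obtain m where m: "it n (k - Suc i) = Some m" "A m ((d ^^ (k - Suc i)) x)" using it[OF n] by blast
      have "R (Suc i) = rg (prod_encode (m, v))" using v m by (simp add: R_def)
      moreover have "F ((d ^^ (k - Suc i)) x) = g ((d ^^ (k - Suc i)) x) (F ((d ^^ (k - i)) x))"
        using F[of "(d ^^ (k - Suc i)) x"] nb[of "k - Suc i"] Suc.prems
          funpow.simps(2)[THEN fun_cong, of "k - Suc i" d x] Suc_diff_Suc[of i k]
        by simp
      ultimately show ?case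
        using rg(2)[of "prod_encode (m, v)" "((d ^^ (k - Suc i)) x, F ((d ^^ (k - i)) x))"] v m
        by (simp add: rprod_def)
    qed
    from this[of k] have "\<exists>m. R k = Some m \<and> B m (F x)" by simp
    moreover have "K n = Some k" using K[OF n] by (simp add: k_def)
    ultimately show "\<exists>m. Option.bind (K n) (\<lambda>k. rF (prod_encode (n, k))) = Some m \<and> B m (F x)"
      by (simp add: rF_def R_def)
  qed
qed


lemma computable_recursion:
  fixes \<mu> :: "'x \<Rightarrow> nat"
  assumes "computable A rbool b" "computable A B f" "computable A A d"
    and "computable (rprod A B) B (\<lambda>z. g (fst z) (snd z))"
    and "\<And>x. F x = (if b x then f x else g x (F (d x)))"
    and \<mu>: "\<And>x. \<not> b x \<Longrightarrow> \<mu> (d x) < \<mu> x"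
  shows "computable A B F"
proof (rule computable_linear_recursion[OF assms(1-5)])
  fix n x assume "A n x"
  show "\<exists>k. b ((d ^^ k) x)"
  proof (induction "\<mu> x" arbitrary: x rule: less_induct)
    case less
    show ?case
    proof (cases "b x")
      case True
      then have "b ((d ^^ 0) x)" by simp
      then show ?thesis by blast
    next
      case False
      from less.hyps[OF \<mu>[OF this]] obtain k where "b ((d ^^ k) (d x))" by blast
      then have "b ((d ^^ Suc k) x)" by (simp only: funpow_Suc_right o_def)
      then show ?thesis by blast
    qed
  qed
qed

lemma computable_nat_eq:
  assumes "computable A rnat f" "computable A rnat g"
  shows "computable A rbool (\<lambda>x. f x = g x)"
proof (rule computable_comp_pair[OF _ assms])
  show "computable (rprod rnat rnat) rbool (\<lambda>z. fst z = snd z)"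
    by (rule computableI[OF partial_recursive_if[OF partial_recursive.left partial_recursive.right
            total_recursive_const[of 1] total_recursive_const[of 0]]])
      (auto simp: rprod_def rnat_def rbool_def)
qed

lemma computable_comp_triple:
  assumes "computable (rprod E (rprod A B)) C (\<lambda>z. g (fst z) (fst (snd z)) (snd (snd z)))"
    and "computable X E a" "computable X A b" "computable X B c"
  shows "computable X C (\<lambda>x. g (a x) (b x) (c x))"
  using computable_comp[OF computable_pair[OF assms(2) computable_pair[OF assms(3,4)]] assms(1)] by simp

lemmas computable_intros = computable_id computable_pair computable_fst computable_snd
  computable_nat_const computable_bool_const computable_if computable_not computable_conj
  computable_None computable_Some computable_case_option computable_Nil computable_Cons
  computable_case_list computable_nat_eq

lemma computable_foldr:
  fixes E :: "'e rep" and A :: "'b rep"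
  assumes g: "computable (rprod E (rprod A B)) B (\<lambda>z. g (fst z) (fst (snd z)) (snd (snd z)))"
    and f: "computable E B f" and xs: "computable E (rlist A) xs"
  shows "computable E B (\<lambda>e. foldr (g e) (xs e) (f e))"
proof -
  have "computable (rprod E (rlist A)) B (\<lambda>z. foldr (g (fst z)) (snd z) (f (fst z)))"
  proof (rule computable_linear_recursion[where f = "\<lambda>z. f (fst z)"
        and b = "\<lambda>z. case snd z of [] \<Rightarrow> True | _ # _ \<Rightarrow> False"
        and d = "\<lambda>z. (fst z, case snd z of [] \<Rightarrow> [] | y # ys \<Rightarrow> ys)"
        and g = "\<lambda>z r. case snd z of [] \<Rightarrow> r | y # ys \<Rightarrow> g (fst z) y r"])
    show "computable (rprod (rprod E (rlist A)) B) B
      (\<lambda>z. case snd (fst z) of [] \<Rightarrow> snd z | y # ys \<Rightarrow> g (fst (fst z)) y (snd z))"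
      by (rule computable_intros computable_comp_triple[OF g])+
    show "computable (rprod E (rlist A)) B (\<lambda>z. f (fst z))"
      by (rule computable_comp[OF _ f] computable_intros)+
    fix n and z :: "'e \<times> 'b list"
    have "case snd (((\<lambda>z. (fst z, case snd z of [] \<Rightarrow> [] | y # ys \<Rightarrow> ys)) ^^ length ys) (e, ys)) of
       [] \<Rightarrow> True | _ # _ \<Rightarrow> False" for e :: 'e and ys :: "'b list"
      by (induction ys) (auto simp del: funpow.simps simp: funpow_Suc_right)
    from this[of "snd z" "fst z"]
    have "case snd (((\<lambda>z. (fst z, case snd z of [] \<Rightarrow> [] | y # ys \<Rightarrow> ys)) ^^ length (snd z)) z) of
       [] \<Rightarrow> True | _ # _ \<Rightarrow> False" by (simp only: prod.collapse)
    then show "\<exists>k. case snd (((\<lambda>z. (fst z, case snd z of [] \<Rightarrow> [] | y # ys \<Rightarrow> ys)) ^^ k) z) of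
       [] \<Rightarrow> True | _ # _ \<Rightarrow> False" by (rule exI)
  qed ((rule computable_intros)+, auto split: list.splits)
  from computable_comp[OF computable_pair[OF computable_id xs] this] show ?thesis by simp
qed

lemma computable_append:
  assumes "computable E (rlist A) f" "computable E (rlist A) g"
  shows "computable E (rlist A) (\<lambda>e. f e @ g e)"
proof -
  have "computable E (rlist A) (\<lambda>e. foldr Cons (f e) (g e))"
    by (rule computable_foldr[OF _ assms(2,1)] computable_intros)+
  moreover have "foldr Cons xs ys = xs @ ys" for xs ys :: "'b list" by (induction xs) simp_all
  ultimately show ?thesis by simp
qed

section \<open>Finite sets represented by lists\<close>

lemma finite_rset: "rset A n X \<Longrightarrow> finite X"
  by (auto simp: rset_def)

text \<open>An algorithm on lists is one on sets as soon as its result depends on the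
  \<open>set\<close> alone; applying \<open>h\<close> to \<open>set (snd z)\<close> in the premise
  expresses this independence.\<close>

lemma computable_rset:
  assumes "computable (rprod E (rlist A)) B (\<lambda>z. h (fst z) (set (snd z)))" "computable E (rset A) X"
  shows "computable E B (\<lambda>e. h e (X e))"
proof -
  obtain r where r: "partial_recursive r"
      "\<And>n z. rprod E (rlist A) n z \<Longrightarrow> \<exists>m. r n = Some m \<and> B m (h (fst z) (set (snd z)))"
    using assms(1) by (rule computableE) blast
  show ?thesis
  proof (rule computable_bind[OF assms(2) r(1)])
    fix n x m assume "E n x" "rset A m (X x)"
    then obtain xs where "rprod E (rlist A) (prod_encode (n, m)) (x, xs)" "set xs = X x"
      by (auto simp: rset_def rprod_def)
    with r(2) show "\<exists>k. r (prod_encode (n, m)) = Some k \<and> B k (h x (X x))" by fastforce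
  qed
qed

lemma computable_set: "computable E (rlist A) f \<Longrightarrow> computable E (rset A) (\<lambda>e. set (f e))"
  unfolding computable_def rset_def by blast

lemma computable_empty: "computable E (rset A) (\<lambda>_. {})"
  using computable_set[OF computable_Nil] by simp

lemma computable_singleton: "computable E A f \<Longrightarrow> computable E (rset A) (\<lambda>e. {f e})"
  using computable_set[OF computable_Cons[OF _ computable_Nil], of E A f] by simp

text \<open>The head of any list that codes the singleton is a code of its element. This lets a
  recursion run on sets, with \<open>{}\<close> as default where no element is at hand.\<close>

lemma computable_the_elem:
  assumes "computable E (rset A) (\<lambda>e. {f e})" shows "computable E A f"
proof -
  have "computable (restrict (rset A) (\<lambda>X. \<exists>x. X = {x})) A the_elem"
  proof (rule computable_totalI)
    show "total_recursive (\<lambda>n. fst (prod_decode (n - 1)))"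
      by (intro total_recursive_fst total_recursive_pred total_recursive_id)
    fix n and X :: "'b set" assume "restrict (rset A) (\<lambda>X. \<exists>x. X = {x}) n X"
    then obtain x xs where x: "X = {x}" "rlist A n xs" "set xs = {x}" by (auto simp: restrict_def rset_def)
    then obtain y ys where "xs = y # ys" by (cases xs) auto
    with x show "A (fst (prod_decode (n - 1))) (the_elem X)"
      by (cases n) (auto simp: rlist_def split: prod.splits)
  qed
  moreover have "computable E (restrict (rset A) (\<lambda>X. \<exists>x. X = {x})) (\<lambda>e. {f e})"
    using assms unfolding computable_def restrict_def by blast
  ultimately show ?thesis using computable_comp by fastforce
qed

lemma computable_union:
  assumes "computable E (rset A) f" "computable E (rset A) g"
  shows "computable E (rset A) (\<lambda>e. f e \<union> g e)"
proof -
  have "computable (rprod (rprod E (rlist A)) (rlist A)) (rset A)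
      (\<lambda>z. set (snd (fst z) @ snd z))"
    by (rule computable_set computable_append computable_intros)+
  then have "computable (rprod (rprod E (rlist A)) (rlist A)) (rset A)
      (\<lambda>z. set (snd (fst z)) \<union> set (snd z))" by simp
  from computable_rset[where h = "\<lambda>z Y. set (snd z) \<union> Y", OF this
      computable_comp[OF computable_fst[OF computable_id] assms(2)]]
  have "computable (rprod E (rlist A)) (rset A) (\<lambda>z. set (snd z) \<union> g (fst z))" .
  from computable_rset[where h = "\<lambda>e X. X \<union> g e", OF this assms(1)] show ?thesis .
qed

lemma computable_UN:
  assumes "computable E (rset A) X" "computable (rprod E A) (rset B) (\<lambda>z. f (fst z) (snd z))"
  shows "computable E (rset B) (\<lambda>e. \<Union>x\<in>X e. f e x)"
proof (rule computable_rset[where h = "\<lambda>e X. \<Union>x\<in>X. f e x", OF _ assms(1)])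
  have "computable (rprod E (rlist A)) (rset B)
      (\<lambda>z. foldr (\<lambda>x R. f (fst z) x \<union> R) (snd z) {})"
    by (rule computable_foldr[where g = "\<lambda>z x R. f (fst z) x \<union> R"] computable_union computable_empty
        computable_comp_pair[OF assms(2)] computable_intros)+
  moreover have "foldr (\<lambda>x R. h x \<union> R) xs {} = (\<Union>x\<in>set xs. h x)" for h :: "'b \<Rightarrow> 'c set" and xs
    by (induction xs) simp_all
  ultimately show "computable (rprod E (rlist A)) (rset B) (\<lambda>z. \<Union>x\<in>set (snd z). f (fst z) x)"
    by simp
qed

lemma computable_Ball:
  assumes "computable E (rset A) X" "computable (rprod E A) rbool (\<lambda>z. P (fst z) (snd z))"
  shows "computable E rbool (\<lambda>e. \<forall>x\<in>X e. P e x)"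
proof (rule computable_rset[where h = "\<lambda>e X. \<forall>x\<in>X. P e x", OF _ assms(1)])
  have "computable (rprod E (rlist A)) rbool
      (\<lambda>z. foldr (\<lambda>x r. P (fst z) x \<and> r) (snd z) True)"
    by (rule computable_foldr[where g = "\<lambda>z x r. P (fst z) x \<and> r"]
        computable_comp_pair[OF assms(2)] computable_intros)+
  moreover have "foldr (\<lambda>x r. h x \<and> r) xs True = (\<forall>x\<in>set xs. h x)" for h :: "'b \<Rightarrow> bool" and xs
    by (induction xs) simp_all
  ultimately show "computable (rprod E (rlist A)) rbool (\<lambda>z. \<forall>x\<in>set (snd z). P (fst z) x)"
    by simp
qed

lemma computable_Bex:
  assumes "computable E (rset A) X" "computable (rprod E A) rbool (\<lambda>z. P (fst z) (snd z))"
  shows "computable E rbool (\<lambda>e. \<exists>x\<in>X e. P e x)"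
  using computable_not[OF computable_Ball[OF assms(1) computable_not[OF assms(2)]]] by simp

lemmas computable_set_intros = computable_empty computable_singleton computable_union computable_UN
  computable_Ball computable_Bex


section \<open>Branching recursion\<close>

text \<open>Every inner node continues with one chosen subproblem, so a result is a leaf value
  transformed along a single branch. This fits a calculus whose rules have at most one
  premise.\<close>

inductive run :: "('x \<Rightarrow> bool) \<Rightarrow> ('x \<Rightarrow> 'z set) \<Rightarrow> ('x \<Rightarrow> ('l \<times> 'x) set) \<Rightarrow> ('l \<Rightarrow> 'z \<Rightarrow> 'z) \<Rightarrow> 'x \<Rightarrow> 'z \<Rightarrow> bool"
  for b f ch g where
  leaf: "\<lbrakk>b x; z \<in> f x\<rbrakk> \<Longrightarrow> run b f ch g x z"
| node: "\<lbrakk>\<not> b x; (l, y) \<in> ch x; run b f ch g y z\<rbrakk> \<Longrightarrow> run b f ch g x (g l z)"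

text \<open>Runs are explored breadth first: a state is a finite set of subproblems, each with the list of
  labels that leads to it from the root.\<close>

lemma computable_run:
  fixes \<mu> :: "'x \<Rightarrow> nat"
  assumes b: "computable A rbool b" and f: "computable A (rset B) f"
    and ch: "computable A (rset (rprod L A)) ch"
    and g: "computable (rprod L B) B (\<lambda>z. g (fst z) (snd z))"
    and \<mu>: "\<And>x l y. \<lbrakk>(l, y) \<in> ch x; \<not> b x\<rbrakk> \<Longrightarrow> \<mu> y < \<mu> x"
  shows "computable A (rset B) (\<lambda>x. {z. run b f ch g x z})"
proof -
  let ?S = "rset (rprod (rlist L) A)"
  let ?b = "\<lambda>Z. \<forall>w\<in>Z. b (snd w)"
  let ?f = "\<lambda>Z. \<Union>w\<in>Z. \<Union>z\<in>f (snd w). {foldr g (fst w) z}"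
  \<comment> \<open>One round of the exploration: finished items stay, the others are replaced by
    their subproblems. New labels are appended at the end, so that \<open>foldr\<close> applies the
    label at the root last.\<close>
  define e where "e w = (if b (snd w) then {w} else \<Union>v\<in>ch (snd w). {(fst w @ [fst v], snd v)})" for w
  let ?d = "\<lambda>Z. \<Union>w\<in>Z. e w"
  let ?F = "\<lambda>Z. \<Union>w\<in>Z. {foldr g (fst w) z | z. run b f ch g (snd w) z}"
  have cb: "computable ?S rbool ?b"
    by (rule computable_intros computable_set_intros computable_comp[OF _ b])+
  have "computable ?S (rset B) ?F"
  proof (rule computable_linear_recursion[where b = ?b and f = ?f and d = ?d and g = "\<lambda>_ r. r", OF cb])
    show "computable ?S (rset B) ?f"
      by (rule computable_intros computable_set_intros computable_comp[OF _ f] computable_foldr computable_comp_pair[OF g])+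
    show "computable ?S ?S ?d" unfolding e_def
      by (rule computable_intros computable_set_intros computable_comp[OF _ b] computable_comp[OF _ ch]
          computable_append)+
    show "computable (rprod ?S (rset B)) (rset B) snd" using computable_snd[OF computable_id] .
  next
    fix Z
    show "?F Z = (if ?b Z then ?f Z else ?F (?d Z))"
    proof (cases "?b Z")
      case True
      have "run b f ch g x z \<longleftrightarrow> z \<in> f x" if "b x" for x z
        using that run.simps[of b f ch g x z] by auto
      with True show ?thesis by auto
    next
      case False
      have step: "{foldr g (fst w) z | z. run b f ch g (snd w) z}
          = (\<Union>v\<in>e w. {foldr g (fst v) z | z. run b f ch g (snd v) z})" for w
      proof (cases "b (snd w)")
        case True
        then show ?thesis by (simp add: e_def)
      next
        case False
        have "run b f ch g (snd w) z \<longleftrightarrow> (\<exists>l y z'. (l, y) \<in> ch (snd w) \<and> z = g l z' \<and> run b f ch g y z')" for z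
          using False run.simps[of b f ch g "snd w" z] by auto
        with False show ?thesis unfolding e_def
          by auto (rule bexI[rotated], assumption, force, blast)
      qed
      have "?F Z = (\<Union>w\<in>Z. \<Union>v\<in>e w. {foldr g (fst v) z | z. run b f ch g (snd v) z})"
        by (rule SUP_cong[OF HOL.refl step])
      then show ?thesis unfolding if_not_P[OF False] UN_UN_flatten .
    qed
  next
    fix n Z assume "?S n Z"
    then have fin: "finite Z" by (rule finite_rset)
    \<comment> \<open>Each round lowers the bound on the measures of unfinished items; the
      finiteness of the coded set provides the initial bound.\<close>
    define M where "M = Suc (\<Sum>w\<in>Z. \<mu> (snd w))"
    have "\<forall>w\<in>Z. \<mu> (snd w) < M"
      using fin by (auto simp: M_def less_Suc_eq_le intro: member_le_sum)
    then have "\<forall>w\<in>Z. \<not> b (snd w) \<longrightarrow> \<mu> (snd w) < M" by blast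
    then show "\<exists>k. \<forall>w\<in>(?d ^^ k) Z. b (snd w)"
    proof (induction M arbitrary: Z)
      case 0
      then have "\<forall>w\<in>(?d ^^ 0) Z. b (snd w)" by simp
      then show ?case by blast
    next
      case (Suc M)
      have "\<mu> (snd v) < M" if "v \<in> ?d Z" "\<not> b (snd v)" for v
      proof -
        from that(1) obtain w where w: "w \<in> Z" "v \<in> e w" by blast
        with that(2) have nb: "\<not> b (snd w)" by (auto simp: e_def)
        with w(2) obtain l where "(l, snd v) \<in> ch (snd w)" by (auto simp: e_def)
        then have "\<mu> (snd v) < \<mu> (snd w)" using nb by (rule \<mu>)
        moreover have "\<mu> (snd w) < Suc M" using Suc.prems w(1) nb by blast
        ultimately show ?thesis by linarith
      qed
      then have "\<forall>w\<in>?d Z. \<not> b (snd w) \<longrightarrow> \<mu> (snd w) < M" by blast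
      then obtain k where "\<forall>w\<in>(?d ^^ k) (?d Z). b (snd w)" using Suc.IH by blast
      then have "\<forall>w\<in>(?d ^^ Suc k) Z. b (snd w)" by (simp only: funpow_Suc_right o_def)
      then show ?case by blast
    qed
  qed
  from computable_comp[OF computable_singleton[OF computable_pair[OF computable_Nil computable_id]] this]
  show ?thesis by simp
qed


section \<open>Formulas and derivations as represented sets\<close>

text \<open>The clauses have the shape of \<open>enc_fm\<close>, with arbitrary representations at
  the labels. Algorithms thereby become functions of formulas over actual objects and arrows rather
  than of trees of codes. \<open>rder\<close> relates to \<open>enc_der\<close> in the same
  way.\<close>

inductive rfm :: "'x rep \<Rightarrow> 'a rep \<Rightarrow> ('x, 'a) fm rep" for X A where
  "X n x \<Longrightarrow> rfm X A (prod_encode (0, n)) (Atom x)"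
| "\<lbrakk>A n f; rfm X A m S\<rbrakk> \<Longrightarrow> rfm X A (prod_encode (1, prod_encode (n, m))) (Pos f S)"
| "\<lbrakk>A n f; rfm X A m S\<rbrakk> \<Longrightarrow> rfm X A (prod_encode (2, prod_encode (n, m))) (Neg f S)"

inductive rder :: "'d rep \<Rightarrow> 'a rep \<Rightarrow> ('d, 'a) der rep" for D A where
  "D n d \<Longrightarrow> rder D A (prod_encode (0, n)) (Ax d)"
| "\<lbrakk>A n f; A m g; rder D A k \<alpha>\<rbrakk> \<Longrightarrow> rder D A (prod_encode (1, enc3 (n, m, k))) (LP f g \<alpha>)"
| "\<lbrakk>A n f; rder D A k \<alpha>\<rbrakk> \<Longrightarrow> rder D A (prod_encode (2, prod_encode (n, k))) (RP f \<alpha>)"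
| "\<lbrakk>A n f; rder D A k \<alpha>\<rbrakk> \<Longrightarrow> rder D A (prod_encode (3, prod_encode (n, k))) (LN f \<alpha>)"
| "\<lbrakk>A n f; A m g; rder D A k \<alpha>\<rbrakk> \<Longrightarrow> rder D A (prod_encode (4, enc3 (n, m, k))) (RN f g \<alpha>)"

lemma rfm_enc_fm:
  "\<lbrakk>\<forall>x\<in>set1_fm s. X x (u x); \<forall>a\<in>set2_fm s. A a (v a)\<rbrakk> \<Longrightarrow> rfm X A (enc_fm s) (map_fm u v s)"
  by (induction s) (auto intro: rfm.intros simp del: One_nat_def)

lemma rder_enc_der:
  "\<lbrakk>\<forall>x\<in>set1_der t. D x (u x); \<forall>a\<in>set2_der t. A a (v a)\<rbrakk> \<Longrightarrow> rder D A (enc_der t) (map_der u v t)"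
  by (induction t) (auto intro: rder.intros simp del: One_nat_def)

lemma code_collapse: "prod_encode (fst (prod_decode n), snd (prod_decode n)) = n"
  by simp

lemma enc3_collapse: "enc3 (fst (prod_decode n), fst (prod_decode (snd (prod_decode n))),
    snd (prod_decode (snd (prod_decode n)))) = n"
  by (simp add: enc3_def)

lemmas total_recursive_tag = total_recursive_pair[OF total_recursive_const total_recursive_id]

lemma computable_Atom: "computable E X f \<Longrightarrow> computable E (rfm X A) (\<lambda>e. Atom (f e))"
  by (erule computable_comp, rule computable_totalI[OF total_recursive_tag[of 0]]) (rule rfm.intros)

lemma computable_Pos:
  assumes "computable E A f" "computable E (rfm X A) S"
  shows "computable E (rfm X A) (\<lambda>e. Pos (f e) (S e))"
  by (rule computable_comp_pair[OF computable_totalI[OF total_recursive_tag[of 1]] assms])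
    (simp only: rprod_def, metis rfm.intros(2) code_collapse)

lemma computable_Neg:
  assumes "computable E A f" "computable E (rfm X A) S"
  shows "computable E (rfm X A) (\<lambda>e. Neg (f e) (S e))"
  by (rule computable_comp_pair[OF computable_totalI[OF total_recursive_tag[of 2]] assms])
    (simp only: rprod_def, metis rfm.intros(3) code_collapse)

lemma computable_Ax: "computable E D f \<Longrightarrow> computable E (rder D A) (\<lambda>e. Ax (f e))"
  by (erule computable_comp, rule computable_totalI[OF total_recursive_tag[of 0]]) (rule rder.intros)

lemma computable_LP:
  assumes "computable E A f" "computable E A g" "computable E (rder D A) \<alpha>"
  shows "computable E (rder D A) (\<lambda>e. LP (f e) (g e) (\<alpha> e))"
  by (rule computable_comp_triple[OF computable_totalI[OF total_recursive_tag[of 1]] assms])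
    (simp only: rprod_def, metis rder.intros(2) enc3_collapse)

lemma computable_RP:
  assumes "computable E A f" "computable E (rder D A) \<alpha>"
  shows "computable E (rder D A) (\<lambda>e. RP (f e) (\<alpha> e))"
  by (rule computable_comp_pair[OF computable_totalI[OF total_recursive_tag[of 2]] assms])
    (simp only: rprod_def, metis rder.intros(3) code_collapse)

lemma computable_LN:
  assumes "computable E A f" "computable E (rder D A) \<alpha>"
  shows "computable E (rder D A) (\<lambda>e. LN (f e) (\<alpha> e))"
  by (rule computable_comp_pair[OF computable_totalI[OF total_recursive_tag[of 3]] assms])
    (simp only: rprod_def, metis rder.intros(4) code_collapse)

lemma computable_RN:
  assumes "computable E A f" "computable E A g" "computable E (rder D A) \<alpha>"
  shows "computable E (rder D A) (\<lambda>e. RN (f e) (g e) (\<alpha> e))"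
  by (rule computable_comp_triple[OF computable_totalI[OF total_recursive_tag[of 4]] assms])
    (simp only: rprod_def, metis rder.intros(5) enc3_collapse)

lemma computable_case_fm:
  assumes e: "computable E (rfm X A) e"
    and "computable (rprod E X) B (\<lambda>z. f0 (fst z) (snd z))"
    and "computable (rprod E (rprod A (rfm X A))) B (\<lambda>z. f1 (fst z) (fst (snd z)) (snd (snd z)))"
    and "computable (rprod E (rprod A (rfm X A))) B (\<lambda>z. f2 (fst z) (fst (snd z)) (snd (snd z)))"
  shows "computable E B (\<lambda>x. case e x of Atom y \<Rightarrow> f0 x y | Pos f S \<Rightarrow> f1 x f S | Neg f S \<Rightarrow> f2 x f S)"
proof -
  obtain r0 where r0: "partial_recursive r0"
      "\<And>n z. rprod E X n z \<Longrightarrow> \<exists>m. r0 n = Some m \<and> B m (f0 (fst z) (snd z))"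
    using assms(2) by (rule computableE) blast
  obtain r1 where r1: "partial_recursive r1"
      "\<And>n z. rprod E (rprod A (rfm X A)) n z
        \<Longrightarrow> \<exists>m. r1 n = Some m \<and> B m (f1 (fst z) (fst (snd z)) (snd (snd z)))"
    using assms(3) by (rule computableE) blast
  obtain r2 where r2: "partial_recursive r2"
      "\<And>n z. rprod E (rprod A (rfm X A)) n z
        \<Longrightarrow> \<exists>m. r2 n = Some m \<and> B m (f2 (fst z) (fst (snd z)) (snd (snd z)))"
    using assms(4) by (rule computableE) blast
  \<comment> \<open>The continuation is given the code of the argument paired with a tagged code:
    \<open>t\<close> reads the tag, and \<open>u\<close> removes it.\<close>
  define t where "t n = fst (prod_decode (snd (prod_decode n)))" for n
  define u where "u n = prod_encode (fst (prod_decode n), snd (prod_decode (snd (prod_decode n))))" for n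
  have tu: "total_recursive t" "total_recursive u"
    unfolding t_def u_def by (intro total_recursive_intros)+
  show ?thesis
  proof (rule computable_bind[OF e])
    show "partial_recursive (\<lambda>n. if t n = 0 then r0 (u n) else if t n = 1 then r1 (u n) else r2 (u n))"
      by (intro partial_recursive_if tu total_recursive_const partial_recursive_comp_total[OF r0(1)]
          partial_recursive_comp_total[OF r1(1)] partial_recursive_comp_total[OF r2(1)])
    fix n x m assume *: "E n x" "rfm X A m (e x)"
    let ?m = "prod_encode (n, m)"
    show "\<exists>k. (if t ?m = 0 then r0 (u ?m) else if t ?m = 1 then r1 (u ?m) else r2 (u ?m)) = Some k
      \<and> B k (case e x of Atom y \<Rightarrow> f0 x y | Pos f S \<Rightarrow> f1 x f S | Neg f S \<Rightarrow> f2 x f S)"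
      using *(2)
    proof cases
      case (1 i y)
      with *(1) r0(2)[of "u ?m" "(x, y)"] show ?thesis by (simp add: t_def u_def rprod_def)
    next
      case (2 i f j S)
      with *(1) r1(2)[of "u ?m" "(x, f, S)"] show ?thesis by (simp add: t_def u_def rprod_def)
    next
      case (3 i f j S)
      with *(1) r2(2)[of "u ?m" "(x, f, S)"] show ?thesis by (simp add: t_def u_def rprod_def)
    qed
  qed
qed

lemma computable_case_der:
  assumes e: "computable E (rder D A) e"
    and "computable (rprod E D) B (\<lambda>z. f0 (fst z) (snd z))"
    and "computable (rprod E (rprod A (rprod A (rder D A)))) B
      (\<lambda>z. f1 (fst z) (fst (snd z)) (fst (snd (snd z))) (snd (snd (snd z))))"
    and "computable (rprod E (rprod A (rder D A))) B (\<lambda>z. f2 (fst z) (fst (snd z)) (snd (snd z)))"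
    and "computable (rprod E (rprod A (rder D A))) B (\<lambda>z. f3 (fst z) (fst (snd z)) (snd (snd z)))"
    and "computable (rprod E (rprod A (rprod A (rder D A)))) B
      (\<lambda>z. f4 (fst z) (fst (snd z)) (fst (snd (snd z))) (snd (snd (snd z))))"
  shows "computable E B (\<lambda>x. case e x of Ax d \<Rightarrow> f0 x d | LP f g \<alpha> \<Rightarrow> f1 x f g \<alpha> | RP f \<alpha> \<Rightarrow> f2 x f \<alpha>
    | LN f \<alpha> \<Rightarrow> f3 x f \<alpha> | RN f g \<alpha> \<Rightarrow> f4 x f g \<alpha>)"
proof -
  obtain r0 where r0: "partial_recursive r0"
      "\<And>n z. rprod E D n z \<Longrightarrow> \<exists>m. r0 n = Some m \<and> B m (f0 (fst z) (snd z))"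
    using assms(2) by (rule computableE) blast
  obtain r1 where r1: "partial_recursive r1"
      "\<And>n z. rprod E (rprod A (rprod A (rder D A))) n z
        \<Longrightarrow> \<exists>m. r1 n = Some m \<and> B m (f1 (fst z) (fst (snd z)) (fst (snd (snd z))) (snd (snd (snd z))))"
    using assms(3) by (rule computableE) blast
  obtain r2 where r2: "partial_recursive r2"
      "\<And>n z. rprod E (rprod A (rder D A)) n z
        \<Longrightarrow> \<exists>m. r2 n = Some m \<and> B m (f2 (fst z) (fst (snd z)) (snd (snd z)))"
    using assms(4) by (rule computableE) blast
  obtain r3 where r3: "partial_recursive r3"
      "\<And>n z. rprod E (rprod A (rder D A)) n z
        \<Longrightarrow> \<exists>m. r3 n = Some m \<and> B m (f3 (fst z) (fst (snd z)) (snd (snd z)))"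
    using assms(5) by (rule computableE) blast
  obtain r4 where r4: "partial_recursive r4"
      "\<And>n z. rprod E (rprod A (rprod A (rder D A))) n z
        \<Longrightarrow> \<exists>m. r4 n = Some m \<and> B m (f4 (fst z) (fst (snd z)) (fst (snd (snd z))) (snd (snd (snd z))))"
    using assms(6) by (rule computableE) blast
  define t where "t n = fst (prod_decode (snd (prod_decode n)))" for n
  define u where "u n = prod_encode (fst (prod_decode n), snd (prod_decode (snd (prod_decode n))))" for n
  have tu: "total_recursive t" "total_recursive u"
    unfolding t_def u_def by (intro total_recursive_intros)+
  let ?h = "\<lambda>n. if t n = 0 then r0 (u n) else if t n = 1 then r1 (u n) else if t n = 2 then r2 (u n)
    else if t n = 3 then r3 (u n) else r4 (u n)"
  show ?thesis
  proof (rule computable_bind[OF e])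
    show "partial_recursive ?h"
      by (intro partial_recursive_if tu total_recursive_const partial_recursive_comp_total[OF r0(1)]
          partial_recursive_comp_total[OF r1(1)] partial_recursive_comp_total[OF r2(1)]
          partial_recursive_comp_total[OF r3(1)] partial_recursive_comp_total[OF r4(1)])
    fix n x m assume *: "E n x" "rder D A m (e x)"
    let ?m = "prod_encode (n, m)"
    show "\<exists>k. ?h ?m = Some k \<and> B k (case e x of Ax d \<Rightarrow> f0 x d | LP f g \<alpha> \<Rightarrow> f1 x f g \<alpha>
        | RP f \<alpha> \<Rightarrow> f2 x f \<alpha> | LN f \<alpha> \<Rightarrow> f3 x f \<alpha> | RN f g \<alpha> \<Rightarrow> f4 x f g \<alpha>)"
      using *(2)
    proof cases
      case (1 i y)
      with *(1) r0(2)[of "u ?m" "(x, y)"] show ?thesis by (simp add: t_def u_def rprod_def)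
    next
      case (2 i f j g k S)
      with *(1) r1(2)[of "u ?m" "(x, f, g, S)"] show ?thesis by (simp add: t_def u_def rprod_def enc3_def)
    next
      case (3 i f j S)
      with *(1) r2(2)[of "u ?m" "(x, f, S)"] show ?thesis by (simp add: t_def u_def rprod_def)
    next
      case (4 i f j S)
      with *(1) r3(2)[of "u ?m" "(x, f, S)"] show ?thesis by (simp add: t_def u_def rprod_def)
    next
      case (5 i f j g k S)
      with *(1) r4(2)[of "u ?m" "(x, f, g, S)"] show ?thesis by (simp add: t_def u_def rprod_def enc3_def)
    qed
  qed
qed

lemmas computable_tree_intros = computable_Atom computable_Pos computable_Neg computable_Ax computable_LP
  computable_RP computable_LN computable_RN computable_case_fm computable_case_der

section \<open>Derivations\<close>

text \<open>A total composition, so that the functions below can be computed on arbitrary trees.\<close>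

definition composite :: "('o, 'a) cat \<Rightarrow> 'a \<Rightarrow> 'a \<Rightarrow> 'a" where
  "composite C f g = (if Cod C f = Dom C g then f \<cdot>\<^bsub>C\<^esub> g else f)"

lemma composite_eq [simp]: "Cod C f = Dom C g \<Longrightarrow> composite C f g = f \<cdot>\<^bsub>C\<^esub> g"
  by (simp add: composite_def)

locale bifibration_data = bif C D p \<P> \<N> + cat_functor D C p
  for C :: "('o, 'a) cat" (structure) and D :: "('x, 'd) cat" and p :: "('x, 'd, 'o, 'a) ftr"
    and \<P> \<N> :: "'a set" +
  assumes P_sub: "\<P> \<subseteq> Arr C" and N_sub: "\<N> \<subseteq> Arr C"
begin

lemma P_Arr: "f \<in> \<P> \<Longrightarrow> f \<in> Arr C" and N_Arr: "f \<in> \<N> \<Longrightarrow> f \<in> Arr C"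
  using P_sub N_sub by auto

abbreviation cmp :: "'a \<Rightarrow> 'a \<Rightarrow> 'a" where
  "cmp \<equiv> composite C"

primrec over :: "('x, 'a) fm \<Rightarrow> 'o" where
  "over (Atom X) = fobj p X"
| "over (Pos f S) = Cod C f"
| "over (Neg g T) = Dom C g"

lemma formula_over: "formula S A \<Longrightarrow> over S = A"
  by (erule formula.cases) auto

primrec src :: "('d, 'a) der \<Rightarrow> ('x, 'a) fm" where
  "src (Ax \<delta>) = Atom (Dom D \<delta>)"
| "src (LP f g \<alpha>) = Pos f (src \<alpha>)"
| "src (RP f \<alpha>) = src \<alpha>"
| "src (LN g \<alpha>) = Neg g (src \<alpha>)"
| "src (RN f g \<alpha>) = src \<alpha>"

primrec tgt :: "('d, 'a) der \<Rightarrow> ('x, 'a) fm" where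
  "tgt (Ax \<delta>) = Atom (Cod D \<delta>)"
| "tgt (LP f g \<alpha>) = tgt \<alpha>"
| "tgt (RP f \<alpha>) = Pos f (tgt \<alpha>)"
| "tgt (LN g \<alpha>) = tgt \<alpha>"
| "tgt (RN f g \<alpha>) = Neg g (tgt \<alpha>)"

text \<open>\<open>LP\<close> and \<open>RN\<close> store the base arrow of their conclusion, since
  it is only a factor of the base arrow of the premise. With \<open>cmp\<close> the value exists on
  every tree and can be computed without knowing that the tree is a derivation.\<close>

primrec base :: "('d, 'a) der \<Rightarrow> 'a" where
  "base (Ax \<delta>) = farr p \<delta>"
| "base (LP f g \<alpha>) = g"
| "base (RP f \<alpha>) = cmp (base \<alpha>) f"
| "base (LN g \<alpha>) = cmp g (base \<alpha>)"
| "base (RN f g \<alpha>) = f"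

lemma derives_sequent: "derives \<alpha> S h T \<Longrightarrow> src \<alpha> = S \<and> base \<alpha> = h \<and> tgt \<alpha> = T"
  and derives_formulas: "derives \<alpha> S h T \<Longrightarrow> h \<in> Arr C \<and> formula S (Dom C h) \<and> formula T (Cod C h)"
proof (induction rule: derives.induct)
  case (Ax \<delta>)
  { case 1 show ?case by simp }
  { case 2 from Ax show ?case
      using formula.intros(1)[OF dom.Dom_in[OF Ax]] formula.intros(1)[OF dom.Cod_in[OF Ax]]
      by (simp add: farr_in Dom_farr Cod_farr) }
next
  case (LP f g S \<alpha> T)
  { case 1 from LP show ?case by simp }
  { case 2 from LP P_Arr[of f] formula.intros(2)[of f S] show ?case by (auto simp: cod.Cod_Comp) }
next
  case (RP f f' \<alpha> S' S)
  { case 1 from RP show ?case by auto }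
  { case 2 from RP P_Arr[of f] formula.intros(2)[of f S] show ?case
      by (auto simp: cod.Cod_Comp cod.Dom_Comp cod.Comp_in) }
next
  case (LN g g' \<alpha> T T')
  { case 1 from LN show ?case by auto }
  { case 2 from LN N_Arr[of g] formula.intros(3)[of g T] show ?case
      by (auto simp: cod.Cod_Comp cod.Dom_Comp cod.Comp_in) }
next
  case (RN f g T \<alpha> S)
  { case 1 from RN show ?case by simp }
  { case 2 from RN N_Arr[of g] formula.intros(3)[of g T] show ?case by (auto simp: cod.Dom_Comp) }
qed

lemma derives_base: "derives \<alpha> S h T \<Longrightarrow> base \<alpha> = h"
  and derives_Arr: "derives \<alpha> S h T \<Longrightarrow> h \<in> Arr C"
  and derives_src: "derives \<alpha> S h T \<Longrightarrow> formula S (Dom C h)"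
  and derives_tgt: "derives \<alpha> S h T \<Longrightarrow> formula T (Cod C h)"
  using derives_sequent derives_formulas by auto

lemma derives_unique:
  "\<lbrakk>derives \<alpha> S h T; derives \<alpha> S' h' T'\<rbrakk> \<Longrightarrow> S = S' \<and> h = h' \<and> T = T'"
  using derives_sequent by metis

inductive_cases derives_AxE: "derives (Ax \<delta>) S h T"
inductive_cases derives_LPE: "derives (LP f g \<alpha>) S h T"
inductive_cases derives_RPE: "derives (RP f \<alpha>) S h T"
inductive_cases derives_LNE: "derives (LN g \<alpha>) S h T"
inductive_cases derives_RNE: "derives (RN f g \<alpha>) S h T"

lemma derives_LP_iff: "derives (LP f g \<alpha>) S h T \<longleftrightarrow>
    (\<exists>S'. S = Pos f S' \<and> h = g \<and> f \<in> \<P> \<and> g \<in> Arr C \<and> Cod C f = Dom C g \<and> derives \<alpha> S' (f \<cdot> g) T)"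
  by (auto elim!: derives_LPE intro!: derives.LP)
    (metis derives_src cod.Dom_Comp P_Arr)

lemma derives_RP_iff: "derives (RP f \<alpha>) S h T \<longleftrightarrow>
    (\<exists>g T'. T = Pos f T' \<and> h = g \<cdot> f \<and> f \<in> \<P> \<and> Cod C g = Dom C f \<and> derives \<alpha> S g T')"
  by (auto elim!: derives_RPE intro!: derives.RP)

lemma derives_LN_iff: "derives (LN f \<alpha>) S h T \<longleftrightarrow>
    (\<exists>g S'. S = Neg f S' \<and> h = f \<cdot> g \<and> f \<in> \<N> \<and> Cod C f = Dom C g \<and> derives \<alpha> S' g T)"
  by (auto elim!: derives_LNE intro!: derives.LN)

lemma derives_RN_iff: "derives (RN g f \<alpha>) S h T \<longleftrightarrow>
    (\<exists>T'. T = Neg f T' \<and> h = g \<and> f \<in> \<N> \<and> g \<in> Arr C \<and> Cod C g = Dom C f \<and> derives \<alpha> S (g \<cdot> f) T')"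
  by (auto elim!: derives_RNE intro!: derives.RN)
    (metis derives_tgt cod.Cod_Comp N_Arr)


section \<open>Permutation equivalence\<close>

lemma permeq_derives: "\<alpha> \<sim> \<beta> \<Longrightarrow> \<exists>S h T. derives \<alpha> S h T \<and> derives \<beta> S h T"
proof (induction rule: permeq.induct)
  case (trans \<alpha> \<beta> \<gamma>)
  then show ?case using derives_unique by metis
qed blast+

lemma permeq_derives_iff: "\<alpha> \<sim> \<beta> \<Longrightarrow> derives \<alpha> S h T \<longleftrightarrow> derives \<beta> S h T"
  using permeq_derives derives_unique by metis

lemma permeq_base: "\<alpha> \<sim> \<beta> \<Longrightarrow> base \<alpha> = base \<beta>"
  using permeq_derives derives_base by metis

lemma permeq_derives_RP: "\<alpha> \<sim> \<beta> \<Longrightarrow> derives (RP f \<alpha>) S h T \<longleftrightarrow> derives (RP f \<beta>) S h T"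
  and permeq_derives_RN: "\<alpha> \<sim> \<beta> \<Longrightarrow> derives (RN f g \<alpha>) S h T \<longleftrightarrow> derives (RN f g \<beta>) S h T"
  by (simp_all add: derives_RP_iff derives_RN_iff permeq_derives_iff[of \<alpha> \<beta>])

lemma permeq_LP: "\<lbrakk>\<alpha> \<sim> \<beta>; derives (LP f g \<alpha>) S h T\<rbrakk> \<Longrightarrow> LP f g \<alpha> \<sim> LP f g \<beta>"
  by (rule permeq.cong_LP[of _ _ _ S h T]) (auto simp: derives_LP_iff permeq_derives_iff)

lemma permeq_RP: "\<lbrakk>\<alpha> \<sim> \<beta>; derives (RP f \<alpha>) S h T\<rbrakk> \<Longrightarrow> RP f \<alpha> \<sim> RP f \<beta>"
  by (rule permeq.cong_RP[of _ _ S h T]) (auto simp: derives_RP_iff permeq_derives_iff)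

lemma permeq_LN: "\<lbrakk>\<alpha> \<sim> \<beta>; derives (LN f \<alpha>) S h T\<rbrakk> \<Longrightarrow> LN f \<alpha> \<sim> LN f \<beta>"
  by (rule permeq.cong_LN[of _ _ S h T]) (auto simp: derives_LN_iff permeq_derives_iff)

lemma permeq_RN: "\<lbrakk>\<alpha> \<sim> \<beta>; derives (RN f g \<alpha>) S h T\<rbrakk> \<Longrightarrow> RN f g \<alpha> \<sim> RN f g \<beta>"
  by (rule permeq.cong_RN[of _ _ _ S h T]) (auto simp: derives_RN_iff permeq_derives_iff)

lemma permute_RP_LN:
  assumes "derives (RP h (LN f \<alpha>)) S k T" shows "RP h (LN f \<alpha>) \<sim> LN f (RP h \<alpha>)"
proof (rule permeq.RP_LN[OF assms])
  from assms obtain g S' T' where *: "S = Neg f S'" "T = Pos h T'" "k = (f \<cdot> g) \<cdot> h" "f \<in> \<N>" "h \<in> \<P>"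
      "Cod C f = Dom C g" "Cod C (f \<cdot> g) = Dom C h" "derives \<alpha> S' g T'"
    by (auto simp: derives_RP_iff derives_LN_iff)
  then have g: "g \<in> Arr C" "Cod C g = Dom C h"
    using derives_Arr N_Arr cod.Cod_Comp by metis+
  with * have "derives (LN f (RP h \<alpha>)) (Neg f S') (f \<cdot> (g \<cdot> h)) (Pos h T')"
    by (intro derives.LN derives.RP) (simp_all add: cod.Dom_Comp P_Arr)
  with * g show "derives (LN f (RP h \<alpha>)) S k T" by (simp add: cod.assoc N_Arr P_Arr)
qed

text \<open>On the left side the premise lies over \<open>f \<cdot> g\<close>, and the right side
  merely composes further. From the right side one would only learn that the premise lies over some
  \<open>m\<close> with \<open>m \<cdot> h = f \<cdot> (g \<cdot> h)\<close>, which is why the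
  hypothesis concerns the left side.\<close>

lemma permute_RP_LP:
  assumes "derives (RP h (LP f g \<alpha>)) S k T" shows "RP h (LP f g \<alpha>) \<sim> LP f (g \<cdot> h) (RP h \<alpha>)"
proof (rule permeq.RP_LP[OF assms])
  show "derives (LP f (g \<cdot> h) (RP h \<alpha>)) S k T"
    using assms unfolding derives_RP_iff derives_LP_iff
    by (auto simp: cod.Comp_in cod.Dom_Comp cod.Cod_Comp P_Arr) (metis cod.assoc cod.Cod_Comp P_Arr)
qed

text \<open>Here the hypothesis concerns the right side: from the left side one only learns that
  \<alpha> lies over some \<open>m\<close> with
  \<open>f \<cdot> m = (f \<cdot> g) \<cdot> h\<close>, and \<open>m = g \<cdot> h\<close> cannot be
  inferred by cancelling \<open>f\<close>.\<close>

lemma permute_RN_LN: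
  assumes "derives (LN f (RN g h \<alpha>)) S k T" shows "RN (f \<cdot> g) h (LN f \<alpha>) \<sim> LN f (RN g h \<alpha>)"
proof (rule permeq.RN_LN[OF _ assms])
  show "derives (RN (f \<cdot> g) h (LN f \<alpha>)) S k T"
    using assms unfolding derives_RN_iff derives_LN_iff
    by (auto simp: cod.Comp_in cod.Dom_Comp cod.Cod_Comp N_Arr) (metis cod.assoc cod.Dom_Comp N_Arr)
qed

lemma permute_RN_LP:
  assumes "derives (RN g h (LP f (g \<cdot> h) \<alpha>)) S k T"
  shows "RN g h (LP f (g \<cdot> h) \<alpha>) \<sim> LP f g (RN (f \<cdot> g) h \<alpha>)"
proof (rule permeq.RN_LP[OF assms])
  show "derives (LP f g (RN (f \<cdot> g) h \<alpha>)) S k T"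
    using assms unfolding derives_RN_iff derives_LP_iff
    by (auto simp: cod.Comp_in cod.Dom_Comp cod.Cod_Comp cod.assoc N_Arr P_Arr)
qed

lemma permute_LP_RN:
  assumes "derives (LP f g (RN (f \<cdot> g) h \<alpha>)) S k T"
  shows "RN g h (LP f (g \<cdot> h) \<alpha>) \<sim> LP f g (RN (f \<cdot> g) h \<alpha>)"
proof (rule permeq.RN_LP[OF _ assms])
  show "derives (RN g h (LP f (g \<cdot> h) \<alpha>)) S k T"
    using assms unfolding derives_RN_iff derives_LP_iff
    by (auto simp: cod.Comp_in cod.Dom_Comp cod.Cod_Comp cod.assoc N_Arr P_Arr)
qed

text \<open>Below the \<open>LP\<close> that introduces the outermost connective of the source there
  can only be right rules, and both kinds move up past it without any filler.\<close>

lemma invert_LP: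
  assumes "derives \<alpha> (Pos f S) g T"
  obtains \<beta> where "derives \<beta> S (f \<cdot> g) T" "\<alpha> \<sim> LP f g \<beta>"
proof -
  have "\<exists>\<beta>. derives \<beta> S (f \<cdot> g) T \<and> \<alpha> \<sim> LP f g \<beta>"
    using assms
  proof (induction \<alpha> arbitrary: g T)
    case (Ax \<delta>)
    then show ?case by (auto elim: derives_AxE)
  next
    case (LP f' g' \<alpha>)
    then show ?case by (auto simp: derives_LP_iff intro!: exI[of _ \<alpha>] permeq.refl)
  next
    case (RP h \<alpha>)
    then obtain g' T' where d: "T = Pos h T'" "g = g' \<cdot> h" "h \<in> \<P>" "Cod C g' = Dom C h"
      "derives \<alpha> (Pos f S) g' T'" by (auto simp: derives_RP_iff)
    with RP.IH obtain \<beta> where b: "derives \<beta> S (f \<cdot> g') T'" "\<alpha> \<sim> LP f g' \<beta>" by blast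
    have 1: "RP h \<alpha> \<sim> RP h (LP f g' \<beta>)" using b(2) RP.prems by (rule permeq_RP)
    then have 2: "RP h (LP f g' \<beta>) \<sim> LP f g (RP h \<beta>)"
      using RP.prems permute_RP_LP permeq_derives_iff d(2) by metis
    then have "derives (LP f g (RP h \<beta>)) (Pos f S) g T"
      using 1 RP.prems permeq_derives_iff by metis
    then show ?case using permeq.trans[OF 1 2] by (auto simp: derives_LP_iff)
  next
    case (LN f' \<alpha>)
    then show ?case by (auto simp: derives_LN_iff)
  next
    case (RN g' h \<alpha>)
    then obtain T' where d: "T = Neg h T'" "g' = g" "derives \<alpha> (Pos f S) (g \<cdot> h) T'"
      by (auto simp: derives_RN_iff)
    with RN.IH obtain \<beta> where b: "\<alpha> \<sim> LP f (g \<cdot> h) \<beta>" by blast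
    have 1: "RN g h \<alpha> \<sim> RN g h (LP f (g \<cdot> h) \<beta>)" using b RN.prems d(2) permeq_RN by metis
    then have 2: "RN g h (LP f (g \<cdot> h) \<beta>) \<sim> LP f g (RN (f \<cdot> g) h \<beta>)"
      using RN.prems permute_RN_LP permeq_derives_iff d(2) by metis
    then have "derives (LP f g (RN (f \<cdot> g) h \<beta>)) (Pos f S) g T"
      using 1 RN.prems permeq_derives_iff d(2) by metis
    then show ?case using permeq.trans[OF 1 2] d(2) by (auto simp: derives_LP_iff)
  qed
  with that show thesis by blast
qed

text \<open>Below the \<open>RN\<close> that introduces the outermost connective of the target there
  can only be left rules. \<open>LN\<close> exchanges with \<open>RN\<close> here in the direction
  that composes, so again no filler is involved.\<close>

lemma invert_RN:
  assumes "derives \<alpha> S g (Neg f T)"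
  obtains \<beta> where "derives \<beta> S (g \<cdot> f) T" "\<alpha> \<sim> RN g f \<beta>"
proof -
  have "\<exists>\<beta>. derives \<beta> S (g \<cdot> f) T \<and> \<alpha> \<sim> RN g f \<beta>"
    using assms
  proof (induction \<alpha> arbitrary: g S)
    case (Ax \<delta>)
    then show ?case by (auto elim: derives_AxE)
  next
    case (LP k g' \<alpha>)
    then obtain S' where d: "S = Pos k S'" "g' = g" "derives \<alpha> S' (k \<cdot> g) (Neg f T)"
      by (auto simp: derives_LP_iff)
    with LP.IH obtain \<beta> where b: "\<alpha> \<sim> RN (k \<cdot> g) f \<beta>" by blast
    have 1: "LP k g \<alpha> \<sim> LP k g (RN (k \<cdot> g) f \<beta>)" using b LP.prems d(2) permeq_LP by metis
    then have 2: "RN g f (LP k (g \<cdot> f) \<beta>) \<sim> LP k g (RN (k \<cdot> g) f \<beta>)"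
      using LP.prems permute_LP_RN permeq_derives_iff d(2) by metis
    then have "derives (RN g f (LP k (g \<cdot> f) \<beta>)) S g (Neg f T)"
      using 1 LP.prems permeq_derives_iff d(2) by metis
    then show ?case using permeq.trans[OF 1 permeq.sym[OF 2]] d(2) by (auto simp: derives_RN_iff)
  next
    case (RP h \<alpha>)
    then show ?case by (auto simp: derives_RP_iff)
  next
    case (LN k \<alpha>)
    then obtain g' S' where d: "S = Neg k S'" "g = k \<cdot> g'" "derives \<alpha> S' g' (Neg f T)"
      by (auto simp: derives_LN_iff)
    with LN.IH obtain \<beta> where b: "\<alpha> \<sim> RN g' f \<beta>" by blast
    have 1: "LN k \<alpha> \<sim> LN k (RN g' f \<beta>)" using b LN.prems permeq_LN by metis
    then have 2: "RN g f (LN k \<beta>) \<sim> LN k (RN g' f \<beta>)"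
      using LN.prems permute_RN_LN permeq_derives_iff d(2) by metis
    then have "derives (RN g f (LN k \<beta>)) S g (Neg f T)"
      using 1 LN.prems permeq_derives_iff by metis
    then show ?case using permeq.trans[OF 1 permeq.sym[OF 2]] by (auto simp: derives_RN_iff)
  next
    case (RN g' h \<alpha>)
    then show ?case by (auto simp: derives_RN_iff intro!: exI[of _ \<alpha>] permeq.refl)
  qed
  with that show thesis by blast
qed

end


section \<open>Normal forms for permutation equivalence\<close>

locale preordered_bifibration_data = bifibration_data C D p \<P> \<N>
  for C :: "('o, 'a) cat" (structure) and D :: "('x, 'd) cat" and p :: "('x, 'd, 'o, 'a) ftr"
    and \<P> \<N> :: "'a set" +
  assumes P_preordered: "factorization_preordered C \<P>"
    and N_preordered: "factorization_preordered C \<N>"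
begin

text \<open>The diagonal of the square \<open>f \<cdot> m = k \<cdot> h\<close>, in the order in
  which \<open>insert_RN k h (LN f \<alpha>)\<close> with \<alpha> over \<open>m\<close> meets its
  sides. Membership of \<open>f\<close> and \<open>h\<close> in \<N> is part of the test, so that
  the arrow picked by \<open>SOME\<close> is the only candidate.\<close>

definition filler :: "'a \<Rightarrow> 'a \<Rightarrow> 'a \<Rightarrow> 'a \<Rightarrow> 'a option" where
  "filler f m k h =
    (if f \<in> \<N> \<and> h \<in> \<N> \<and> (\<exists>e \<in> hom C (Cod C f) (Dom C h). k = f \<cdot> e \<and> m = e \<cdot> h)
     then Some (SOME e. e \<in> hom C (Cod C f) (Dom C h) \<and> k = f \<cdot> e \<and> m = e \<cdot> h) else None)"

lemma filler_SomeD: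
  assumes "filler f m k h = Some e"
  shows "f \<in> \<N>" "h \<in> \<N>" "e \<in> Arr C" "Dom C e = Cod C f" "Cod C e = Dom C h" "k = f \<cdot> e" "m = e \<cdot> h"
proof -
  have "f \<in> \<N> \<and> h \<in> \<N> \<and> e \<in> hom C (Cod C f) (Dom C h) \<and> k = f \<cdot> e \<and> m = e \<cdot> h"
    using assms unfolding filler_def by (auto split: if_splits intro: someI2)
  then show "f \<in> \<N>" "h \<in> \<N>" "e \<in> Arr C" "Dom C e = Cod C f" "Cod C e = Dom C h" "k = f \<cdot> e" "m = e \<cdot> h"
    by (auto simp: hom_def)
qed

lemma N_cancel:
  assumes "f \<in> \<N>" "h \<in> \<N>" "e \<in> Arr C" "Dom C e = Cod C f" "Cod C e = Dom C h"
    and "e' \<in> Arr C" "Dom C e' = Cod C f" "Cod C e' = Dom C h" "f \<cdot> e = f \<cdot> e'" "e \<cdot> h = e' \<cdot> h"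
  shows "e = e'"
  using N_preordered assms unfolding factorization_preordered_def by metis

lemma P_cancel:
  assumes "f \<in> \<P>" "h \<in> \<P>" "e \<in> Arr C" "Dom C e = Cod C f" "Cod C e = Dom C h"
    and "e' \<in> Arr C" "Dom C e' = Cod C f" "Cod C e' = Dom C h" "f \<cdot> e = f \<cdot> e'" "e \<cdot> h = e' \<cdot> h"
  shows "e = e'"
  using P_preordered assms unfolding factorization_preordered_def by metis

lemma filler_eq:
  assumes "f \<in> \<N>" "h \<in> \<N>" "e \<in> Arr C" "Dom C e = Cod C f" "Cod C e = Dom C h"
  shows "filler f (e \<cdot> h) (f \<cdot> e) h = Some e"
proof (cases "filler f (e \<cdot> h) (f \<cdot> e) h")
  case None
  with assms show ?thesis by (auto simp: filler_def hom_def split: if_splits)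
next
  case (Some e')
  from filler_SomeD[OF this] assms have "e' = e" by (intro N_cancel[of f h e' e]) simp_all
  with Some show ?thesis by simp
qed

text \<open>Normal forms have their left rules as far down as possible: a right rule is inserted by
  moving it up past left rules. Only for \<open>RN\<close> above \<open>LN\<close> can this fail.\<close>

primrec insert_RP :: "'a \<Rightarrow> ('d, 'a) der \<Rightarrow> ('d, 'a) der" where
  "insert_RP h (Ax \<delta>) = RP h (Ax \<delta>)"
| "insert_RP h (LP f g \<alpha>) = LP f (cmp g h) (insert_RP h \<alpha>)"
| "insert_RP h (RP f \<alpha>) = RP h (RP f \<alpha>)"
| "insert_RP h (LN f \<alpha>) = LN f (insert_RP h \<alpha>)"
| "insert_RP h (RN f g \<alpha>) = RP h (RN f g \<alpha>)"

primrec insert_RN :: "'a \<Rightarrow> 'a \<Rightarrow> ('d, 'a) der \<Rightarrow> ('d, 'a) der" where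
  "insert_RN k h (Ax \<delta>) = RN k h (Ax \<delta>)"
| "insert_RN k h (LP f g \<alpha>) = LP f k (insert_RN (cmp f k) h \<alpha>)"
| "insert_RN k h (RP f \<alpha>) = RN k h (RP f \<alpha>)"
| "insert_RN k h (LN f \<alpha>) = (case filler f (base \<alpha>) k h of
     None \<Rightarrow> RN k h (LN f \<alpha>) | Some e \<Rightarrow> LN f (insert_RN e h \<alpha>))"
| "insert_RN k h (RN f g \<alpha>) = RN k h (RN f g \<alpha>)"

primrec nf :: "('d, 'a) der \<Rightarrow> ('d, 'a) der" where
  "nf (Ax \<delta>) = Ax \<delta>"
| "nf (LP f g \<alpha>) = LP f g (nf \<alpha>)"
| "nf (RP f \<alpha>) = insert_RP f (nf \<alpha>)"
| "nf (LN f \<alpha>) = LN f (nf \<alpha>)"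
| "nf (RN f g \<alpha>) = insert_RN f g (nf \<alpha>)"

lemma insert_RP_permeq: "derives (RP h \<alpha>) S k T \<Longrightarrow> insert_RP h \<alpha> \<sim> RP h \<alpha>"
proof (induction \<alpha> arbitrary: S k T)
  case (LP f g \<alpha>)
  have 1: "RP h (LP f g \<alpha>) \<sim> LP f (g \<cdot> h) (RP h \<alpha>)" using LP.prems by (rule permute_RP_LP)
  then have d: "derives (LP f (g \<cdot> h) (RP h \<alpha>)) S k T" using LP.prems permeq_derives_iff by blast
  then have "LP f (g \<cdot> h) (RP h \<alpha>) \<sim> LP f (g \<cdot> h) (insert_RP h \<alpha>)"
    using LP.IH permeq_LP permeq.sym unfolding derives_LP_iff by metis
  moreover have "cmp g h = g \<cdot> h" using LP.prems by (auto simp: derives_RP_iff derives_LP_iff)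
  ultimately show ?case using permeq.trans[OF 1] permeq.sym by simp
next
  case (LN f \<alpha>)
  have 1: "RP h (LN f \<alpha>) \<sim> LN f (RP h \<alpha>)" using LN.prems by (rule permute_RP_LN)
  then have d: "derives (LN f (RP h \<alpha>)) S k T" using LN.prems permeq_derives_iff by blast
  then have "LN f (RP h \<alpha>) \<sim> LN f (insert_RP h \<alpha>)"
    using LN.IH permeq_LN permeq.sym unfolding derives_LN_iff by metis
  then show ?case using permeq.trans[OF 1] permeq.sym by simp
qed (auto intro: permeq.refl)

lemma insert_RN_permeq: "derives (RN g h \<alpha>) S k T \<Longrightarrow> insert_RN g h \<alpha> \<sim> RN g h \<alpha>"
proof (induction \<alpha> arbitrary: g S k T)
  case (LP f m \<alpha>)
  then have m: "m = g \<cdot> h" "Cod C f = Dom C g"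
    by (auto simp: derives_RN_iff derives_LP_iff cod.Dom_Comp N_Arr)
  have 1: "RN g h (LP f (g \<cdot> h) \<alpha>) \<sim> LP f g (RN (f \<cdot> g) h \<alpha>)"
    using LP.prems m permute_RN_LP by metis
  then have d: "derives (LP f g (RN (f \<cdot> g) h \<alpha>)) S k T"
    using LP.prems permeq_derives_iff m by blast
  then have "LP f g (RN (f \<cdot> g) h \<alpha>) \<sim> LP f g (insert_RN (f \<cdot> g) h \<alpha>)"
    using LP.IH permeq_LP permeq.sym unfolding derives_LP_iff by metis
  then show ?case using permeq.trans[OF 1] permeq.sym m by simp
next
  case (LN f \<alpha>)
  show ?case
  proof (cases "filler f (base \<alpha>) g h")
    case None
    then show ?thesis using LN.prems by (auto intro: permeq.refl)
  next
    case (Some e)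
    note e = filler_SomeD[OF Some]
    from LN.prems obtain S' T' m where d: "S = Neg f S'" "T = Neg h T'" "derives \<alpha> S' m T'" "k = g"
      by (auto simp: derives_RN_iff derives_LN_iff)
    then have "derives (RN e h \<alpha>) S' e T" using e derives_base by (auto simp: derives_RN_iff)
    then have d: "derives (LN f (RN e h \<alpha>)) S k T" and i: "insert_RN e h \<alpha> \<sim> RN e h \<alpha>"
      using e d LN.IH by (auto simp: derives_LN_iff)
    have "LN f (insert_RN e h \<alpha>) \<sim> LN f (RN e h \<alpha>)"
      using permeq_LN[OF permeq.sym[OF i] d] by (rule permeq.sym)
    from permeq.trans[OF this permeq.sym[OF permute_RN_LN[OF d]]] show ?thesis using e(6) Some by simp
  qed
qed (auto intro: permeq.refl)

lemma nf_permeq: "derives \<alpha> S h T \<Longrightarrow> nf \<alpha> \<sim> \<alpha>"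
proof (induction rule: derives.induct)
  case (Ax \<delta>)
  then show ?case by (auto intro: permeq.refl derives.Ax)
next
  case (LP f g S \<alpha> T)
  then show ?case using permeq_LP[OF permeq.sym, of "nf \<alpha>" \<alpha> f g] derives.LP permeq.sym by fastforce
next
  case (RP f f' \<alpha> S' S)
  then have "RP f \<alpha> \<sim> RP f (nf \<alpha>)" using permeq_RP[OF permeq.sym] derives.RP by metis
  then show ?case using insert_RP_permeq permeq_derives permeq.trans permeq.sym by (metis nf.simps(3))
next
  case (LN g g' \<alpha> T T')
  then show ?case using permeq_LN[OF permeq.sym, of "nf \<alpha>" \<alpha> g] derives.LN permeq.sym by fastforce
next
  case (RN f g T \<alpha> S)
  then have "RN f g \<alpha> \<sim> RN f g (nf \<alpha>)" using permeq_RN[OF permeq.sym] derives.RN by metis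
  then show ?case using insert_RN_permeq permeq_derives permeq.trans permeq.sym by (metis nf.simps(5))
qed

text \<open>\<open>nf\<close> is compositional, so the congruence rules are immediate, and each
  exchange becomes a defining equation of an insertion. Only the exchange of \<open>RN\<close> with
  \<open>LN\<close> takes an argument: the filler found by the insertion must be the given
  \<open>g\<close>, by uniqueness.\<close>

lemma nf_cong: "\<alpha> \<sim> \<beta> \<Longrightarrow> nf \<alpha> = nf \<beta>"
proof (induction rule: permeq.induct)
  case (RP_LP h f g \<alpha> S k T)
  then show ?case by (auto simp: derives_RP_iff derives_LP_iff)
next
  case (RN_LN f g h \<alpha> S k T)
  then obtain S' T' where d: "f \<in> \<N>" "h \<in> \<N>" "g \<in> Arr C" "Cod C f = Dom C g" "Cod C g = Dom C h"
      "derives \<alpha> S' (g \<cdot> h) T'"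
    by (auto simp: derives_RN_iff derives_LN_iff)
  then have "base (nf \<alpha>) = g \<cdot> h" using nf_permeq permeq_base derives_base by metis
  then show ?case using filler_eq[of f h g] d by simp
next
  case (RN_LP g h f \<alpha> S k T)
  then show ?case by (auto simp: derives_RN_iff derives_LP_iff)
qed simp_all

lemma permeq_iff_nf:
  assumes "derives \<alpha> S h T" "derives \<beta> S' h' T'"
  shows "\<alpha> \<sim> \<beta> \<longleftrightarrow> nf \<alpha> = nf \<beta>"
  using nf_cong nf_permeq[OF assms(1)] nf_permeq[OF assms(2)] permeq.sym permeq.trans by metis

section \<open>Cancellation of rules up to permutation equivalence\<close>

lemma permeq_Ax: "Ax \<delta> \<sim> Ax \<epsilon> \<Longrightarrow> \<delta> = \<epsilon>"
  by (drule nf_cong) simp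

text \<open>A left rule at the root stays at the root of the normal form, so cancelling it is
  injectivity of a constructor. For the right rules the corresponding fact is injectivity of the
  insertion.\<close>

lemma permeq_LN_cancel:
  assumes "LN f \<alpha> \<sim> LN f \<beta>" shows "\<alpha> \<sim> \<beta>"
proof -
  have "nf \<alpha> = nf \<beta>" using nf_cong[OF assms] by simp
  moreover obtain S h T where "derives (LN f \<alpha>) S h T" "derives (LN f \<beta>) S h T"
    using permeq_derives[OF assms] by blast
  ultimately show ?thesis unfolding derives_LN_iff using permeq_iff_nf by metis
qed

lemma permeq_LP_cancel:
  assumes "LP f g \<alpha> \<sim> LP f g \<beta>" shows "\<alpha> \<sim> \<beta>"
proof -
  have "nf \<alpha> = nf \<beta>" using nf_cong[OF assms] by simp
  moreover obtain S h T where "derives (LP f g \<alpha>) S h T" "derives (LP f g \<beta>) S h T"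
    using permeq_derives[OF assms] by blast
  ultimately show ?thesis unfolding derives_LP_iff using permeq_iff_nf by metis
qed

text \<open>Passing an \<open>LP f g\<close> overwrites \<open>g\<close> by
  \<open>g \<cdot> h\<close>, so the result determines \<open>g\<close> only through this composite.
  The base of the common premise gives \<open>f \<cdot> g\<close> as well, and uniqueness of fillers
  in \<P> concludes.\<close>

lemma insert_RP_inject:
  assumes "insert_RP h \<alpha> = insert_RP h \<beta>" "derives (RP h \<alpha>) S k T" "derives (RP h \<beta>) S' k' T'"
  shows "\<alpha> = \<beta>"
  using assms
proof (induction \<alpha> arbitrary: \<beta> S k T S' k' T')
  case (LP f g \<alpha>)
  then obtain g' \<beta>' where b: "\<beta> = LP f g' \<beta>'" by (cases \<beta>) auto
  from LP.prems(2) obtain S1 T1 where 1: "f \<in> \<P>" "h \<in> \<P>" "g \<in> Arr C" "Cod C f = Dom C g" "Cod C g = Dom C h"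
      "derives \<alpha> S1 (f \<cdot> g) T1"
    by (auto simp: derives_RP_iff derives_LP_iff)
  from LP.prems(3) b obtain S2 T2 where 2: "g' \<in> Arr C" "Cod C f = Dom C g'" "Cod C g' = Dom C h"
      "derives \<beta>' S2 (f \<cdot> g') T2"
    by (auto simp: derives_RP_iff derives_LP_iff)
  have "derives (RP h \<alpha>) S1 ((f \<cdot> g) \<cdot> h) (Pos h T1)" "derives (RP h \<beta>') S2 ((f \<cdot> g') \<cdot> h) (Pos h T2)"
    using 1 2 by (auto intro!: derives.RP simp: cod.Cod_Comp P_Arr)
  with LP.IH LP.prems(1) b have "\<alpha> = \<beta>'" by auto
  \<comment> \<open>The premise now is one and the same derivation, which has only one base
    arrow.\<close>
  with 1 2 have "f \<cdot> g = f \<cdot> g'" using derives_unique by blast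
  moreover have "g \<cdot> h = g' \<cdot> h" using LP.prems(1) b 1 2 by simp
  ultimately have "g = g'" using 1 2 by (intro P_cancel[of f h g g']) simp_all
  with b \<open>\<alpha> = \<beta>'\<close> show ?case by simp
next
  case (LN f \<alpha>)
  then obtain \<beta>' where b: "\<beta> = LN f \<beta>'" by (cases \<beta>) auto
  have "\<exists>S k T. derives (RP h \<gamma>) S k T" if "derives (RP h (LN f \<gamma>)) S k T" for \<gamma> S k T
    using that permeq_derives_iff[OF permute_RP_LN[OF that]] unfolding derives_LN_iff by blast
  with LN b show ?case by (metis insert_RP.simps(4) der.inject(4))
qed (case_tac \<beta>; simp)+

text \<open>Passing an \<open>LP\<close> loses nothing, since the overwritten arrow was
  \<open>g \<cdot> h\<close> and \<open>g\<close>, \<open>h\<close> are fixed. Passing an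
  \<open>LN\<close> changes the first argument into a filler, which may a priori differ between
  \<alpha> and \<beta>.\<close>

lemma insert_RN_inject:
  assumes "insert_RN g h \<alpha> = insert_RN g h \<beta>" "derives (RN g h \<alpha>) S k T" "derives (RN g h \<beta>) S' k' T'"
  shows "\<alpha> = \<beta>"
  using assms
proof (induction \<alpha> arbitrary: \<beta> g S k T S' k' T')
  case (LP f m \<alpha>)
  then obtain m' \<beta>' where b: "\<beta> = LP f m' \<beta>'" by (cases \<beta>) (auto split: option.splits)
  have *: "l = g \<cdot> h \<and> Cod C f = Dom C g \<and> (\<exists>S k T. derives (RN (f \<cdot> g) h \<gamma>) S k T)"
    if "derives (RN g h (LP f l \<gamma>)) S k T" for l \<gamma> S k T
  proof -
    have l: "l = g \<cdot> h" "Cod C f = Dom C g"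
      using that by (auto simp: derives_RN_iff derives_LP_iff cod.Dom_Comp N_Arr)
    with that have "RN g h (LP f (g \<cdot> h) \<gamma>) \<sim> LP f g (RN (f \<cdot> g) h \<gamma>)"
      using permute_RN_LP by metis
    with that l have "derives (LP f g (RN (f \<cdot> g) h \<gamma>)) S k T" using permeq_derives_iff by metis
    with l show ?thesis unfolding derives_LP_iff by metis
  qed
  from *[OF LP.prems(2)] obtain S1 k1 T1 where 1: "m = g \<cdot> h" "Cod C f = Dom C g"
    "derives (RN (f \<cdot> g) h \<alpha>) S1 k1 T1" by blast
  from LP.prems(3) b * obtain S2 k2 T2 where 2: "m' = g \<cdot> h"
    "derives (RN (f \<cdot> g) h \<beta>') S2 k2 T2" by blast
  have "insert_RN (f \<cdot> g) h \<alpha> = insert_RN (f \<cdot> g) h \<beta>'" using LP.prems(1) b 1 by simp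
  then have "\<alpha> = \<beta>'" using 1(3) 2(2) by (rule LP.IH)
  with b 1 2 show ?case by simp
next
  case (LN f \<alpha>)
  have *: "\<exists>S T. derives (RN e h \<gamma>) S e T"
    if "derives (RN g h (LN f \<gamma>)) S k T" "filler f (base \<gamma>) g h = Some e" for \<gamma> e S k T
  proof -
    from that(1) obtain S' m T' where "derives \<gamma> S' m T'"
      by (auto simp: derives_RN_iff derives_LN_iff)
    with filler_SomeD[OF that(2)] show ?thesis
      using derives_base[of \<gamma> S' m T'] by (auto simp: derives_RN_iff)
  qed
  show ?case
  proof (cases "filler f (base \<alpha>) g h")
    case None
    with LN.prems show ?thesis by (cases \<beta>) (auto split: option.splits)
  next
    case (Some e)
    with LN.prems(1) obtain \<beta>' e' where b: "\<beta> = LN f \<beta>'" "filler f (base \<beta>') g h = Some e'"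
        "insert_RN e h \<alpha> = insert_RN e' h \<beta>'"
      by (cases \<beta>) (auto split: option.splits)
    obtain S1 T1 where 1: "derives (RN e h \<alpha>) S1 e T1" using *[OF LN.prems(2) Some] by blast
    obtain S2 T2 where 2: "derives (RN e' h \<beta>') S2 e' T2" using * LN.prems(3) b by blast
    \<comment> \<open>The inserted \<open>RN\<close> fixes the base arrow of the result, so both
      fillers can be read off from the common result.\<close>
    have "e = base (insert_RN e h \<alpha>)" "e' = base (insert_RN e' h \<beta>')"
      using insert_RN_permeq[OF 1] insert_RN_permeq[OF 2] permeq_base by (metis base.simps(5))+
    with b(3) have "e = e'" by simp
    with LN.IH[OF _ 1, of \<beta>'] 2 b show ?thesis by blast
  qed
qed (case_tac \<beta>; simp split: option.splits)+

lemma permeq_RP_cancel: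
  assumes "RP f \<alpha> \<sim> RP f \<beta>" shows "\<alpha> \<sim> \<beta>"
proof -
  obtain S h T where d: "derives (RP f \<alpha>) S h T" "derives (RP f \<beta>) S h T"
    using permeq_derives[OF assms] by blast
  then have n: "nf \<alpha> \<sim> \<alpha>" "nf \<beta> \<sim> \<beta>" unfolding derives_RP_iff using nf_permeq by blast+
  from d have "derives (RP f (nf \<alpha>)) S h T" "derives (RP f (nf \<beta>)) S h T"
    using d by (simp_all add: permeq_derives_RP[OF n(1)] permeq_derives_RP[OF n(2)])
  then have "nf \<alpha> = nf \<beta>" using nf_cong[OF assms] insert_RP_inject[of f] by simp
  with n show ?thesis by (metis permeq.sym permeq.trans)
qed

lemma permeq_RN_cancel:
  assumes "RN f g \<alpha> \<sim> RN f g \<beta>" shows "\<alpha> \<sim> \<beta>"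
proof -
  obtain S h T where d: "derives (RN f g \<alpha>) S h T" "derives (RN f g \<beta>) S h T"
    using permeq_derives[OF assms] by blast
  then have n: "nf \<alpha> \<sim> \<alpha>" "nf \<beta> \<sim> \<beta>" unfolding derives_RN_iff using nf_permeq by blast+
  from d have "derives (RN f g (nf \<alpha>)) S h T" "derives (RN f g (nf \<beta>)) S h T"
    using d by (simp_all add: permeq_derives_RN[OF n(1)] permeq_derives_RN[OF n(2)])
  then have "nf \<alpha> = nf \<beta>" using nf_cong[OF assms] insert_RN_inject[of f g] by simp
  with n show ?thesis by (metis permeq.sym permeq.trans)
qed

text \<open>Inserting an \<open>RP\<close> never creates a left rule. If the normal form of the left
  side has \<open>LN f\<close> at its root, this \<open>LN f\<close> was already at the root of
  \<open>nf \<alpha>\<close>, and what is above it provides \<gamma>.\<close>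

lemma permeq_RP_LN:
  assumes "RP h \<alpha> \<sim> LN f \<beta>"
  obtains \<gamma> where "\<alpha> \<sim> LN f \<gamma>" "\<beta> \<sim> RP h \<gamma>"
proof -
  obtain S k T where d: "derives (RP h \<alpha>) S k T" "derives (LN f \<beta>) S k T"
    using permeq_derives[OF assms] by blast
  then have n: "nf \<alpha> \<sim> \<alpha>" "nf \<beta> \<sim> \<beta>"
    unfolding derives_RP_iff derives_LN_iff using nf_permeq by blast+
  have "insert_RP h (nf \<alpha>) = LN f (nf \<beta>)" using nf_cong[OF assms] by simp
  then obtain \<gamma> where g: "nf \<alpha> = LN f \<gamma>" "insert_RP h \<gamma> = nf \<beta>" by (cases "nf \<alpha>") auto
  have "derives (RP h (LN f \<gamma>)) S k T"
    using permeq_derives_iff[OF permeq_RP[OF permeq.sym[OF n(1)] d(1)]] d(1) g by simp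
  then have "derives (LN f (RP h \<gamma>)) S k T" using permute_RP_LN permeq_derives_iff by metis
  then have "insert_RP h \<gamma> \<sim> RP h \<gamma>" unfolding derives_LN_iff using insert_RP_permeq by blast
  then have "\<beta> \<sim> RP h \<gamma>" using g(2) n(2) by (metis permeq.sym permeq.trans)
  moreover have "\<alpha> \<sim> LN f \<gamma>" using g(1) n(1) by (metis permeq.sym)
  ultimately show thesis using that by blast
qed

end

section \<open>Sequences of rules\<close>

lemma Poss_simps [simp]: "Poss [] S = S" "Poss (f # \<pi>) S = Poss \<pi> (Pos f S)"
  "Poss (\<pi> @ [f]) S = Pos f (Poss \<pi> S)"
  by (simp_all add: Poss_def)

lemma Negs_simps [simp]: "Negs [] S = S" "Negs (f # \<pi>) S = Neg f (Negs \<pi> S)"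
  by (simp_all add: Negs_def)

lemma positive_Poss: "positive (Poss \<pi> S) \<longleftrightarrow> \<pi> \<noteq> [] \<or> positive S"
  by (cases \<pi> rule: rev_cases) auto

lemma negative_Poss: "negative (Poss \<pi> S) \<longleftrightarrow> \<pi> = [] \<and> negative S"
  by (cases \<pi> rule: rev_cases) auto

lemma negative_Negs: "negative (Negs \<pi> S) \<longleftrightarrow> \<pi> \<noteq> [] \<or> negative S"
  by (cases \<pi>) auto

lemma positive_Negs: "positive (Negs \<pi> S) \<longleftrightarrow> \<pi> = [] \<and> positive S"
  by (cases \<pi>) auto

lemma Poss_inject:
  "\<lbrakk>Poss \<pi> S = Poss \<pi>' S'; \<not> positive S; \<not> positive S'\<rbrakk> \<Longrightarrow> \<pi> = \<pi>' \<and> S = S'"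
proof (induction \<pi> arbitrary: \<pi>' rule: rev_induct)
  case Nil
  then show ?case using positive_Poss[of \<pi>' S'] by auto
next
  case (snoc f \<pi>)
  then show ?case using positive_Poss[of "\<pi> @ [f]" S] by (cases \<pi>' rule: rev_cases) auto
qed

lemma Negs_inject:
  "\<lbrakk>Negs \<pi> S = Negs \<pi>' S'; \<not> negative S; \<not> negative S'\<rbrakk> \<Longrightarrow> \<pi> = \<pi>' \<and> S = S'"
proof (induction \<pi> arbitrary: \<pi>')
  case Nil
  then show ?case using negative_Negs[of \<pi>' S'] by auto
next
  case (Cons f \<pi>)
  then show ?case using negative_Negs[of "f # \<pi>" S] by (cases \<pi>') auto
qed

lemma Poss_eq_iff [simp]: "Poss \<pi> S = Poss \<pi> S' \<longleftrightarrow> S = S'"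
  by (induction \<pi> rule: rev_induct) auto

lemma Negs_eq_iff [simp]: "Negs \<pi> S = Negs \<pi> S' \<longleftrightarrow> S = S'"
  by (induction \<pi>) auto

lemma ex_Poss: "\<exists>\<pi> N. S = Poss \<pi> N \<and> \<not> positive N"
proof (induction S)
  case (Pos f S)
  then obtain \<pi> N where "S = Poss \<pi> N" "\<not> positive N" by blast
  then have "Pos f S = Poss (\<pi> @ [f]) N" by simp
  with \<open>\<not> positive N\<close> show ?case by blast
qed (metis Poss_simps(1) positive.simps)+

lemma ex_Negs: "\<exists>\<pi> N. S = Negs \<pi> N \<and> \<not> negative N"
proof (induction S)
  case (Neg f S)
  then show ?case by (metis Negs_simps(2))
qed (metis Negs_simps(1) negative.simps)+

primrec connectives :: "('x, 'a) fm \<Rightarrow> nat" where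
  "connectives (Atom X) = 0"
| "connectives (Pos f S) = Suc (connectives S)"
| "connectives (Neg g T) = Suc (connectives T)"

lemma connectives_Poss [simp]: "connectives (Poss \<pi> S) = length \<pi> + connectives S"
  by (induction \<pi> rule: rev_induct) auto

lemma connectives_Negs [simp]: "connectives (Negs \<pi> S) = length \<pi> + connectives S"
  by (induction \<pi>) auto

context bifibration_data
begin

declare permeq.trans [trans]

section \<open>Base arrows composed with paths\<close>

lemma pre_simps [simp]: "pre [] f = f" "pre (g # \<pi>) f = g \<cdot> pre \<pi> f"
  by (simp_all add: pre_def)

lemma post_simps [simp]: "post f [] = f" "post f (g # \<rho>) = post (f \<cdot> g) \<rho>"
  by (simp_all add: post_def)

lemma path_snoc: "path W A (\<pi> @ [f]) B \<longleftrightarrow> path W A \<pi> (Dom C f) \<and> f \<in> W \<and> Cod C f = B"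
  by (induction \<pi> arbitrary: A) auto

lemma pre_typing:
  "\<lbrakk>W \<subseteq> Arr C; path W A \<pi> (Dom C f); f \<in> Arr C\<rbrakk>
    \<Longrightarrow> pre \<pi> f \<in> Arr C \<and> Dom C (pre \<pi> f) = A \<and> Cod C (pre \<pi> f) = Cod C f"
  by (induction \<pi> arbitrary: A) (auto simp: cod.Comp_in cod.Dom_Comp cod.Cod_Comp subset_iff)

lemma post_typing:
  "\<lbrakk>W \<subseteq> Arr C; path W (Cod C f) \<rho> B; f \<in> Arr C\<rbrakk>
    \<Longrightarrow> post f \<rho> \<in> Arr C \<and> Dom C (post f \<rho>) = Dom C f \<and> Cod C (post f \<rho>) = B"
proof (induction \<rho> arbitrary: f)
  case (Cons g \<rho>)
  then have "g \<in> Arr C" "Cod C f = Dom C g" by auto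
  with Cons show ?case using Cons.IH[of "f \<cdot> g"] by (simp add: cod.Comp_in cod.Dom_Comp cod.Cod_Comp)
qed simp

lemma pre_Comp:
  assumes "W \<subseteq> Arr C" "path W A \<pi> (Dom C f)" "f \<in> Arr C" "g \<in> Arr C" "Cod C f = Dom C g"
  shows "pre \<pi> (f \<cdot> g) = pre \<pi> f \<cdot> g"
  using assms(2)
proof (induction \<pi> arbitrary: A)
  case (Cons h \<pi>)
  then have "path W (Cod C h) \<pi> (Dom C f)" "h \<in> Arr C" using assms(1) by auto
  with Cons.IH assms pre_typing[of W "Cod C h" \<pi> f] show ?case by (simp add: cod.assoc)
qed simp

lemma Comp_post:
  assumes "W \<subseteq> Arr C" "path W (Cod C g) \<rho> B" "f \<in> Arr C" "g \<in> Arr C" "Cod C f = Dom C g"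
  shows "post (f \<cdot> g) \<rho> = f \<cdot> post g \<rho>"
  using assms(2,4,5)
proof (induction \<rho> arbitrary: g)
  case (Cons h \<rho>)
  then have "h \<in> Arr C" "Cod C g = Dom C h" using assms(1) by auto
  with Cons Cons.IH[of "g \<cdot> h"] assms(3) show ?case
    by (simp add: cod.assoc cod.Comp_in cod.Dom_Comp cod.Cod_Comp)
qed simp

lemma pre_post:
  assumes "W \<subseteq> Arr C" "W' \<subseteq> Arr C" "path W A \<pi> (Dom C f)" "path W' (Cod C f) \<rho> B" "f \<in> Arr C"
  shows "pre \<pi> (post f \<rho>) = post (pre \<pi> f) \<rho>"
  using assms(3)
proof (induction \<pi> arbitrary: A)
  case (Cons g \<pi>)
  then have "path W (Cod C g) \<pi> (Dom C f)" "g \<in> Arr C" using assms(1) by auto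
  with Cons.IH assms pre_typing[of W "Cod C g" \<pi> f] Comp_post[of W' "pre \<pi> f" \<rho> B g]
  show ?case by simp
qed simp

text \<open>Removes the identities that stand in for composites of possibly empty paths. The
  commutation of the outer square follows from the diagonal by \<open>pre_post\<close>.\<close>

lemma square_le_iff:
  assumes W: "W \<subseteq> Arr C" "W' \<subseteq> Arr C" and f: "f \<in> Arr C" and g: "g \<in> Arr C"
    and p: "path W A \<sigma> (Dom C g)" "path W' (Cod C f) \<rho> B"
  shows "square_le (pre \<sigma> (Id C (Dom C g)), g) (f, post (Id C (Cod C f)) \<rho>) \<longleftrightarrow>
    (\<exists>e. e \<in> Arr C \<and> Dom C e = Dom C g \<and> Cod C e = Cod C f \<and> f = pre \<sigma> e \<and> g = post e \<rho>)"
proof -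
  have i: "Id C (Dom C g) \<in> Arr C" "Id C (Cod C f) \<in> Arr C"
    "Dom C (Id C (Dom C g)) = Dom C g" "Cod C (Id C (Dom C g)) = Dom C g"
    "Dom C (Id C (Cod C f)) = Cod C f" "Cod C (Id C (Cod C f)) = Cod C f"
    using f g by (simp_all add: cod.Id_in cod.Dom_in cod.Cod_in cod.Dom_Id cod.Cod_Id)
  have t: "Cod C (pre \<sigma> (Id C (Dom C g))) = Dom C g" "Dom C (post (Id C (Cod C f)) \<rho>) = Cod C f"
    using pre_typing[OF W(1)] post_typing[OF W(2)] p i by metis+
  have e: "pre \<sigma> (Id C (Dom C g)) \<cdot> e = pre \<sigma> e" "e \<cdot> post (Id C (Cod C f)) \<rho> = post e \<rho>"
    if "e \<in> Arr C" "Dom C e = Dom C g" "Cod C e = Cod C f" for e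
    using pre_Comp[OF W(1) _ i(1) that(1), of A \<sigma>] Comp_post[OF W(2) _ that(1) i(2), of \<rho> B] p i that
      cod.Id_left[of e] cod.Id_right[of e] by simp_all
  have g': "pre \<sigma> (Id C (Dom C g)) \<cdot> g = pre \<sigma> g"
    using pre_Comp[OF W(1) _ i(1) g, of A \<sigma>] p i cod.Id_left[of g] g by simp
  have f': "f \<cdot> post (Id C (Cod C f)) \<rho> = post f \<rho>"
    using Comp_post[OF W(2) _ f i(2), of \<rho> B] p i cod.Id_right[of f] f by simp
  have "pre \<sigma> g = post f \<rho>"
    if "e \<in> Arr C" "Dom C e = Dom C g" "Cod C e = Cod C f" "f = pre \<sigma> e" "g = post e \<rho>" for e
    using pre_post[OF W, of A \<sigma> e \<rho> B] p that by simp
  moreover have "square_le (pre \<sigma> (Id C (Dom C g)), g) (f, post (Id C (Cod C f)) \<rho>) \<longleftrightarrow>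
    pre \<sigma> g = post f \<rho> \<and> (\<exists>e. (e \<in> Arr C \<and> Dom C e = Dom C g \<and> Cod C e = Cod C f) \<and>
      f = pre \<sigma> (Id C (Dom C g)) \<cdot> e \<and> g = e \<cdot> post (Id C (Cod C f)) \<rho>)"
    unfolding square_le_def hom_def by (simp only: prod.case t g' f' mem_Collect_eq Bex_def)
  moreover have "(\<exists>e. (e \<in> Arr C \<and> Dom C e = Dom C g \<and> Cod C e = Cod C f) \<and>
      f = pre \<sigma> (Id C (Dom C g)) \<cdot> e \<and> g = e \<cdot> post (Id C (Cod C f)) \<rho>) \<longleftrightarrow>
    (\<exists>e. (e \<in> Arr C \<and> Dom C e = Dom C g \<and> Cod C e = Cod C f) \<and> f = pre \<sigma> e \<and> g = post e \<rho>)"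
    by (intro ex_cong1) (metis e)
  ultimately show ?thesis by blast
qed

section \<open>Blocks of rules and their sequents\<close>

abbreviation LNs :: "'a list \<Rightarrow> ('d, 'a) der \<Rightarrow> ('d, 'a) der" where
  "LNs \<sigma> \<alpha> \<equiv> foldr LN \<sigma> \<alpha>"

abbreviation RPs :: "'a list \<Rightarrow> ('d, 'a) der \<Rightarrow> ('d, 'a) der" where
  "RPs \<tau> \<alpha> \<equiv> fold RP \<tau> \<alpha>"

lemma derives_LNs_iff: "derives (LNs \<sigma> \<alpha>) S h T \<longleftrightarrow>
    (\<exists>g S'. S = Negs \<sigma> S' \<and> h = pre \<sigma> g \<and> path \<N> (Dom C h) \<sigma> (Dom C g) \<and> derives \<alpha> S' g T)"
proof (induction \<sigma> arbitrary: S h)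
  case (Cons f \<sigma>)
  show ?case
  proof
    assume "derives (LNs (f # \<sigma>) \<alpha>) S h T"
    then obtain g' S1 where 1: "S = Neg f S1" "h = f \<cdot> g'" "f \<in> \<N>" "Cod C f = Dom C g'"
        "derives (LNs \<sigma> \<alpha>) S1 g' T" by (auto simp: derives_LN_iff)
    then have "Dom C h = Dom C f" by (simp add: cod.Dom_Comp N_Arr derives_Arr)
    moreover from 1(5) obtain g S' where "S1 = Negs \<sigma> S'" "g' = pre \<sigma> g" "path \<N> (Dom C g') \<sigma> (Dom C g)"
        "derives \<alpha> S' g T" unfolding Cons.IH by blast
    ultimately show "\<exists>g S'. S = Negs (f # \<sigma>) S' \<and> h = pre (f # \<sigma>) g \<and>
        path \<N> (Dom C h) (f # \<sigma>) (Dom C g) \<and> derives \<alpha> S' g T"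
      using 1 by auto
  next
    assume "\<exists>g S'. S = Negs (f # \<sigma>) S' \<and> h = pre (f # \<sigma>) g \<and>
        path \<N> (Dom C h) (f # \<sigma>) (Dom C g) \<and> derives \<alpha> S' g T"
    then obtain g S' where 1: "S = Neg f (Negs \<sigma> S')" "h = f \<cdot> pre \<sigma> g" "f \<in> \<N>"
        "path \<N> (Cod C f) \<sigma> (Dom C g)" "derives \<alpha> S' g T" by auto
    note 2 = pre_typing[OF N_sub 1(4) derives_Arr[OF 1(5)]]
    then have "derives (LNs \<sigma> \<alpha>) (Negs \<sigma> S') (pre \<sigma> g) T" unfolding Cons.IH using 1 by auto
    then show "derives (LNs (f # \<sigma>) \<alpha>) S h T" using 1 2 by (auto simp: derives_LN_iff)
  qed
qed auto

lemma derives_RPs_iff: "derives (RPs \<tau> \<alpha>) S h T \<longleftrightarrow>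
    (\<exists>g T'. T = Poss \<tau> T' \<and> h = post g \<tau> \<and> path \<P> (Cod C g) \<tau> (Cod C h) \<and> derives \<alpha> S g T')"
proof (induction \<tau> arbitrary: \<alpha>)
  case (Cons f \<tau>)
  show ?case
  proof
    assume "derives (RPs (f # \<tau>) \<alpha>) S h T"
    then obtain g1 T1 where 1: "T = Poss \<tau> T1" "h = post g1 \<tau>" "path \<P> (Cod C g1) \<tau> (Cod C h)"
        "derives (RP f \<alpha>) S g1 T1" using Cons.IH[of "RP f \<alpha>"] by auto
    then obtain g T' where 2: "T1 = Pos f T'" "g1 = g \<cdot> f" "f \<in> \<P>" "Cod C g = Dom C f" "derives \<alpha> S g T'"
      by (auto simp: derives_RP_iff)
    then have "Cod C g1 = Cod C f" by (simp add: cod.Cod_Comp P_Arr derives_Arr)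
    with 1 2 show "\<exists>g T'. T = Poss (f # \<tau>) T' \<and> h = post g (f # \<tau>) \<and>
        path \<P> (Cod C g) (f # \<tau>) (Cod C h) \<and> derives \<alpha> S g T'"
      by (intro exI[of _ g] exI[of _ T']) simp
  next
    assume "\<exists>g T'. T = Poss (f # \<tau>) T' \<and> h = post g (f # \<tau>) \<and>
        path \<P> (Cod C g) (f # \<tau>) (Cod C h) \<and> derives \<alpha> S g T'"
    then obtain g T' where 1: "T = Poss \<tau> (Pos f T')" "h = post (g \<cdot> f) \<tau>" "f \<in> \<P>" "Cod C g = Dom C f"
        "path \<P> (Cod C f) \<tau> (Cod C h)" "derives \<alpha> S g T'" by auto
    then have "derives (RP f \<alpha>) S (g \<cdot> f) (Pos f T')" by (intro derives.RP)
    moreover have "Cod C (g \<cdot> f) = Cod C f" using 1 by (simp add: cod.Cod_Comp P_Arr derives_Arr)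
    ultimately have "derives (RPs \<tau> (RP f \<alpha>)) S h T" unfolding Cons.IH using 1 by metis
    then show "derives (RPs (f # \<tau>) \<alpha>) S h T" by simp
  qed
qed auto

lemma derives_expand_LP_iff: "derives (expand_LP \<pi> g \<alpha>) S g T \<longleftrightarrow>
    (\<exists>S'. S = Poss \<pi> S' \<and> g \<in> Arr C \<and> path \<P> (Dom C (pre \<pi> g)) \<pi> (Dom C g) \<and> derives \<alpha> S' (pre \<pi> g) T)"
proof (induction \<pi> arbitrary: \<alpha>)
  case Nil
  then show ?case by (auto dest: derives_Arr)
next
  case (Cons f \<pi>)
  have *: "pre \<pi> g \<in> Arr C \<and> Dom C (f \<cdot> pre \<pi> g) = Dom C f"
    if "f \<in> \<P>" "Cod C f = Dom C (pre \<pi> g)" "path \<P> (Dom C (pre \<pi> g)) \<pi> (Dom C g)" "g \<in> Arr C"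
    using that pre_typing[OF P_sub that(3,4)] by (simp add: cod.Dom_Comp P_Arr)
  moreover have "Cod C f = Dom C (pre \<pi> g)" if "path \<P> (Cod C f) \<pi> (Dom C g)" "g \<in> Arr C"
    using pre_typing[OF P_sub that] by simp
  ultimately show ?case by (simp add: derives_LP_iff Cons.IH) fastforce
qed

lemma derives_expand_RN_iff: "derives (expand_RN g \<rho> \<alpha>) S g T \<longleftrightarrow>
    (\<exists>T'. T = Negs \<rho> T' \<and> g \<in> Arr C \<and> path \<N> (Cod C g) \<rho> (Cod C (post g \<rho>)) \<and> derives \<alpha> S (post g \<rho>) T')"
proof (induction \<rho> arbitrary: g T)
  case Nil
  then show ?case by (auto dest: derives_Arr)
next
  case (Cons f \<rho>)
  have "Cod C (g \<cdot> f) = Cod C f \<and> g \<cdot> f \<in> Arr C" if "f \<in> \<N>" "Cod C g = Dom C f" "g \<in> Arr C"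
    using that by (simp add: cod.Cod_Comp cod.Comp_in N_Arr)
  then show ?case by (simp add: derives_RN_iff Cons.IH) fastforce
qed

lemma derives_LNs:
  assumes "derives \<alpha> S g T" "path \<N> A \<sigma> (Dom C g)"
  shows "derives (LNs \<sigma> \<alpha>) (Negs \<sigma> S) (pre \<sigma> g) T"
  using assms pre_typing[OF N_sub assms(2) derives_Arr[OF assms(1)]] by (auto simp: derives_LNs_iff)

lemma derives_RPs:
  assumes "derives \<alpha> S g T" "path \<P> (Cod C g) \<tau> B"
  shows "derives (RPs \<tau> \<alpha>) S (post g \<tau>) (Poss \<tau> T)"
  unfolding derives_RPs_iff
  using assms post_typing[OF P_sub assms(2) derives_Arr[OF assms(1)]]
  by (intro exI[of _ g] exI[of _ T]) simp

lemma derives_expand_LP: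
  assumes "derives \<alpha> S (pre \<pi> g) T" "path \<P> A \<pi> (Dom C g)" "g \<in> Arr C"
  shows "derives (expand_LP \<pi> g \<alpha>) (Poss \<pi> S) g T"
  using assms pre_typing[OF P_sub assms(2,3)] by (auto simp: derives_expand_LP_iff)

lemma derives_expand_RN:
  assumes "derives \<alpha> S (post g \<rho>) T" "path \<N> (Cod C g) \<rho> B" "g \<in> Arr C"
  shows "derives (expand_RN g \<rho> \<alpha>) S g (Negs \<rho> T)"
  using assms post_typing[OF N_sub assms(2,3)] by (auto simp: derives_expand_RN_iff)

lemma permeq_LNs: "\<lbrakk>\<alpha> \<sim> \<beta>; derives (LNs \<sigma> \<alpha>) S h T\<rbrakk> \<Longrightarrow> LNs \<sigma> \<alpha> \<sim> LNs \<sigma> \<beta>"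
proof (induction \<sigma> arbitrary: S h)
  case (Cons f \<sigma>)
  then obtain S' g where "derives (LNs \<sigma> \<alpha>) S' g T" by (auto simp: derives_LN_iff)
  with Cons have "LNs \<sigma> \<alpha> \<sim> LNs \<sigma> \<beta>" by blast
  from permeq_LN[OF this] Cons.prems show ?case by simp
qed simp

lemma permeq_RPs: "\<lbrakk>\<alpha> \<sim> \<beta>; derives (RPs \<tau> \<alpha>) S h T\<rbrakk> \<Longrightarrow> RPs \<tau> \<alpha> \<sim> RPs \<tau> \<beta>"
proof (induction \<tau> arbitrary: \<alpha> \<beta>)
  case (Cons f \<tau>)
  then obtain S' g T' where "derives (RP f \<alpha>) S' g T'" by (auto simp: derives_RPs_iff)
  from permeq_RP[OF Cons.prems(1) this] Cons.IH Cons.prems(2) show ?case by simp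
qed simp

lemma permeq_expand_LP:
  "\<lbrakk>\<alpha> \<sim> \<beta>; derives (expand_LP \<pi> g \<alpha>) S g T\<rbrakk> \<Longrightarrow> expand_LP \<pi> g \<alpha> \<sim> expand_LP \<pi> g \<beta>"
proof (induction \<pi> arbitrary: \<alpha> \<beta>)
  case (Cons f \<pi>)
  then obtain S' where "derives (LP f (pre \<pi> g) \<alpha>) S' (pre \<pi> g) T" by (auto simp: derives_expand_LP_iff)
  from permeq_LP[OF Cons.prems(1) this] Cons.IH Cons.prems(2) show ?case by simp
qed simp

lemma permeq_expand_RN:
  "\<lbrakk>\<alpha> \<sim> \<beta>; derives (expand_RN g \<rho> \<alpha>) S g T\<rbrakk> \<Longrightarrow> expand_RN g \<rho> \<alpha> \<sim> expand_RN g \<rho> \<beta>"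
proof (induction \<rho> arbitrary: g T)
  case (Cons f \<rho>)
  then obtain T' where "derives (expand_RN (g \<cdot> f) \<rho> \<alpha>) S (g \<cdot> f) T'" by (auto simp: derives_RN_iff)
  with Cons have "expand_RN (g \<cdot> f) \<rho> \<alpha> \<sim> expand_RN (g \<cdot> f) \<rho> \<beta>" by blast
  from permeq_RN[OF this] Cons.prems show ?case by simp
qed simp

section \<open>Exchanging whole blocks\<close>

lemma permute_RP_LNs: "derives (RP k (LNs \<sigma> \<alpha>)) S h T \<Longrightarrow> RP k (LNs \<sigma> \<alpha>) \<sim> LNs \<sigma> (RP k \<alpha>)"
proof (induction \<sigma> arbitrary: S h)
  case (Cons f \<sigma>)
  then have 1: "RP k (LN f (LNs \<sigma> \<alpha>)) \<sim> LN f (RP k (LNs \<sigma> \<alpha>))" using permute_RP_LN by simp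
  then have d: "derives (LN f (RP k (LNs \<sigma> \<alpha>))) S h T" using Cons.prems by (simp add: permeq_derives_iff[OF 1])
  then have "RP k (LNs \<sigma> \<alpha>) \<sim> LNs \<sigma> (RP k \<alpha>)" using Cons.IH by (auto simp: derives_LN_iff)
  from permeq.trans[OF 1 permeq_LN[OF this d]] show ?case by simp
qed (simp add: permeq.refl)

lemma permute_RPs_LNs:
  "derives (RPs \<tau> (LNs \<sigma> \<alpha>)) S h T \<Longrightarrow> RPs \<tau> (LNs \<sigma> \<alpha>) \<sim> LNs \<sigma> (RPs \<tau> \<alpha>)"
proof (induction \<tau> arbitrary: \<alpha>)
  case (Cons k \<tau>)
  then obtain S' g T' where "derives (RP k (LNs \<sigma> \<alpha>)) S' g T'" by (auto simp: derives_RPs_iff)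
  then have "RP k (LNs \<sigma> \<alpha>) \<sim> LNs \<sigma> (RP k \<alpha>)" by (rule permute_RP_LNs)
  then have 1: "RPs \<tau> (RP k (LNs \<sigma> \<alpha>)) \<sim> RPs \<tau> (LNs \<sigma> (RP k \<alpha>))"
    using Cons.prems by (intro permeq_RPs) simp_all
  then have "derives (RPs \<tau> (LNs \<sigma> (RP k \<alpha>))) S h T"
    using Cons.prems permeq_derives_iff[OF 1] by simp
  from permeq.trans[OF 1 Cons.IH[OF this]] show ?case by simp
qed (simp add: permeq.refl)

lemma permute_RP_expand_LP:
  "derives (RP k (expand_LP \<pi> e \<alpha>)) S (e \<cdot> k) T \<Longrightarrow> derives (expand_LP \<pi> e \<alpha>) S e T'
    \<Longrightarrow> RP k (expand_LP \<pi> e \<alpha>) \<sim> expand_LP \<pi> (e \<cdot> k) (RP k \<alpha>)"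
proof (induction \<pi> arbitrary: \<alpha>)
  case (Cons f \<pi>)
  let ?\<alpha> = "LP f (pre \<pi> e) \<alpha>"
  have 1: "RP k (expand_LP \<pi> e ?\<alpha>) \<sim> expand_LP \<pi> (e \<cdot> k) (RP k ?\<alpha>)" using Cons by simp
  then have d: "derives (expand_LP \<pi> (e \<cdot> k) (RP k ?\<alpha>)) S (e \<cdot> k) T"
    using Cons.prems(1) permeq_derives_iff by auto
  then obtain S' where "derives (RP k ?\<alpha>) S' (pre \<pi> (e \<cdot> k)) T" by (auto simp: derives_expand_LP_iff)
  then have 2: "RP k ?\<alpha> \<sim> LP f (pre \<pi> e \<cdot> k) (RP k \<alpha>)" by (rule permute_RP_LP)
  have "e \<in> Arr C" using Cons.prems(2) by (rule derives_Arr)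
  moreover have "k \<in> Arr C" "Cod C e = Dom C k"
    using Cons.prems derives_unique unfolding derives_RP_iff by (metis P_Arr)+
  moreover have "path \<P> (Dom C (pre \<pi> e)) \<pi> (Dom C e)"
    using Cons.prems(2) by (auto simp: derives_expand_LP_iff derives_LP_iff)
  ultimately have "pre \<pi> e \<cdot> k = pre \<pi> (e \<cdot> k)" using pre_Comp[OF P_sub] by metis
  with permeq.trans[OF 1 permeq_expand_LP[OF 2 d]] show ?case by simp
qed (simp add: permeq.refl)

text \<open>Here \<open>e\<close> plays the part of the diagonal in \<open>square_le_iff\<close>:
  once it is known, the right block \<tau> slides below the inversion block \<pi>. This is what a
  maximality condition rules out.\<close>

lemma permute_RPs_expand_LP:
  assumes "derives (expand_LP \<pi> e \<alpha>) S e (T :: ('x, 'a) fm)" "path \<P> (Cod C e) \<tau> B"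
  shows "RPs \<tau> (expand_LP \<pi> e \<alpha>) \<sim> expand_LP \<pi> (post e \<tau>) (RPs \<tau> \<alpha>)"
  using assms
proof (induction \<tau> arbitrary: e \<alpha> T)
  case (Cons k \<tau>)
  then have k: "k \<in> \<P>" "Cod C e = Dom C k" "e \<in> Arr C" by (auto dest: derives_Arr)
  then have d: "derives (RP k (expand_LP \<pi> e \<alpha>)) S (e \<cdot> k) (Pos k T)"
    using Cons.prems(1) by (intro derives.RP)
  then have 1: "RP k (expand_LP \<pi> e \<alpha>) \<sim> expand_LP \<pi> (e \<cdot> k) (RP k \<alpha>)"
    using Cons.prems(1) by (rule permute_RP_expand_LP)
  with d have d2: "derives (expand_LP \<pi> (e \<cdot> k) (RP k \<alpha>)) S (e \<cdot> k) (Pos k T)"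
    using permeq_derives_iff by blast
  have p: "path \<P> (Cod C (e \<cdot> k)) \<tau> B" using Cons.prems(2) k by (simp add: cod.Cod_Comp P_Arr)
  with d have "derives (RPs \<tau> (RP k (expand_LP \<pi> e \<alpha>))) S (post (e \<cdot> k) \<tau>) (Poss \<tau> (Pos k T))"
    using post_typing[OF P_sub p derives_Arr[OF d]] by (auto simp: derives_RPs_iff)
  from permeq.trans[OF permeq_RPs[OF 1 this] Cons.IH[OF d2 p]] show ?case by simp
qed (auto intro: permeq.refl)

lemma permute_LN_expand_RN:
  "derives (LN f (expand_RN e \<rho> \<alpha>)) S (f \<cdot> e) T \<Longrightarrow> derives (expand_RN e \<rho> \<alpha>) S' e T
    \<Longrightarrow> expand_RN (f \<cdot> e) \<rho> (LN f \<alpha>) \<sim> LN f (expand_RN e \<rho> \<alpha>)"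
proof (induction \<rho> arbitrary: e T)
  case (Cons k \<rho>)
  let ?\<alpha> = "expand_RN (e \<cdot> k) \<rho> \<alpha>"
  have t: "f \<in> \<N>" "k \<in> \<N>" "e \<in> Arr C" "Cod C f = Dom C e" "Cod C e = Dom C k"
    using Cons.prems by (auto simp: derives_RN_iff derives_LN_iff dest: derives_unique)
  from Cons.prems(2) obtain T' where T': "derives ?\<alpha> S' (e \<cdot> k) T'" "T = Neg k T'"
    by (auto simp: derives_RN_iff)
  then have d: "derives (LN f ?\<alpha>) (Neg f S') (f \<cdot> (e \<cdot> k)) T'"
    using t by (intro derives.LN) (simp_all add: cod.Dom_Comp N_Arr)
  have S: "S = Neg f S'"
    using Cons.prems derives_unique unfolding derives_LN_iff by blast
  have 1: "expand_RN (f \<cdot> (e \<cdot> k)) \<rho> (LN f \<alpha>) \<sim> LN f ?\<alpha>"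
    using Cons.IH[OF _ T'(1)] d S by simp
  have 2: "RN (f \<cdot> e) k (LN f ?\<alpha>) \<sim> LN f (RN e k ?\<alpha>)"
    using Cons.prems(1) by (intro permute_RN_LN) simp
  then have "derives (RN (f \<cdot> e) k (LN f ?\<alpha>)) S (f \<cdot> e) T"
    using Cons.prems(1) permeq_derives_iff by simp
  from permeq.trans[OF permeq.sym[OF permeq_RN[OF permeq.sym[OF 1] this]] 2] t
  show ?case by (simp add: cod.assoc N_Arr)
qed (simp add: permeq.refl)

text \<open>The dual slide, of a left block \<sigma> below an inversion block \<rho> along the
  diagonal \<open>e\<close>.\<close>

lemma permute_LNs_expand_RN:
  assumes "derives (expand_RN e \<rho> \<alpha>) S e (T :: ('x, 'a) fm)" "path \<N> A \<sigma> (Dom C e)"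
  shows "expand_RN (pre \<sigma> e) \<rho> (LNs \<sigma> \<alpha>) \<sim> LNs \<sigma> (expand_RN e \<rho> \<alpha>)"
  using assms(2)
proof (induction \<sigma> arbitrary: A)
  case Nil
  then show ?case using assms(1) by (auto intro: permeq.refl)
next
  case (Cons f \<sigma>)
  then have p: "path \<N> (Cod C f) \<sigma> (Dom C e)" "f \<in> \<N>" by auto
  note e = derives_Arr[OF assms(1)]
  note t = pre_typing[OF N_sub p(1) e]
  have d: "derives (LNs \<sigma> (expand_RN e \<rho> \<alpha>)) (Negs \<sigma> S) (pre \<sigma> e) T"
    using assms(1) p t by (auto simp: derives_LNs_iff)
  note 1 = Cons.IH[OF p(1)]
  then have d2: "derives (expand_RN (pre \<sigma> e) \<rho> (LNs \<sigma> \<alpha>)) (Negs \<sigma> S) (pre \<sigma> e) T"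
    using d permeq_derives_iff by blast
  then have d3: "derives (LN f (expand_RN (pre \<sigma> e) \<rho> (LNs \<sigma> \<alpha>))) (Neg f (Negs \<sigma> S)) (f \<cdot> pre \<sigma> e) T"
    using p t by (intro derives.LN) simp_all
  from permeq.trans[OF permute_LN_expand_RN[OF d3 d2] permeq_LN[OF 1 d3]] show ?case by simp
qed

lemma invert_expand_LP:
  assumes "derives \<alpha> (Poss \<pi> S) g T"
  obtains \<beta> where "derives \<beta> S (pre \<pi> g) T" "\<alpha> \<sim> expand_LP \<pi> g \<beta>"
proof -
  have "\<exists>\<beta>. derives \<beta> S (pre \<pi> g) T \<and> \<alpha> \<sim> expand_LP \<pi> g \<beta>"
    using assms
  proof (induction \<pi> arbitrary: S)
    case Nil
    then show ?case by (auto intro: permeq.refl)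
  next
    case (Cons f \<pi>)
    then obtain \<beta> where b: "derives \<beta> (Pos f S) (pre \<pi> g) T" "\<alpha> \<sim> expand_LP \<pi> g \<beta>" by auto
    from b(1) obtain \<gamma> where c: "derives \<gamma> S (f \<cdot> pre \<pi> g) T" "\<beta> \<sim> LP f (pre \<pi> g) \<gamma>" by (rule invert_LP)
    have "derives (expand_LP \<pi> g \<beta>) (Poss \<pi> (Pos f S)) g T"
      using b(2) Cons.prems permeq_derives_iff by auto
    from permeq.trans[OF b(2) permeq_expand_LP[OF c(2) this]] c show ?case by auto
  qed
  with that show thesis by blast
qed

lemma invert_expand_RN:
  assumes "derives \<alpha> S g (Negs \<rho> T)"
  obtains \<beta> where "derives \<beta> S (post g \<rho>) T" "\<alpha> \<sim> expand_RN g \<rho> \<beta>"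
proof -
  have "\<exists>\<beta>. derives \<beta> S (post g \<rho>) T \<and> \<alpha> \<sim> expand_RN g \<rho> \<beta>"
    using assms
  proof (induction \<rho> arbitrary: \<alpha> g)
    case Nil
    then show ?case by (auto intro: permeq.refl)
  next
    case (Cons f \<rho>)
    then have "derives \<alpha> S g (Neg f (Negs \<rho> T))" by simp
    then obtain \<beta> where b: "derives \<beta> S (g \<cdot> f) (Negs \<rho> T)" "\<alpha> \<sim> RN g f \<beta>" by (rule invert_RN)
    from Cons.IH[OF b(1)] obtain \<gamma> where c: "derives \<gamma> S (post (g \<cdot> f) \<rho>) T" "\<beta> \<sim> expand_RN (g \<cdot> f) \<rho> \<gamma>"
      by blast
    have "derives (RN g f \<beta>) S g (Neg f (Negs \<rho> T))"
      using b(2) Cons.prems permeq_derives_iff by auto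
    from permeq.trans[OF b(2) permeq_RN[OF c(2) this]] c show ?case by auto
  qed
  with that show thesis by blast
qed

end

section \<open>Cancelling and separating blocks\<close>

context preordered_bifibration_data
begin

lemma permeq_LNs_cancel: "LNs \<sigma> \<alpha> \<sim> LNs \<sigma> \<beta> \<Longrightarrow> \<alpha> \<sim> \<beta>"
  by (induction \<sigma>) (auto dest: permeq_LN_cancel)

lemma permeq_RPs_cancel: "RPs \<tau> \<alpha> \<sim> RPs \<tau> \<beta> \<Longrightarrow> \<alpha> \<sim> \<beta>"
  by (induction \<tau> arbitrary: \<alpha> \<beta>) (auto dest: permeq_RP_cancel)

lemma permeq_expand_LP_cancel: "expand_LP \<pi> g \<alpha> \<sim> expand_LP \<pi> g \<beta> \<Longrightarrow> \<alpha> \<sim> \<beta>"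
  by (induction \<pi> arbitrary: \<alpha> \<beta>) (auto dest: permeq_LP_cancel)

lemma permeq_expand_RN_cancel: "expand_RN g \<rho> \<alpha> \<sim> expand_RN g \<rho> \<beta> \<Longrightarrow> \<alpha> \<sim> \<beta>"
  by (induction \<rho> arbitrary: g) (auto dest: permeq_RN_cancel)

lemma permeq_RP_LNs:
  assumes "RP h \<alpha> \<sim> LNs \<sigma> \<beta>"
  shows "\<exists>\<gamma>. \<alpha> \<sim> LNs \<sigma> \<gamma> \<and> \<beta> \<sim> RP h \<gamma>"
  using assms
proof (induction \<sigma> arbitrary: \<alpha>)
  case Nil
  then obtain S k T where "derives (RP h \<alpha>) S k T" using permeq_derives by blast
  then have "\<alpha> \<sim> \<alpha>" unfolding derives_RP_iff using permeq.refl by blast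
  with Nil show ?case using permeq.sym by auto
next
  case (Cons f \<sigma>)
  then have "RP h \<alpha> \<sim> LN f (LNs \<sigma> \<beta>)" by simp
  then obtain \<gamma> where g: "\<alpha> \<sim> LN f \<gamma>" "LNs \<sigma> \<beta> \<sim> RP h \<gamma>" by (rule permeq_RP_LN)
  from Cons.IH[OF permeq.sym[OF g(2)]] obtain \<delta> where d: "\<gamma> \<sim> LNs \<sigma> \<delta>" "\<beta> \<sim> RP h \<delta>" by blast
  obtain S k T where "derives (LN f \<gamma>) S k T" using permeq_derives g(1) by blast
  from permeq.trans[OF g(1) permeq_LN[OF d(1) this]] d(2) show ?case by auto
qed

text \<open>The source of bi-focusing: a derivation that can be brought to end in either of two
  blocks has a common core \<gamma> above both of them. The proof repeats
  \<open>permeq_RP_LN\<close> rule by rule.\<close>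

lemma permeq_RPs_LNs:
  assumes "RPs \<tau> \<alpha> \<sim> LNs \<sigma> \<beta>"
  obtains \<gamma> where "\<alpha> \<sim> LNs \<sigma> \<gamma>" "\<beta> \<sim> RPs \<tau> \<gamma>"
proof -
  have "\<exists>\<gamma>. \<alpha> \<sim> LNs \<sigma> \<gamma> \<and> \<beta> \<sim> RPs \<tau> \<gamma>" using assms
  proof (induction \<tau> arbitrary: \<alpha>)
    case Nil
    then obtain S k T where "derives (LNs \<sigma> \<beta>) S k T" using permeq_derives by blast
    then have "\<beta> \<sim> \<beta>" unfolding derives_LNs_iff using permeq.refl by blast
    with Nil show ?case by auto
  next
    case (Cons h \<tau>)
    then obtain \<gamma> where g: "RP h \<alpha> \<sim> LNs \<sigma> \<gamma>" "\<beta> \<sim> RPs \<tau> \<gamma>" by auto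
    from permeq_RP_LNs[OF g(1)] obtain \<delta> where d: "\<alpha> \<sim> LNs \<sigma> \<delta>" "\<gamma> \<sim> RP h \<delta>" by blast
    obtain S k T where "derives (RPs \<tau> \<gamma>) S k T" using permeq_derives g(2) by blast
    from permeq.trans[OF g(2) permeq_RPs[OF d(2) this]] d(1) show ?case by auto
  qed
  with that show thesis by blast
qed

end


section \<open>Maximally multifocused derivations\<close>

context bifibration_data
begin

inductive_cases mmf_LFocE: "mmf_derives (LFoc \<sigma> d) S h q T"
inductive_cases mmf_RFocE: "mmf_derives (RFoc d \<tau>) S h q T"
inductive_cases mmf_ILE: "mmf_derives d S h IL T"
inductive_cases mmf_IRE: "mmf_derives d S h IR T"
inductive_cases mmf_IBotE: "mmf_derives d S h IBot T"

lemma derives_underlying: "mmf_derives d S h q T \<Longrightarrow> derives (underlying d) S h T"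
proof (induction rule: mmf_derives.induct)
  case (Axiom \<delta> q)
  then show ?case by (auto intro: derives.Ax)
next
  case (Inversion f A \<pi> \<rho> B N P q q' d)
  note t = pre_typing[OF P_sub Inversion.hyps(2,1)]
  from t Inversion.hyps have "path \<N> (Cod C (pre \<pi> f)) \<rho> B" by simp
  with Inversion.IH t have "derives (expand_RN (pre \<pi> f) \<rho> (underlying d)) N (pre \<pi> f) (Negs \<rho> P)"
    by (intro derives_expand_RN) simp_all
  from derives_expand_LP[OF this Inversion.hyps(2,1)] show ?case by simp
next
  case (Left_focus \<sigma> A g P Q q d)
  from derives_LNs[OF Left_focus.IH Left_focus.hyps(2)] show ?case by simp
next
  case (Right_focus \<tau> g B N M q d)
  from derives_RPs[OF Right_focus.IH Right_focus.hyps(2)] show ?case by simp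
next
  case (Bi_focus \<sigma> \<tau> A g B P N q d)
  note g = derives_Arr[OF Bi_focus.IH]
  have "path \<N> A \<sigma> (Dom C (post g \<tau>))"
    using post_typing[OF P_sub Bi_focus.hyps(4) g] Bi_focus.hyps(3) by simp
  from derives_LNs[OF derives_RPs[OF Bi_focus.IH Bi_focus.hyps(4)] this]
  show ?case using pre_post[OF N_sub P_sub Bi_focus.hyps(3,4) g] by simp
qed

lemma formula_Poss: "formula (Poss \<pi> S) B \<longleftrightarrow> (\<exists>A. formula S A \<and> path \<P> A \<pi> B)"
proof (induction \<pi> arbitrary: B rule: rev_induct)
  case (snoc f \<pi>)
  show ?case by (simp add: path_snoc snoc) (subst formula.simps, auto simp: snoc)
qed auto

lemma formula_Negs: "formula (Negs \<rho> S) A \<longleftrightarrow> (\<exists>B. formula S B \<and> path \<N> A \<rho> B)"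
proof (induction \<rho> arbitrary: A)
  case (Cons f \<rho>)
  show ?case by (simp add: Cons) (subst formula.simps, auto simp: Cons)
qed auto

text \<open>Exchanging \<open>RP\<close> with \<open>LN\<close> loses no arrow, so the exchange can
  also be justified from this side.\<close>

lemma permute_RPs_LNs_sym:
  assumes "derives (LNs \<sigma> (RPs \<tau> \<alpha>)) S h T"
  shows "RPs \<tau> (LNs \<sigma> \<alpha>) \<sim> LNs \<sigma> (RPs \<tau> \<alpha>)"
proof -
  from assms obtain g1 S' where 1: "S = Negs \<sigma> S'" "h = pre \<sigma> g1" "path \<N> (Dom C h) \<sigma> (Dom C g1)"
      "derives (RPs \<tau> \<alpha>) S' g1 T" by (auto simp: derives_LNs_iff)
  then obtain g T' where 2: "T = Poss \<tau> T'" "g1 = post g \<tau>" "path \<P> (Cod C g) \<tau> (Cod C g1)"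
      "derives \<alpha> S' g T'" by (auto simp: derives_RPs_iff)
  note g = derives_Arr[OF 2(4)]
  have p: "path \<N> (Dom C h) \<sigma> (Dom C g)" using 1(3) 2(2) post_typing[OF P_sub 2(3) g] by simp
  have "path \<P> (Cod C (pre \<sigma> g)) \<tau> (Cod C g1)" using 2(3) pre_typing[OF N_sub p g] by simp
  from derives_RPs[OF derives_LNs[OF 2(4) p] this] show ?thesis by (rule permute_RPs_LNs)
qed

text \<open>In a derivation that ends in a focusing phase, the left rules and the right rules of the
  outermost blocks commute until one of the two blocks is exhausted.\<close>

lemma exhaust_block:
  assumes "derives \<alpha> (Negs \<sigma> P) h (Poss \<tau> M)" "\<not> negative P" "\<not> positive M"
    and "\<sigma> = [] \<Longrightarrow> \<not> positive P" "\<tau> = [] \<Longrightarrow> \<not> negative M"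
  shows "(\<exists>\<delta>. \<alpha> = Ax \<delta>) \<or> \<sigma> \<noteq> [] \<and> (\<exists>\<beta>. \<alpha> \<sim> LNs \<sigma> \<beta>) \<or> \<tau> \<noteq> [] \<and> (\<exists>\<beta>. \<alpha> \<sim> RPs \<tau> \<beta>)"
  using assms
proof (induction \<alpha> arbitrary: \<sigma> \<tau> h)
  case (LP f g \<alpha>)
  then have "positive (Negs \<sigma> P)" by (auto simp: derives_LP_iff)
  with LP.prems show ?case by (auto simp: positive_Negs)
next
  case (RN f g \<alpha>)
  then have "negative (Poss \<tau> M)" by (auto simp: derives_RN_iff)
  with RN.prems show ?case by (auto simp: negative_Poss)
next
  case (LN f \<alpha>)
  then obtain g S' where d: "Negs \<sigma> P = Neg f S'" "derives \<alpha> S' g (Poss \<tau> M)" "h = f \<cdot> g"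
    by (auto simp: derives_LN_iff)
  with LN.prems(2) obtain \<sigma>' where s: "\<sigma> = f # \<sigma>'" "S' = Negs \<sigma>' P" by (cases \<sigma>) auto
  show ?case
  proof (cases "\<sigma>' = []")
    case True
    with s LN.prems(1) have "LN f \<alpha> \<sim> LNs \<sigma> \<alpha>" by (auto intro: permeq.refl)
    with s show ?thesis by blast
  next
    case False
    with LN.IH[of \<sigma>' g \<tau>] LN.prems d s consider \<delta> where "\<alpha> = Ax \<delta>" | \<beta> where "\<alpha> \<sim> LNs \<sigma>' \<beta>"
      | \<beta> where "\<tau> \<noteq> []" "\<alpha> \<sim> RPs \<tau> \<beta>" by blast
    then show ?thesis
    proof cases
      case 1
      with d s False show ?thesis by (cases \<sigma>') (auto elim!: derives_AxE)
    next
      case 2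
      from permeq_LN[OF this LN.prems(1)] have "LN f \<alpha> \<sim> LNs \<sigma> \<beta>" using s by simp
      with s show ?thesis by blast
    next
      case 3
      note e = permeq_LN[OF 3(2) LN.prems(1)]
      with LN.prems(1) have "derives (LNs [f] (RPs \<tau> \<beta>)) (Negs \<sigma> P) h (Poss \<tau> M)"
        using permeq_derives_iff by auto
      from permeq.trans[OF e] permeq.sym[OF permute_RPs_LNs_sym[OF this]] 3(1) show ?thesis
        by auto
    qed
  qed
next
  case (RP k \<alpha>)
  then obtain g T' where d: "Poss \<tau> M = Pos k T'" "derives \<alpha> (Negs \<sigma> P) g T'" "h = g \<cdot> k"
    by (auto simp: derives_RP_iff)
  with RP.prems(3) obtain \<tau>' where s: "\<tau> = \<tau>' @ [k]" "T' = Poss \<tau>' M"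
    by (cases \<tau> rule: rev_cases) auto
  show ?case
  proof (cases "\<tau>' = []")
    case True
    with s RP.prems(1) have "RP k \<alpha> \<sim> RPs \<tau> \<alpha>" by (auto intro: permeq.refl)
    with s show ?thesis by blast
  next
    case False
    with RP.IH[of \<sigma> g \<tau>'] RP.prems d s consider \<delta> where "\<alpha> = Ax \<delta>" | \<beta> where "\<alpha> \<sim> RPs \<tau>' \<beta>"
      | \<beta> where "\<sigma> \<noteq> []" "\<alpha> \<sim> LNs \<sigma> \<beta>" by blast
    then show ?thesis
    proof cases
      case 1
      with d s False show ?thesis by (cases \<tau>' rule: rev_cases) (auto elim!: derives_AxE)
    next
      case 2
      from permeq_RP[OF this RP.prems(1)] have "RP k \<alpha> \<sim> RPs \<tau> \<beta>" using s by simp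
      with s show ?thesis by blast
    next
      case 3
      note e = permeq_RP[OF 3(2) RP.prems(1)]
      with RP.prems(1) have "derives (RP k (LNs \<sigma> \<beta>)) (Negs \<sigma> P) h (Poss \<tau> M)"
        using permeq_derives_iff by blast
      from permeq.trans[OF e permute_RP_LNs[OF this]] 3(1) show ?thesis by blast
    qed
  qed
qed auto

end

section \<open>Existence of multifocused representatives\<close>

context preordered_bifibration_data
begin

text \<open>The state \<open>FL \<pi> f\<close> differs from \<open>FBot\<close> only by the
  maximality condition at the root of \<open>d\<close>. If it failed, the diagonal would let the
  block \<tau> slide below the inversion \<pi>, against \<open>no\<close>.\<close>

lemma mmf_FL:
  assumes d: "mmf_derives d N (pre \<pi> f) FBot (Poss \<tau> M)" and M: "\<not> positive M"
    and p: "path \<P> A \<pi> (Dom C f)" and f: "f \<in> Arr C"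
    and no: "\<And>\<beta>. \<tau> \<noteq> [] \<Longrightarrow> \<not> expand_LP \<pi> f (underlying d) \<sim> RPs \<tau> \<beta>"
  shows "mmf_derives d N (pre \<pi> f) (FL \<pi> f) (Poss \<tau> M)"
proof -
  \<comment> \<open>Stated for an arbitrary core \<alpha>, because in a bi-focus the part above
    \<tau> is not the stored premise but this premise with the left block \<sigma> applied.\<close>
  have max: "\<not> square_le (pre \<pi> (Id C (Dom C f)), f) (g, post (Id C (Cod C g)) \<tau>)"
    if t: "\<tau> \<noteq> []" and g: "derives \<alpha> N g M" and q: "path \<P> (Cod C g) \<tau> B"
      and u: "underlying d \<sim> RPs \<tau> \<alpha>" for g B \<alpha>
  proof
    assume "square_le (pre \<pi> (Id C (Dom C f)), f) (g, post (Id C (Cod C g)) \<tau>)"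
    then obtain e where e: "e \<in> Arr C" "Dom C e = Dom C f" "Cod C e = Cod C g" "g = pre \<pi> e" "f = post e \<tau>"
      unfolding square_le_iff[OF P_sub P_sub derives_Arr[OF g] f p q] by blast
    have dL: "derives (expand_LP \<pi> e \<alpha>) (Poss \<pi> N) e M"
      using g e p by (intro derives_expand_LP[of _ _ _ _ _ A]) simp_all
    have q': "path \<P> (Cod C e) \<tau> B" using q e by simp
    note c = permute_RPs_expand_LP[OF dL q']
    have "derives (RPs \<tau> (expand_LP \<pi> e \<alpha>)) (Poss \<pi> N) f (Poss \<tau> M)"
      using derives_RPs[OF dL q'] e by simp
    with c e have "derives (expand_LP \<pi> f (RPs \<tau> \<alpha>)) (Poss \<pi> N) f (Poss \<tau> M)"
      using permeq_derives_iff by blast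
    from permeq_expand_LP[OF permeq.sym[OF u] this] c e have "RPs \<tau> (expand_LP \<pi> e \<alpha>) \<sim> expand_LP \<pi> f (underlying d)"
      using permeq.trans by blast
    with no[OF t] show False using permeq.sym by blast
  qed
  from d show ?thesis
  proof cases
    case (Axiom \<delta>)
    then show ?thesis using mmf_derives.Axiom by fastforce
  next
    case (Left_focus \<sigma> A g P d')
    then show ?thesis using mmf_derives.Left_focus by fastforce
  next
    case (Right_focus \<tau>' g B M' d')
    then have t: "\<tau>' = \<tau>" "M' = M" using M Poss_inject by blast+
    note u = derives_underlying[OF Right_focus(10)]
    have "underlying d \<sim> RPs \<tau> (underlying d')"
      using Right_focus t derives_underlying[OF d] by (auto intro: permeq.refl)
    with max[of "underlying d'" g B] u Right_focus t have
      "\<not> square_le (pre \<pi> (Id C (Dom C f)), f) (g, post (Id C (Cod C g)) \<tau>)" by blast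
    with Right_focus t show ?thesis using mmf_derives.Right_focus[of \<tau> g B N M "FL \<pi> f" d'] by auto
  next
    case (Bi_focus \<sigma> \<tau>' A g B P M' d')
    then have t: "\<tau>' = \<tau>" "M' = M" using M Poss_inject by blast+
    note u = derives_underlying[OF Bi_focus(14)]
    note g = derives_Arr[OF u]
    note v = pre_typing[OF N_sub Bi_focus(7) g]
    have l: "derives (LNs \<sigma> (underlying d')) N (pre \<sigma> g) M"
      using derives_LNs[OF u Bi_focus(7)] t(2) Bi_focus(2) by simp
    have "derives (LNs \<sigma> (RPs \<tau> (underlying d'))) N (pre \<pi> f) (Poss \<tau> M)"
      using derives_underlying[OF d] Bi_focus(1) t(1) by simp
    from permeq.sym[OF permute_RPs_LNs_sym[OF this]] Bi_focus(1) t(1)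
    have "underlying d \<sim> RPs \<tau> (LNs \<sigma> (underlying d'))" by simp
    with max[OF _ l, of B] v Bi_focus t have
      "\<not> square_le (pre \<pi> (Id C (Dom C f)), f) (pre \<sigma> g, post (Id C (Cod C g)) \<tau>)" by auto
    with Bi_focus t show ?thesis
      using mmf_derives.Bi_focus[of \<sigma> \<tau> A g B P M "FL \<pi> f" d'] by auto
  qed auto
qed

text \<open>Dual: a failing condition would let the left block \<sigma> slide below the right
  inversion \<rho>.\<close>

lemma mmf_FR:
  assumes d: "mmf_derives d (Negs \<sigma> P) (post f \<rho>) FBot Q" and P: "\<not> negative P"
    and p: "path \<N> (Cod C f) \<rho> B" and f: "f \<in> Arr C"
    and no: "\<And>\<beta>. \<sigma> \<noteq> [] \<Longrightarrow> \<not> expand_RN f \<rho> (underlying d) \<sim> LNs \<sigma> \<beta>"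
  shows "mmf_derives d (Negs \<sigma> P) (post f \<rho>) (FR f \<rho>) Q"
proof -
  have max: "\<not> square_le (pre \<sigma> (Id C (Dom C g)), g) (f, post (Id C (Cod C f)) \<rho>)"
    if t: "\<sigma> \<noteq> []" and g: "derives \<alpha> P g Q" and q: "path \<N> A \<sigma> (Dom C g)"
      and u: "underlying d \<sim> LNs \<sigma> \<alpha>" for g A \<alpha>
  proof
    assume "square_le (pre \<sigma> (Id C (Dom C g)), g) (f, post (Id C (Cod C f)) \<rho>)"
    then obtain e where e: "e \<in> Arr C" "Dom C e = Dom C g" "Cod C e = Cod C f" "f = pre \<sigma> e" "g = post e \<rho>"
      unfolding square_le_iff[OF N_sub N_sub f derives_Arr[OF g] q p] by blast
    have dR: "derives (expand_RN e \<rho> \<alpha>) P e (Negs \<rho> Q)"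
      using g e p by (intro derives_expand_RN[of _ _ _ _ _ B]) simp_all
    have q': "path \<N> A \<sigma> (Dom C e)" using q e by simp
    note c = permute_LNs_expand_RN[OF dR q']
    have "derives (LNs \<sigma> (expand_RN e \<rho> \<alpha>)) (Negs \<sigma> P) f (Negs \<rho> Q)"
      using derives_LNs[OF dR q'] e by simp
    with c e have "derives (expand_RN f \<rho> (LNs \<sigma> \<alpha>)) (Negs \<sigma> P) f (Negs \<rho> Q)"
      using permeq_derives_iff by blast
    from permeq_expand_RN[OF permeq.sym[OF u] this] c e have "LNs \<sigma> (expand_RN e \<rho> \<alpha>) \<sim> expand_RN f \<rho> (underlying d)"
      using permeq.trans permeq.sym by blast
    with no[OF t] show False using permeq.sym by blast
  qed
  from d show ?thesis
  proof cases
    case (Axiom \<delta>)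
    then show ?thesis using mmf_derives.Axiom by fastforce
  next
    case (Right_focus \<tau> g B M d')
    then show ?thesis using mmf_derives.Right_focus by fastforce
  next
    case (Left_focus \<sigma>' A g P' d')
    then have t: "\<sigma>' = \<sigma>" "P' = P" using P Negs_inject by blast+
    note u = derives_underlying[OF Left_focus(10)]
    have "underlying d \<sim> LNs \<sigma> (underlying d')"
      using Left_focus t derives_underlying[OF d] by (auto intro: permeq.refl)
    with max[of "underlying d'" g A] u Left_focus t have
      "\<not> square_le (pre \<sigma> (Id C (Dom C g)), g) (f, post (Id C (Cod C f)) \<rho>)" by blast
    with Left_focus t show ?thesis using mmf_derives.Left_focus[of \<sigma> A g P Q "FR f \<rho>" d'] by auto
  next
    case (Bi_focus \<sigma>' \<tau> A g B P' M d')
    then have t: "\<sigma>' = \<sigma>" "P' = P" using P Negs_inject by blast+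
    note u = derives_underlying[OF Bi_focus(14)]
    note g = derives_Arr[OF u]
    note v = post_typing[OF P_sub Bi_focus(8) g]
    have l: "derives (RPs \<tau> (underlying d')) P (post g \<tau>) Q"
      using derives_RPs[OF u Bi_focus(8)] t Bi_focus by simp
    have "underlying d \<sim> LNs \<sigma> (RPs \<tau> (underlying d'))"
      using Bi_focus t derives_underlying[OF d] by (auto intro: permeq.refl)
    with max[OF _ l, of A] v Bi_focus t have
      "\<not> square_le (pre \<sigma> (Id C (Dom C g)), post g \<tau>) (f, post (Id C (Cod C f)) \<rho>)" by auto
    with Bi_focus t show ?thesis
      using mmf_derives.Bi_focus[of \<sigma> \<tau> A g B P M "FR f \<rho>" d'] by auto
  qed auto
qed


text \<open>At least one of the outermost blocks can be exhausted first; if both can, they are put into one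
  bi-focus, and otherwise the maximality condition holds because the other block cannot.\<close>

lemma ex_mmf_focused:
  assumes IH: "\<And>\<alpha> S h T. \<lbrakk>connectives S + connectives T < connectives N + connectives P; derives \<alpha> S h T\<rbrakk>
      \<Longrightarrow> \<exists>d. mmf_derives d S h IBot T \<and> underlying d \<sim> \<alpha>"
    and c: "derives \<gamma> N k P" and N: "\<not> positive N" and P: "\<not> negative P"
  shows "\<exists>d. mmf_derives d N k FBot P \<and> underlying d \<sim> \<gamma>"
proof -
  obtain \<sigma> P0 where N': "N = Negs \<sigma> P0" and P0: "\<not> negative P0" using ex_Negs by blast
  obtain \<tau> M0 where P': "P = Poss \<tau> M0" and M0: "\<not> positive M0" using ex_Poss by blast
  have left: "\<exists>g. derives \<delta> P0 g P \<and> k = pre \<sigma> g \<and> path \<N> (Dom C k) \<sigma> (Dom C g)"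
    if "\<gamma> \<sim> LNs \<sigma> \<delta>" for \<delta>
    using c N' unfolding permeq_derives_iff[OF that] derives_LNs_iff by auto
  have right: "\<exists>g. derives \<delta> N g M0 \<and> k = post g \<tau> \<and> path \<P> (Cod C g) \<tau> (Cod C k)"
    if "\<gamma> \<sim> RPs \<tau> \<delta>" for \<delta>
    using c P' unfolding permeq_derives_iff[OF that] derives_RPs_iff by auto
  have both: "\<gamma> \<sim> RPs \<tau> (LNs \<sigma> \<delta>)" if "\<gamma> \<sim> LNs \<sigma> (RPs \<tau> \<delta>)" for \<delta>
    using c permeq_derives_iff[OF that] permeq.trans[OF that permeq.sym[OF permute_RPs_LNs_sym]] by blast
  have ex: "(\<exists>\<delta>. \<gamma> = Ax \<delta>) \<or> \<sigma> \<noteq> [] \<and> (\<exists>\<beta>. \<gamma> \<sim> LNs \<sigma> \<beta>) \<or> \<tau> \<noteq> [] \<and> (\<exists>\<beta>. \<gamma> \<sim> RPs \<tau> \<beta>)"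
  proof (rule exhaust_block)
    show "\<sigma> = [] \<Longrightarrow> \<not> positive P0" "\<tau> = [] \<Longrightarrow> \<not> negative M0" using N N' P P' by simp_all
    show "derives \<gamma> (Negs \<sigma> P0) k (Poss \<tau> M0)" using c N' P' by simp
  qed (fact P0 M0)+
  \<comment> \<open>The last two cases record that the opposite block cannot come last; this is what
    yields the maximality condition one inversion higher.\<close>
  from ex consider (ax) \<delta> where "\<gamma> = Ax \<delta>"
    | (both) u v where "\<sigma> \<noteq> []" "\<tau> \<noteq> []" "\<gamma> \<sim> LNs \<sigma> u" "\<gamma> \<sim> RPs \<tau> v"
    | (left) u where "\<sigma> \<noteq> []" "\<gamma> \<sim> LNs \<sigma> u" "\<And>\<beta>. \<tau> \<noteq> [] \<Longrightarrow> \<not> \<gamma> \<sim> RPs \<tau> \<beta>"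
    | (right) v where "\<tau> \<noteq> []" "\<gamma> \<sim> RPs \<tau> v" "\<And>\<beta>. \<sigma> \<noteq> [] \<Longrightarrow> \<not> \<gamma> \<sim> LNs \<sigma> \<beta>"
    by blast
  then show ?thesis
  proof cases
    case ax
    with c obtain "\<delta> \<in> Arr D" "N = Atom (Dom D \<delta>)" "k = farr p \<delta>" "P = Atom (Cod D \<delta>)"
      by (auto elim: derives_AxE)
    then have "mmf_derives (MAx \<delta>) N k FBot P" by (simp add: mmf_derives.Axiom)
    moreover have "underlying (MAx \<delta>) \<sim> \<gamma>" using ax c by (auto intro: permeq.refl)
    ultimately show ?thesis by blast
  next
    case both
    from left[OF both(3)] obtain g where g: "derives u P0 g P" "k = pre \<sigma> g" "path \<N> (Dom C k) \<sigma> (Dom C g)"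
      by blast
    \<comment> \<open>Both blocks can come last, so they share a core \<open>w\<close>, to which the
      induction hypothesis applies.\<close>
    have "RPs \<tau> v \<sim> LNs \<sigma> u" using permeq.trans[OF permeq.sym[OF both(4)] both(3)] .
    then obtain w where w: "u \<sim> RPs \<tau> w" by (rule permeq_RPs_LNs)
    then obtain g' where g': "g = post g' \<tau>" "path \<P> (Cod C g') \<tau> (Cod C g)" "derives w P0 g' M0"
      using g(1) unfolding permeq_derives_iff[OF w] derives_RPs_iff P' by auto
    have "connectives P0 + connectives M0 < connectives N + connectives P"
      using both(1) by (auto simp: N' P')
    from IH[OF this g'(3)] obtain d where d: "mmf_derives d P0 g' IBot M0" "underlying d \<sim> w" by blast
    note t = post_typing[OF P_sub g'(2) derives_Arr[OF g'(3)]]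
    have p: "path \<N> (Dom C k) \<sigma> (Dom C g')" using g(3) g'(1) t by simp
    have "mmf_derives (BFoc \<sigma> d \<tau>) (Negs \<sigma> P0) (post (pre \<sigma> g') \<tau>) FBot (Poss \<tau> M0)"
      using both(1,2) p g'(2) P0 M0 d(1) by (intro mmf_derives.Bi_focus) auto
    moreover have "k = post (pre \<sigma> g') \<tau>"
      using pre_post[OF N_sub P_sub p g'(2) derives_Arr[OF g'(3)]] g(2) g'(1) by simp
    moreover have "underlying (BFoc \<sigma> d \<tau>) \<sim> \<gamma>"
    proof -
      have "derives (RPs \<tau> w) P0 g P" using g(1) permeq_derives_iff[OF w] by simp
      from permeq.trans[OF w permeq_RPs[OF permeq.sym[OF d(2)] this]]
      have e: "u \<sim> RPs \<tau> (underlying d)" .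
      have "derives (LNs \<sigma> u) N k P" using c permeq_derives_iff[OF both(3)] by simp
      from permeq.trans[OF both(3) permeq_LNs[OF e this]] show ?thesis by (simp add: permeq.sym)
    qed
    ultimately show ?thesis unfolding N' P' by blast
  next
    case left
    from \<open>\<gamma> \<sim> LNs \<sigma> u\<close> obtain g where g: "derives u P0 g P" "k = pre \<sigma> g" "path \<N> (Dom C k) \<sigma> (Dom C g)"
      using assms \<open>\<And>\<delta>. \<gamma> \<sim> LNs \<sigma> \<delta> \<Longrightarrow> _\<close> by blast
    have "connectives P0 + connectives P < connectives N + connectives P"
      using left(1) by (auto simp: N')
    from IH[OF this g(1)] obtain d where d: "mmf_derives d P0 g IBot P" "underlying d \<sim> u" by blast
    \<comment> \<open>The induction hypothesis provides only the state \<open>IBot\<close>. As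
      \<open>P\<close> is non-negative, its last inversion acts on the left alone, and it can be
      turned into state \<open>IL\<close> by passing its premise from \<open>FBot\<close> to
      \<open>FL\<close>.\<close>
    from d(1) obtain \<pi> d0 N0 A where i: "d = Inv \<pi> g [] d0" "P0 = Poss \<pi> N0" "path \<P> A \<pi> (Dom C g)"
        "g \<in> Arr C" "\<not> positive N0" "formula N0 A" "formula P (Cod C g)" "mmf_derives d0 N0 (pre \<pi> g) FBot P"
      using P by (cases rule: mmf_IBotE) (auto simp: negative_Negs)
    have u: "expand_LP \<pi> g (underlying d0) \<sim> u" using d(2) i(1) by simp
    have l: "derives (LNs \<sigma> u) N k P" using c permeq_derives_iff[OF left(2)] by simp
    have no: "\<not> expand_LP \<pi> g (underlying d0) \<sim> RPs \<tau> \<beta>" if "\<tau> \<noteq> []" for \<beta>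
    proof
      assume "expand_LP \<pi> g (underlying d0) \<sim> RPs \<tau> \<beta>"
      then have "u \<sim> RPs \<tau> \<beta>" using u permeq.sym permeq.trans by blast
      from permeq.trans[OF left(2) permeq_LNs[OF this l]] both left(3)[OF that] show False by blast
    qed
    have "mmf_derives d0 N0 (pre \<pi> g) (FL \<pi> g) P"
      using mmf_FL[of d0 N0 \<pi> g \<tau> M0 A] i(8,3,4) M0 no unfolding P' by blast
    then have "mmf_derives d P0 g IL P"
      using mmf_derives.Inversion[of g A \<pi> "[]" "Cod C g" N0 P IL "FL \<pi> g" d0] i P by simp
    then have "mmf_derives (LFoc \<sigma> d) N k FBot P"
      using mmf_derives.Left_focus[of \<sigma> "Dom C k" g P0 P FBot d] left(1) g P0 P by (simp add: N')
    moreover have "underlying (LFoc \<sigma> d) \<sim> \<gamma>"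
      using permeq.trans[OF left(2) permeq_LNs[OF permeq.sym[OF d(2)] l]] by (simp add: permeq.sym)
    ultimately show ?thesis by blast
  next
    case right
    from \<open>\<gamma> \<sim> RPs \<tau> v\<close> obtain g where g: "derives v N g M0" "k = post g \<tau>" "path \<P> (Cod C g) \<tau> (Cod C k)"
      using assms \<open>\<And>\<delta>. \<gamma> \<sim> RPs \<tau> \<delta> \<Longrightarrow> _\<close> by blast
    have "connectives N + connectives M0 < connectives N + connectives P"
      using right(1) by (auto simp: P')
    from IH[OF this g(1)] obtain d where d: "mmf_derives d N g IBot M0" "underlying d \<sim> v" by blast
    from d(1) obtain \<rho> d0 P1 B where i: "d = Inv [] g \<rho> d0" "M0 = Negs \<rho> P1" "path \<N> (Cod C g) \<rho> B"
        "g \<in> Arr C" "\<not> negative P1" "formula N (Dom C g)" "formula P1 B" "mmf_derives d0 N (post g \<rho>) FBot P1"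
      using N by (cases rule: mmf_IBotE) (auto simp: positive_Poss)
    have v: "expand_RN g \<rho> (underlying d0) \<sim> v" using d(2) i(1) by simp
    have l: "derives (RPs \<tau> v) N k P" using c permeq_derives_iff[OF right(2)] by simp
    have no: "\<not> expand_RN g \<rho> (underlying d0) \<sim> LNs \<sigma> \<beta>" if "\<sigma> \<noteq> []" for \<beta>
    proof
      assume "expand_RN g \<rho> (underlying d0) \<sim> LNs \<sigma> \<beta>"
      then have "v \<sim> LNs \<sigma> \<beta>" using v permeq.sym permeq.trans by blast
      from permeq_RPs[OF this l] l have e: "RPs \<tau> v \<sim> RPs \<tau> (LNs \<sigma> \<beta>)" "derives (RPs \<tau> (LNs \<sigma> \<beta>)) N k P"
        using permeq_derives_iff by blast+
      from permeq.trans[OF permeq.trans[OF right(2) e(1)] permute_RPs_LNs[OF e(2)]] right(3)[OF that]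
      show False by blast
    qed
    have "mmf_derives d0 N (post g \<rho>) (FR g \<rho>) P1"
      using mmf_FR[of d0 \<sigma> P0 g \<rho> P1 B] i(8,3,4) P0 no unfolding N' by blast
    then have "mmf_derives d N g IR M0"
      using mmf_derives.Inversion[of g "Dom C g" "[]" \<rho> B N P1 IR "FR g \<rho>" d0] i N by simp
    then have "mmf_derives (RFoc d \<tau>) N k FBot P"
      using mmf_derives.Right_focus[of \<tau> g "Cod C k" N M0 FBot d] right(1) g N M0 by (simp add: P')
    moreover have "underlying (RFoc d \<tau>) \<sim> \<gamma>"
      using permeq.trans[OF right(2) permeq_RPs[OF permeq.sym[OF d(2)] l]] by (simp add: permeq.sym)
    ultimately show ?thesis by blast
  qed
qed

text \<open>An inversion with empty blocks removes no connective, so the measure is sure to drop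
  only across a focus. Hence one induction step treats an inversion together with the focus above
  it.\<close>

lemma ex_mmf_derives:
  "derives \<alpha> S h T \<Longrightarrow> \<exists>d. mmf_derives d S h IBot T \<and> underlying d \<sim> \<alpha>"
proof (induction "connectives S + connectives T" arbitrary: \<alpha> S h T rule: less_induct)
  case less
  obtain \<pi> N where S: "S = Poss \<pi> N" and N: "\<not> positive N" using ex_Poss by blast
  obtain \<rho> P where T: "T = Negs \<rho> P" and P: "\<not> negative P" using ex_Negs by blast
  note h = derives_Arr[OF less.prems]
  obtain A where A: "formula N A" "path \<P> A \<pi> (Dom C h)"
    using derives_src[OF less.prems] unfolding S formula_Poss by blast
  obtain B where B: "formula P B" "path \<N> (Cod C h) \<rho> B"
    using derives_tgt[OF less.prems] unfolding T formula_Negs by blast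
  obtain \<beta> where b: "derives \<beta> N (pre \<pi> h) (Negs \<rho> P)" "\<alpha> \<sim> expand_LP \<pi> h \<beta>"
    using less.prems unfolding S T by (rule invert_expand_LP)
  obtain \<gamma> where c: "derives \<gamma> N (post (pre \<pi> h) \<rho>) P" "\<beta> \<sim> expand_RN (pre \<pi> h) \<rho> \<gamma>"
    using b(1) by (rule invert_expand_RN)
  have "connectives N + connectives P \<le> connectives S + connectives T" by (simp add: S T)
  with less.hyps obtain d where d: "mmf_derives d N (post (pre \<pi> h) \<rho>) FBot P" "underlying d \<sim> \<gamma>"
    using ex_mmf_focused[OF _ c(1) N P] by (meson order.strict_trans2)
  have "mmf_derives (Inv \<pi> h \<rho> d) S h IBot T"
    unfolding S T using h A B N P d(1) by (intro mmf_derives.Inversion[where q' = FBot]) auto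
  moreover have "underlying (Inv \<pi> h \<rho> d) \<sim> \<alpha>"
  proof -
    have "derives (expand_RN (pre \<pi> h) \<rho> \<gamma>) N (pre \<pi> h) (Negs \<rho> P)"
      using b(1) permeq_derives_iff[OF c(2)] by simp
    from permeq.trans[OF c(2) permeq_expand_RN[OF permeq.sym[OF d(2)] this]]
    have e: "\<beta> \<sim> expand_RN (pre \<pi> h) \<rho> (underlying d)" .
    have "derives (expand_LP \<pi> h \<beta>) S h T" using less.prems permeq_derives_iff[OF b(2)] by simp
    from permeq.trans[OF b(2) permeq_expand_LP[OF e this]] show ?thesis by (simp add: permeq.sym)
  qed
  ultimately show ?case by blast
qed

text \<open>This is where maximality is used for uniqueness. If \<sigma> could come last, it would
  slide down past \<tau> and past the right inversion above it. So a focus on \<sigma> above that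
  inversion would violate its condition, and if that focus is again purely on the right, the
  argument repeats in a smaller derivation.\<close>

lemma no_LNs_above_RFoc:
  "\<lbrakk>mmf_derives (RFoc d \<tau>) (Negs \<sigma> P) h q T; \<sigma> \<noteq> []; \<not> negative P\<rbrakk>
    \<Longrightarrow> \<not> underlying (RFoc d \<tau>) \<sim> LNs \<sigma> \<alpha>"
proof (induction "size d" arbitrary: d \<tau> h q T \<alpha> rule: less_induct)
  case less
  show ?case
  proof
    assume "underlying (RFoc d \<tau>) \<sim> LNs \<sigma> \<alpha>"
    then have "RPs \<tau> (underlying d) \<sim> LNs \<sigma> \<alpha>" by simp
    then obtain \<beta> where b: "underlying d \<sim> LNs \<sigma> \<beta>" by (rule permeq_RPs_LNs)
    from less.prems(1) obtain g M where M: "mmf_derives d (Negs \<sigma> P) g IR M"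
      by (cases rule: mmf_RFocE) auto
    then obtain \<rho> Q d' B where d: "d = Inv [] g \<rho> d'" "g \<in> Arr C" "path \<N> (Cod C g) \<rho> B" "M = Negs \<rho> Q"
        "\<not> negative Q" "mmf_derives d' (Negs \<sigma> P) (post g \<rho>) (FR g \<rho>) Q"
      using less.prems(2) by (cases rule: mmf_IRE) auto
    \<comment> \<open>Splitting \<sigma> off below the inversion leaves the base arrow
      \<open>g1\<close>; it serves as the diagonal in \<open>sq\<close>.\<close>
    obtain g1 where g1: "g = pre \<sigma> g1" "path \<N> (Dom C g) \<sigma> (Dom C g1)" "derives \<beta> P g1 M"
      using derives_underlying[OF M] unfolding permeq_derives_iff[OF b] derives_LNs_iff by auto
    from g1(3) obtain \<gamma> where c: "derives \<gamma> P (post g1 \<rho>) Q" "\<beta> \<sim> expand_RN g1 \<rho> \<gamma>"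
      unfolding d(4) by (rule invert_expand_RN)
    note a1 = derives_Arr[OF g1(3)]
    note t1 = pre_typing[OF N_sub g1(2) a1]
    have p1: "path \<N> (Cod C g1) \<rho> B" using d(3) g1(1) t1 by simp
    note t2 = post_typing[OF N_sub p1 a1]
    have b': "derives (LNs \<sigma> \<beta>) (Negs \<sigma> P) g M"
      using derives_underlying[OF M] permeq_derives_iff[OF b] by simp
    have "derives (expand_RN g1 \<rho> \<gamma>) P g1 M" using g1(3) permeq_derives_iff[OF c(2)] by simp
    from permeq.trans[OF permeq.trans[OF b permeq_LNs[OF c(2) b']]
        permeq.sym[OF permute_LNs_expand_RN[OF this g1(2)]]]
    have "expand_RN g \<rho> (underlying d') \<sim> expand_RN g \<rho> (LNs \<sigma> \<gamma>)" using d(1) g1(1) by simp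
    then have e: "underlying d' \<sim> LNs \<sigma> \<gamma>" by (rule permeq_expand_RN_cancel)
    have sq: "square_le (pre \<sigma> (Id C (Dom C g2)), g2) (g, post (Id C (Cod C g)) \<rho>)"
      if "g2 = post g1 \<rho>" "path \<N> A \<sigma> (Dom C g2)" for g2 A
      unfolding square_le_iff[OF N_sub N_sub d(2) derives_Arr[OF c(1), folded that(1)] that(2) d(3)]
      using that(1) g1(1) a1 conjunct2[OF conjunct2[OF t1]] conjunct1[OF conjunct2[OF t2]]
      by (intro exI[of _ g1]) simp
    from d(6) show False
    proof cases
      case (Axiom \<delta>)
      with less.prems(2) show False by (cases \<sigma>) auto
    next
      case (Left_focus \<sigma>' A g2 P' d2)
      then have s: "\<sigma>' = \<sigma>" "P' = P" using less.prems(3) Negs_inject by blast+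
      with e Left_focus have "underlying d2 \<sim> \<gamma>" by (auto dest: permeq_LNs_cancel)
      then have "g2 = post g1 \<rho>"
        using Left_focus c(1) derives_underlying derives_base permeq_base by metis
      with sq Left_focus s show False by blast
    next
      \<comment> \<open>No condition of state \<open>FR\<close> excludes another
        \<open>RFoc\<close>; \<sigma> could then also come last below that one.\<close>
      case (Right_focus \<tau>' g2 B' M' d2)
      with less.hyps[of d2 \<tau>'] d(1,6) less.prems(2,3) e show False by auto
    next
      case (Bi_focus \<sigma>' \<tau>' A g2 B' P' M' d2)
      then have s: "\<sigma>' = \<sigma>" "P' = P" using less.prems(3) Negs_inject by blast+
      with e Bi_focus have r: "RPs \<tau>' (underlying d2) \<sim> \<gamma>" by (auto dest: permeq_LNs_cancel)
      have u: "derives (underlying d2) P g2 M'" using Bi_focus s derives_underlying by blast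
      note ta = post_typing[OF P_sub Bi_focus(8) derives_Arr[OF u]]
      have "post g2 \<tau>' = post g1 \<rho>"
        using permeq_base[OF r] derives_base[OF c(1)] derives_base[OF derives_RPs[OF u Bi_focus(8)]] by simp
      with sq[of "post g2 \<tau>'" A] Bi_focus s ta show False by auto
    qed auto
  qed
qed

text \<open>Dual, with the block \<tau> sliding below the left inversion that follows the left
  focus. In a bi-focus the right block must first be brought below the left one, because
  \<open>underlying\<close> puts it above.\<close>

lemma no_RPs_above_LFoc:
  "\<lbrakk>mmf_derives (LFoc \<sigma> d) S h q (Poss \<tau> M); \<tau> \<noteq> []; \<not> positive M\<rbrakk>
    \<Longrightarrow> \<not> underlying (LFoc \<sigma> d) \<sim> RPs \<tau> \<alpha>"
proof (induction "size d" arbitrary: d \<sigma> h q S \<alpha> rule: less_induct)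
  case less
  show ?case
  proof
    assume "underlying (LFoc \<sigma> d) \<sim> RPs \<tau> \<alpha>"
    then have "RPs \<tau> \<alpha> \<sim> LNs \<sigma> (underlying d)" using permeq.sym by simp
    then obtain \<beta> where b: "underlying d \<sim> RPs \<tau> \<beta>" by (rule permeq_RPs_LNs)
    from less.prems(1) obtain g P where P: "mmf_derives d P g IL (Poss \<tau> M)"
      by (cases rule: mmf_LFocE) auto
    then obtain \<pi> N d' A where d: "d = Inv \<pi> g [] d'" "g \<in> Arr C" "path \<P> A \<pi> (Dom C g)" "P = Poss \<pi> N"
        "\<not> positive N" "mmf_derives d' N (pre \<pi> g) (FL \<pi> g) (Poss \<tau> M)"
      using less.prems(2) by (cases rule: mmf_ILE) auto
    obtain g1 where g1: "g = post g1 \<tau>" "path \<P> (Cod C g1) \<tau> (Cod C g)" "derives \<beta> P g1 M"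
      using derives_underlying[OF P] unfolding permeq_derives_iff[OF b] derives_RPs_iff by auto
    from g1(3) obtain \<gamma> where c: "derives \<gamma> N (pre \<pi> g1) M" "\<beta> \<sim> expand_LP \<pi> g1 \<gamma>"
      unfolding d(4) by (rule invert_expand_LP)
    note a1 = derives_Arr[OF g1(3)]
    note t1 = post_typing[OF P_sub g1(2) a1]
    have p1: "path \<P> A \<pi> (Dom C g1)" using d(3) g1(1) t1 by simp
    note t2 = pre_typing[OF P_sub p1 a1]
    have b': "derives (RPs \<tau> \<beta>) P g (Poss \<tau> M)"
      using derives_underlying[OF P] permeq_derives_iff[OF b] by simp
    have "derives (expand_LP \<pi> g1 \<gamma>) P g1 M" using g1(3) permeq_derives_iff[OF c(2)] by simp
    from permeq.trans[OF permeq.trans[OF b permeq_RPs[OF c(2) b']]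
        permute_RPs_expand_LP[OF this g1(2)]]
    have "expand_LP \<pi> g (underlying d') \<sim> expand_LP \<pi> g (RPs \<tau> \<gamma>)" using d(1) g1(1) by simp
    then have e: "underlying d' \<sim> RPs \<tau> \<gamma>" by (rule permeq_expand_LP_cancel)
    have sq: "square_le (pre \<pi> (Id C (Dom C g)), g) (g2, post (Id C (Cod C g2)) \<tau>)"
      if "g2 = pre \<pi> g1" "path \<P> (Cod C g2) \<tau> B" for g2 B
      unfolding square_le_iff[OF P_sub P_sub derives_Arr[OF c(1), folded that(1)] d(2) d(3) that(2)]
      using that(1) g1(1) a1 conjunct1[OF conjunct2[OF t1]] conjunct2[OF conjunct2[OF t2]]
      by (intro exI[of _ g1]) simp
    from d(6) show False
    proof cases
      case (Axiom \<delta>)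
      with less.prems(2) show False by (cases \<tau> rule: rev_cases) auto
    next
      case (Right_focus \<tau>' g2 B M' d2)
      then have s: "\<tau>' = \<tau>" "M' = M" using less.prems(3) Poss_inject by blast+
      with e Right_focus have "underlying d2 \<sim> \<gamma>" by (auto dest: permeq_RPs_cancel)
      then have "g2 = pre \<pi> g1"
        using Right_focus c(1) derives_underlying derives_base permeq_base by metis
      with sq Right_focus s show False by blast
    next
      case (Left_focus \<sigma>' A' g2 P' d2)
      with less.hyps[of d2 \<sigma>'] d(1,6) less.prems(2,3) e show False by auto
    next
      case (Bi_focus \<sigma>' \<tau>' A' g2 B P' M' d2)
      then have s: "\<tau>' = \<tau>" "M' = M" using less.prems(3) Poss_inject by blast+
      have u: "derives (underlying d2) P' g2 M" using Bi_focus s derives_underlying by blast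
      note ta = pre_typing[OF N_sub Bi_focus(7) derives_Arr[OF u]]
      have l: "derives (LNs \<sigma>' (underlying d2)) N (pre \<sigma>' g2) M"
        using derives_LNs[OF u Bi_focus(7)] Bi_focus by simp
      have "derives (LNs \<sigma>' (RPs \<tau> (underlying d2))) N (pre \<pi> g) (Poss \<tau> M)"
        using derives_underlying[OF d(6)] Bi_focus(1) s by simp
      from permeq.trans[OF permute_RPs_LNs_sym[OF this]] e Bi_focus(1) s
      have "RPs \<tau> (LNs \<sigma>' (underlying d2)) \<sim> RPs \<tau> \<gamma>" by simp
      then have r: "LNs \<sigma>' (underlying d2) \<sim> \<gamma>" by (rule permeq_RPs_cancel)
      have "pre \<sigma>' g2 = pre \<pi> g1" using permeq_base[OF r] derives_base[OF c(1)] derives_base[OF l] by simp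
      with sq[of "pre \<sigma>' g2" B] Bi_focus s ta show False by auto
    qed auto
  qed
qed

text \<open>Which blocks can come last decides the root rule: a left focus cannot be equivalent to a
  derivation ending in the right block, nor a right focus to one ending in the left block, while a
  bi-focus is equivalent to both. Once the root rules agree, the maximal blocks agree, and
  cancellation reduces to the premises.\<close>

lemma underlying_inject:
  "\<lbrakk>mmf_derives d S h q T; mmf_derives d' S h q T; underlying d \<sim> underlying d'\<rbrakk> \<Longrightarrow> d = d'"
proof (induction arbitrary: d' rule: mmf_derives.induct)
  case (Axiom \<delta> q)
  from Axiom.prems(1) show ?case
  proof cases
    case (Axiom \<delta>')
    then show ?thesis using Axiom.prems(2) permeq_Ax by auto
  next
    case Inversion
    with \<open>pre_focus q\<close> show ?thesis by auto
  next
    case (Left_focus \<sigma>)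
    then show ?thesis by (cases \<sigma>) auto
  next
    case (Right_focus \<tau>)
    then show ?thesis by (cases \<tau> rule: rev_cases) auto
  next
    case (Bi_focus \<sigma>)
    then show ?thesis by (cases \<sigma>) auto
  qed
next
  case (Inversion f A \<pi> \<rho> B N P q q' d)
  from Inversion.prems(1) show ?case
  proof cases
    case i: (Inversion A' \<pi>' \<rho>' B' N' P' q'' d'')
    then have e: "\<pi>' = \<pi>" "N' = N" "\<rho>' = \<rho>" "P' = P"
      using Poss_inject Negs_inject Inversion.hyps by metis+
    with i Inversion.hyps have "q'' = q'" by auto
    moreover have "expand_LP \<pi> f (expand_RN (pre \<pi> f) \<rho> (underlying d))
        \<sim> expand_LP \<pi> f (expand_RN (pre \<pi> f) \<rho> (underlying d''))"
      using Inversion.prems(2) i(1) e by simp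
    then have "underlying d \<sim> underlying d''"
      by (rule permeq_expand_RN_cancel[OF permeq_expand_LP_cancel])
    ultimately show ?thesis using Inversion.IH[of d''] i e by simp
  qed (use Inversion.hyps in auto)
next
  case (Left_focus \<sigma> A g P Q q d)
  from Left_focus.prems(1) show ?case
  proof cases
    case (Axiom \<delta>')
    with Left_focus.hyps show ?thesis by (cases \<sigma>) auto
  next
    case Inversion
    with Left_focus.hyps show ?thesis by auto
  next
    case l: (Left_focus \<sigma>' A' g' P' d'')
    then have e: "\<sigma>' = \<sigma>" "P' = P" using Negs_inject Left_focus.hyps by metis+
    with Left_focus.prems(2) l have u: "underlying d \<sim> underlying d''" by (auto dest: permeq_LNs_cancel)
    then have "g' = g" using derives_underlying[OF Left_focus.hyps(7)] derives_underlying[OF l(10)]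
      permeq_base derives_base by metis
    with Left_focus.IH[of d''] u l e show ?thesis by simp
  next
    case r: (Right_focus \<tau> g' B M d'')
    show ?thesis
      using no_LNs_above_RFoc[OF Left_focus.prems(1)[unfolded r(1)]] Left_focus.hyps Left_focus.prems(2) r(1)
        permeq.sym by fastforce
  next
    case b: (Bi_focus \<sigma>' \<tau> A' g' B P' M d'')
    have l: "mmf_derives (LFoc \<sigma> d) (Negs \<sigma> P) (pre \<sigma> g) q (Poss \<tau> M)"
      using mmf_derives.Left_focus[OF Left_focus.hyps] b(4) by simp
    have "derives (underlying d') (Negs \<sigma> P) (pre \<sigma> g) Q"
      using Left_focus.prems(1) by (rule derives_underlying)
    then have "underlying d' \<sim> RPs \<tau> (LNs \<sigma>' (underlying d''))"
      using b(1) permute_RPs_LNs_sym permeq.sym by auto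
    with no_RPs_above_LFoc[OF l] b Left_focus.prems(2) permeq.trans show ?thesis by blast
  qed
next
  case (Right_focus \<tau> g B N M q d)
  from Right_focus.prems(1) show ?case
  proof cases
    case (Axiom \<delta>')
    with Right_focus.hyps show ?thesis by (cases \<tau> rule: rev_cases) auto
  next
    case Inversion
    with Right_focus.hyps show ?thesis by auto
  next
    case r: (Right_focus \<tau>' g' B' M' d'')
    then have e: "\<tau>' = \<tau>" "M' = M" using Poss_inject Right_focus.hyps by metis+
    with Right_focus.prems(2) r have u: "underlying d \<sim> underlying d''" by (auto dest: permeq_RPs_cancel)
    then have "g' = g" using derives_underlying[OF Right_focus.hyps(7)] derives_underlying[OF r(10)]
      permeq_base derives_base by metis
    with Right_focus.IH[of d''] u r e show ?thesis by simp
  next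
    case l: (Left_focus \<sigma> A g' P d'')
    show ?thesis
      using no_RPs_above_LFoc[OF Right_focus.prems(1)[unfolded l(1)]] Right_focus.hyps Right_focus.prems(2) l(1)
        permeq.sym by fastforce
  next
    case b: (Bi_focus \<sigma> \<tau>' A g' B' P M' d'')
    have "mmf_derives (RFoc d \<tau>) (Negs \<sigma> P) (post g \<tau>) q (Poss \<tau> M)"
      using mmf_derives.Right_focus[OF Right_focus.hyps] b(2) by simp
    from no_LNs_above_RFoc[OF this] b Right_focus.prems(2) show ?thesis by auto
  qed
next
  case (Bi_focus \<sigma> \<tau> A g B P N q d)
  from Bi_focus.prems(1) show ?case
  proof cases
    case (Axiom \<delta>')
    with Bi_focus.hyps show ?thesis by (cases \<sigma>) auto
  next
    case Inversion
    with Bi_focus.hyps show ?thesis by auto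
  next
    case l: (Left_focus \<sigma>' A' g' P' d'')
    have "mmf_derives (BFoc \<sigma> d \<tau>) (Negs \<sigma> P) (post (pre \<sigma> g) \<tau>) q (Poss \<tau> N)"
      by (rule mmf_derives.Bi_focus[OF Bi_focus.hyps])
    from permute_RPs_LNs_sym[OF derives_underlying[OF this, simplified]] Bi_focus.prems(2)
    have "underlying (LFoc \<sigma>' d'') \<sim> RPs \<tau> (LNs \<sigma> (underlying d))"
      using l(1) permeq.trans permeq.sym by (metis underlying.simps(5))
    with no_RPs_above_LFoc[OF Bi_focus.prems(1)[unfolded l(1)]] Bi_focus.hyps show ?thesis by blast
  next
    case r: (Right_focus \<tau>' g' B' M d'')
    from no_LNs_above_RFoc[OF Bi_focus.prems(1)[unfolded r(1)]] Bi_focus.hyps Bi_focus.prems(2) r(1)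
    show ?thesis using permeq.sym by fastforce
  next
    case b: (Bi_focus \<sigma>' \<tau>' A' g' B' P' N' d'')
    then have e: "\<sigma>' = \<sigma>" "P' = P" "\<tau>' = \<tau>" "N' = N"
      using Negs_inject Poss_inject Bi_focus.hyps by metis+
    with Bi_focus.prems(2) b have u: "underlying d \<sim> underlying d''"
      by (auto dest!: permeq_LNs_cancel permeq_RPs_cancel)
    then have "g' = g" using derives_underlying[OF Bi_focus.hyps(10)] derives_underlying[OF b(14)]
      permeq_base derives_base by metis
    with Bi_focus.IH[of d''] u b e show ?thesis by simp
  qed
qed

end

section \<open>The category of formulas\<close>

context bifibration_data
begin

lemma perm_class_eq_iff:
  assumes "derives \<alpha> S h T" shows "perm_class \<alpha> = perm_class \<beta> \<longleftrightarrow> \<alpha> \<sim> \<beta>"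
proof
  assume "perm_class \<alpha> = perm_class \<beta>"
  moreover have "\<alpha> \<in> perm_class \<alpha>" using assms by (simp add: perm_class_def permeq.refl)
  ultimately show "\<alpha> \<sim> \<beta>" by (auto simp: perm_class_def intro: permeq.sym)
next
  assume "\<alpha> \<sim> \<beta>"
  then show "perm_class \<alpha> = perm_class \<beta>"
    unfolding perm_class_def using permeq.sym permeq.trans by blast
qed

lemma ex_perm_class_derives:
  assumes "derives \<alpha> S h T"
  shows "(\<exists>\<beta>\<in>perm_class \<alpha>. derives \<beta> S' h' T') \<longleftrightarrow> S' = S \<and> h' = h \<and> T' = T"
proof
  assume "\<exists>\<beta>\<in>perm_class \<alpha>. derives \<beta> S' h' T'"
  then obtain \<beta> where "\<alpha> \<sim> \<beta>" "derives \<beta> S' h' T'" by (auto simp: perm_class_def)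
  then have "derives \<alpha> S' h' T'" using permeq_derives_iff by blast
  with assms show "S' = S \<and> h' = h \<and> T' = T" using derives_unique by blast
next
  assume "S' = S \<and> h' = h \<and> T' = T"
  with assms show "\<exists>\<beta>\<in>perm_class \<alpha>. derives \<beta> S' h' T'"
    by (auto simp: perm_class_def intro: permeq.refl)
qed

lemma Bif_perm_class:
  assumes "derives \<alpha> S h T"
  shows "perm_class \<alpha> \<in> Arr Bif" "Dom Bif (perm_class \<alpha>) = S" "Cod Bif (perm_class \<alpha>) = T"
    "farr Bif_proj (perm_class \<alpha>) = h"
proof -
  show "perm_class \<alpha> \<in> Arr Bif"
    using assms unfolding Bif_def quotient_def by (auto simp: perm_class_def Image_def)
  show "Dom Bif (perm_class \<alpha>) = S"
  proof -
    have "(\<exists>\<beta>\<in>perm_class \<alpha>. \<exists>h' T'. derives \<beta> S' h' T') \<longleftrightarrow> (\<exists>h' T'. \<exists>\<beta>\<in>perm_class \<alpha>. derives \<beta> S' h' T')" for S'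
      by blast
    then show ?thesis by (simp add: Bif_def ex_perm_class_derives[OF assms])
  qed
  show "Cod Bif (perm_class \<alpha>) = T"
  proof -
    have "(\<exists>\<beta>\<in>perm_class \<alpha>. \<exists>S' h'. derives \<beta> S' h' T') \<longleftrightarrow> (\<exists>S' h'. \<exists>\<beta>\<in>perm_class \<alpha>. derives \<beta> S' h' T')" for T'
      by blast
    then show ?thesis by (simp add: Bif_def ex_perm_class_derives[OF assms])
  qed
  show "farr Bif_proj (perm_class \<alpha>) = h"
  proof -
    have "(\<exists>\<beta>\<in>perm_class \<alpha>. \<exists>S' T'. derives \<beta> S' h' T') \<longleftrightarrow> (\<exists>S' T'. \<exists>\<beta>\<in>perm_class \<alpha>. derives \<beta> S' h' T')" for h'
      by blast
    then show ?thesis by (simp add: Bif_proj_def ex_perm_class_derives[OF assms])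
  qed
qed

lemma hom_over_Bif: "hom_over Bif Bif_proj S h T = perm_class ` {\<alpha>. derives \<alpha> S h T}"
proof (intro equalityI subsetI)
  fix F assume F: "F \<in> hom_over Bif Bif_proj S h T"
  then have "F \<in> Arr Bif" by (simp add: hom_over_def hom_def)
  then obtain \<alpha> S' h' T' where a: "derives \<alpha> S' h' T'" "F = perm_class \<alpha>"
    unfolding Bif_def quotient_def by (auto simp: perm_class_def Image_def)
  with F Bif_perm_class[OF a(1)] show "F \<in> perm_class ` {\<alpha>. derives \<alpha> S h T}"
    by (auto simp: hom_over_def hom_def)
qed (auto simp: hom_over_def hom_def Bif_perm_class)

text \<open>\<open>after f h\<close> and \<open>before h f\<close> are the sets of arrows of the coslice from \<open>f\<close> to \<open>h\<close> and of the
  slice from \<open>h\<close> to \<open>f\<close>.\<close>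

definition after :: "'a \<Rightarrow> 'a \<Rightarrow> 'a set" where
  "after f h = {e \<in> Arr C. Cod C f = Dom C e \<and> f \<cdot> e = h}"

definition before :: "'a \<Rightarrow> 'a \<Rightarrow> 'a set" where
  "before h f = {e \<in> Arr C. Cod C e = Dom C f \<and> e \<cdot> f = h}"

text \<open>The test separates the part where \<open>effective_coslices\<close> promises an
  enumeration from the part where there is no arrow at all.\<close>

lemma coslice_after:
  assumes "f \<in> Arr C" "h \<in> Arr C"
  shows "after f h = (if Dom C f = Dom C h
    then {e. (f, e, h) \<in> hom (coslice C (Dom C f)) f h} else {})"
  using assms by (auto simp: after_def hom_def coslice_def cod.Dom_Comp)

lemma slice_before:
  assumes "f \<in> Arr C" "h \<in> Arr C"
  shows "before h f = (if Cod C h = Cod C f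
    then {e. (h, e, f) \<in> hom (slice C (Cod C h)) h f} else {})"
  using assms by (auto simp: before_def hom_def slice_def cod.Cod_Comp)

lemma finite_after:
  assumes "locally_finite_coslices C" "f \<in> Arr C" "h \<in> Arr C" shows "finite (after f h)"
proof (cases "Dom C f = Dom C h")
  case True
  with assms have "finite (hom (coslice C (Dom C f)) f h)"
    unfolding locally_finite_coslices_def locally_finite_def
    by (auto simp: coslice_def cod.Dom_in)
  then have "finite ((\<lambda>(f, e, h). e) ` hom (coslice C (Dom C f)) f h)" by (rule finite_imageI)
  moreover have "after f h \<subseteq> (\<lambda>(f, e, h). e) ` hom (coslice C (Dom C f)) f h"
    using assms True by (force simp: coslice_after)
  ultimately show ?thesis by (rule rev_finite_subset)
qed (use assms in \<open>simp add: coslice_after\<close>)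

lemma finite_before:
  assumes "locally_finite_slices C" "f \<in> Arr C" "h \<in> Arr C" shows "finite (before h f)"
proof (cases "Cod C h = Cod C f")
  case True
  with assms have "finite (hom (slice C (Cod C h)) h f)"
    unfolding locally_finite_slices_def locally_finite_def
    by (auto simp: slice_def cod.Cod_in)
  then have "finite ((\<lambda>(f, e, h). e) ` hom (slice C (Cod C h)) h f)" by (rule finite_imageI)
  moreover have "before h f \<subseteq> (\<lambda>(f, e, h). e) ` hom (slice C (Cod C h)) h f"
    using assms True by (force simp: slice_before)
  ultimately show ?thesis by (rule rev_finite_subset)
qed (use assms in \<open>simp add: slice_before\<close>)

text \<open>For \<open>LP\<close> and \<open>RN\<close> the base arrow of the premise is a
  determined composite. For \<open>LN\<close> and \<open>RP\<close> it ranges over the arrows of a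
  coslice or slice between two fixed objects, a finite set. The premise has one connective
  less.\<close>

lemma finite_derivations:
  assumes "relatively_locally_finite C D p" "locally_finite_slices C" "locally_finite_coslices C"
    and "h \<in> Arr C"
  shows "finite {\<alpha>. derives \<alpha> S h T}"
  using assms(4)
proof (induction "connectives S + connectives T" arbitrary: S h T rule: less_induct)
  case less
  let ?D = "\<lambda>S h T. {\<alpha>. derives \<alpha> S h T}"
  \<comment> \<open>The guards provide the membership in \<open>Arr C\<close> on which the induction
    hypothesis and the finiteness of \<open>after\<close> and \<open>before\<close> depend.\<close>
  let ?L = "case S of Atom X \<Rightarrow> {} | Pos f S' \<Rightarrow> if f \<cdot> h \<in> Arr C then LP f h ` ?D S' (f \<cdot> h) T else {}
    | Neg f S' \<Rightarrow> if f \<in> Arr C then \<Union>e\<in>after f h. LN f ` ?D S' e T else {}"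
  let ?R = "case T of Atom X \<Rightarrow> {} | Pos f T' \<Rightarrow> if f \<in> Arr C then \<Union>e\<in>before h f. RP f ` ?D S e T' else {}
    | Neg f T' \<Rightarrow> if h \<cdot> f \<in> Arr C then RN h f ` ?D S (h \<cdot> f) T' else {}"
  let ?A = "case S of Atom X \<Rightarrow> (case T of Atom Y \<Rightarrow> if fobj p X = Dom C h \<and> fobj p Y = Cod C h \<and> X \<in> Obj D \<and> Y \<in> Obj D
      then Ax ` hom_over D p X h Y else {} | _ \<Rightarrow> {}) | _ \<Rightarrow> {}"
  have sub: "?D S h T \<subseteq> ?L \<union> ?R \<union> ?A"
  proof
    fix \<alpha> assume "\<alpha> \<in> ?D S h T"
    then have "derives \<alpha> S h T" by simp
    then show "\<alpha> \<in> ?L \<union> ?R \<union> ?A"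
    proof cases
      case (Ax \<delta>)
      then show ?thesis
        by (auto simp: hom_over_def hom_def Dom_farr Cod_farr dom.Dom_in dom.Cod_in)
    next
      case (LP f S' \<alpha>')
      then show ?thesis by (auto simp: cod.Comp_in P_Arr)
    next
      case (RP f f' \<alpha>' S')
      then show ?thesis by (auto simp: before_def P_Arr dest: derives_Arr)
    next
      case (LN g g' \<alpha>' T')
      then show ?thesis by (auto simp: after_def N_Arr dest: derives_Arr)
    next
      case (RN g T' \<alpha>')
      then show ?thesis by (auto simp: cod.Comp_in N_Arr)
    qed
  qed
  have "finite ?L"
    using less.hyps finite_after[OF assms(3) _ less.prems]
    by (auto split: fm.split simp: after_def)
  moreover have "finite ?R"
    using less.hyps finite_before[OF assms(2) _ less.prems]
    by (auto split: fm.split simp: before_def)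
  moreover have "finite ?A"
    using assms(1) less.prems unfolding relatively_locally_finite_def by (auto split: fm.split)
  ultimately have "finite (?L \<union> ?R \<union> ?A)" by (intro finite_UnI)
  with sub show ?case by (rule finite_subset)
qed

lemma relatively_locally_finite_Bif:
  assumes "relatively_locally_finite C D p" "locally_finite_slices C" "locally_finite_coslices C"
  shows "relatively_locally_finite C Bif Bif_proj"
  unfolding relatively_locally_finite_def hom_over_Bif using finite_derivations[OF assms] by blast

section \<open>Identities and cuts\<close>

lemma formula_Obj: "formula S A \<Longrightarrow> A \<in> Obj C"
  by (induction rule: formula.induct) (auto simp: fobj_in cod.Dom_in cod.Cod_in P_Arr N_Arr)

lemma derives_ident: "formula S A \<Longrightarrow> derives (ident S) S (Id C A) S"
proof (induction rule: formula.induct)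
  case (1 X)
  then show ?case using derives.Ax[of "Id D X"] by (simp add: dom.Id_in dom.Dom_Id dom.Cod_Id farr_Id)
next
  case (2 f S)
  then have "derives (RP f (ident S)) S f (Pos f S)"
    using derives.RP[of f "Id C (Dom C f)" "ident S" S S] cod.Id_left[of f]
    by (simp add: P_Arr cod.Cod_Id cod.Dom_in)
  with 2 show ?case using cod.Id_right[of f]
    by (simp add: derives_LP_iff P_Arr cod.Cod_in cod.Id_in cod.Dom_Id)
next
  case (3 g T)
  then have "derives (LN g (ident T)) (Neg g T) g T"
    using derives.LN[of g "Id C (Cod C g)" "ident T" T T] cod.Id_right[of g]
    by (simp add: N_Arr cod.Dom_Id cod.Cod_in)
  with 3 show ?case using cod.Id_left[of g]
    by (simp add: derives_RN_iff N_Arr cod.Dom_in cod.Id_in cod.Cod_Id)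
qed

lemma cut_derives:
  "\<lbrakk>cut \<alpha> \<beta> \<gamma>; derives \<alpha> S g T; derives \<beta> T h U\<rbrakk> \<Longrightarrow> derives \<gamma> S (g \<cdot> h) U"
proof (induction arbitrary: S g T h U rule: cut.induct)
  case (1 \<delta> \<epsilon>)
  then show ?case
    using derives.Ax[of "\<delta> \<cdot>\<^bsub>D\<^esub> \<epsilon>"]
    by (auto elim!: derives_AxE simp: dom.Comp_in dom.Dom_Comp dom.Cod_Comp farr_Comp)
next
  case (2 \<alpha> \<beta> \<gamma> f k)
  then obtain g' S' where "g = g' \<cdot> f" "Cod C g' = Dom C f" "f \<in> \<P>" "Cod C f = Dom C h" "h \<in> Arr C"
      "derives \<alpha> S g' S'" "derives \<beta> S' (f \<cdot> h) U"
    by (auto simp: derives_RP_iff derives_LP_iff)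
  with 2(2) show ?case by (simp add: cod.assoc P_Arr derives_Arr)
next
  case (3 \<alpha> \<beta> \<gamma> k f)
  then obtain h' T' where "h = f \<cdot> h'" "Cod C f = Dom C h'" "f \<in> \<N>" "Cod C g = Dom C f" "g \<in> Arr C"
      "derives \<alpha> S (g \<cdot> f) T'" "derives \<beta> T' h' U"
    by (auto simp: derives_RN_iff derives_LN_iff)
  with 3(2)[of S "g \<cdot> f" T' h' U] show ?case by (simp add: cod.assoc N_Arr derives_Arr)
next
  case (4 \<alpha> \<beta> \<gamma> f)
  then obtain g' S' where *: "g = f \<cdot> g'" "Cod C f = Dom C g'" "f \<in> \<N>" "S = Neg f S'" "derives \<alpha> S' g' T"
    by (auto simp: derives_LN_iff)
  moreover have "Cod C g' = Dom C h"
    using derives_tgt[OF *(5)] derives_src[OF 4(4)] formula_over by metis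
  moreover note 4(2)[OF *(5) 4(4)]
  ultimately show ?case using derives.LN[of f "g' \<cdot> h" \<gamma> S' U] 4(4)
    by (simp add: cod.assoc N_Arr derives_Arr cod.Dom_Comp)
next
  case (5 \<beta> S0 h0 T0 \<alpha> \<gamma> f k)
  then have "h0 = h" using derives_unique by blast
  from 5 obtain S' where *: "g = k" "Cod C f = Dom C g" "f \<in> \<P>" "g \<in> Arr C" "S = Pos f S'" "derives \<alpha> S' (f \<cdot> g) T"
    by (auto simp: derives_LP_iff)
  moreover have c: "Cod C g = Dom C h"
    using derives_tgt[OF 5(4)] derives_src[OF 5(5)] formula_over by metis
  moreover note 5(3)[OF *(6) 5(5)]
  ultimately show ?case using 5(5) \<open>h0 = h\<close>
    by (simp add: derives_LP_iff cod.assoc P_Arr derives_Arr cod.Dom_Comp cod.Comp_in)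
next
  case (6 \<alpha> \<beta> \<gamma> f)
  then obtain h' U' where *: "h = h' \<cdot> f" "Cod C h' = Dom C f" "f \<in> \<P>" "U = Pos f U'" "derives \<beta> T h' U'"
    by (auto simp: derives_RP_iff)
  moreover have "Cod C g = Dom C h'"
    using derives_tgt[OF 6(3)] derives_src[OF *(5)] formula_over by metis
  moreover note 6(2)[OF 6(3) *(5)]
  ultimately show ?case using derives.RP[of f "g \<cdot> h'" \<gamma> S U'] 6(3)
    by (simp add: cod.assoc P_Arr derives_Arr cod.Cod_Comp)
next
  case (7 \<alpha> S0 g0 T0 \<beta> \<gamma> k f)
  then have "g0 = g" using derives_unique by blast
  from 7 obtain U' where *: "h = k" "Cod C h = Dom C f" "f \<in> \<N>" "h \<in> Arr C" "U = Neg f U'" "derives \<beta> T (h \<cdot> f) U'"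
    by (auto simp: derives_RN_iff)
  moreover have c: "Cod C g = Dom C h"
    using derives_tgt[OF 7(4)] derives_src[OF 7(5)] formula_over by metis
  moreover note 7(3)[OF 7(4) *(6)]
  ultimately show ?case using 7(4) \<open>g0 = g\<close>
    by (simp add: derives_RN_iff cod.assoc N_Arr derives_Arr cod.Cod_Comp cod.Comp_in)
qed

text \<open>Composition is a union of classes over all representatives and all results of
  \<open>cut\<close>. Every result is a derivation, so its class is inhabited; hence the union is
  the class of the identity as soon as there is a result and all results lie in that class, and only
  then.\<close>

lemma Bif_Comp_eq_Id_iff:
  assumes S: "formula S A" and "derives \<alpha> S g T" "derives \<beta> T h S"
  shows "perm_class \<alpha> \<cdot>\<^bsub>Bif\<^esub> perm_class \<beta> = Id Bif S \<longleftrightarrow>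
    (\<exists>\<alpha>' \<beta>' \<gamma>. \<alpha> \<sim> \<alpha>' \<and> \<beta> \<sim> \<beta>' \<and> cut \<alpha>' \<beta>' \<gamma>) \<and>
    (\<forall>\<alpha>' \<beta>' \<gamma>. \<alpha> \<sim> \<alpha>' \<longrightarrow> \<beta> \<sim> \<beta>' \<longrightarrow> cut \<alpha>' \<beta>' \<gamma> \<longrightarrow> \<gamma> \<sim> ident S)"
proof -
  define X where "X = {\<gamma>. \<exists>\<alpha>' \<beta>'. \<alpha> \<sim> \<alpha>' \<and> \<beta> \<sim> \<beta>' \<and> cut \<alpha>' \<beta>' \<gamma>}"
  have X: "\<exists>k. derives \<gamma> S k S" if "\<gamma> \<in> X" for \<gamma>
  proof -
    from that obtain \<alpha>' \<beta>' where "\<alpha> \<sim> \<alpha>'" "\<beta> \<sim> \<beta>'" "cut \<alpha>' \<beta>' \<gamma>" by (auto simp: X_def)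
    with assms(2,3) show ?thesis
      using cut_derives[of \<alpha>' \<beta>' \<gamma> S g T h S] permeq_derives_iff[of \<alpha> \<alpha>'] permeq_derives_iff[of \<beta> \<beta>']
      by blast
  qed
  have "perm_class \<alpha> \<cdot>\<^bsub>Bif\<^esub> perm_class \<beta> = \<Union>(perm_class ` X)"
    by (auto simp: Bif_def perm_class_def X_def)
  moreover have "Id Bif S = perm_class (ident S)" by (simp add: Bif_def)
  moreover have "\<Union>(perm_class ` X) = perm_class (ident S) \<longleftrightarrow> X \<noteq> {} \<and> (\<forall>\<gamma>\<in>X. \<gamma> \<sim> ident S)"
  proof
    assume eq: "\<Union>(perm_class ` X) = perm_class (ident S)"
    have "ident S \<in> perm_class (ident S)"
      using derives_ident[OF S] by (auto simp: perm_class_def intro: permeq.refl)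
    with eq have "X \<noteq> {}" by auto
    moreover have "\<gamma> \<sim> ident S" if "\<gamma> \<in> X" for \<gamma>
    proof -
      from X[OF that] have "\<gamma> \<in> perm_class \<gamma>" by (auto simp: perm_class_def intro: permeq.refl)
      with eq that have "\<gamma> \<in> perm_class (ident S)" by blast
      then show ?thesis by (auto simp: perm_class_def intro: permeq.sym)
    qed
    ultimately show "X \<noteq> {} \<and> (\<forall>\<gamma>\<in>X. \<gamma> \<sim> ident S)" by blast
  next
    assume r: "X \<noteq> {} \<and> (\<forall>\<gamma>\<in>X. \<gamma> \<sim> ident S)"
    then have "perm_class \<gamma> = perm_class (ident S)" if "\<gamma> \<in> X" for \<gamma>
      using X[OF that] perm_class_eq_iff that by blast
    with r show "\<Union>(perm_class ` X) = perm_class (ident S)" by auto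
  qed
  moreover have "X \<noteq> {} \<and> (\<forall>\<gamma>\<in>X. \<gamma> \<sim> ident S) \<longleftrightarrow>
    (\<exists>\<alpha>' \<beta>' \<gamma>. \<alpha> \<sim> \<alpha>' \<and> \<beta> \<sim> \<beta>' \<and> cut \<alpha>' \<beta>' \<gamma>) \<and>
    (\<forall>\<alpha>' \<beta>' \<gamma>. \<alpha> \<sim> \<alpha>' \<longrightarrow> \<beta> \<sim> \<beta>' \<longrightarrow> cut \<alpha>' \<beta>' \<gamma> \<longrightarrow> \<gamma> \<sim> ident S)"
    unfolding X_def by blast
  ultimately show ?thesis by simp
qed

end

context preordered_bifibration_data
begin

theorem bij_betw_mmf:
  "bij_betw (\<lambda>d. perm_class (underlying d)) {d. mmf_derives d S h IBot T} (hom_over Bif Bif_proj S h T)"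
proof (intro bij_betw_imageI inj_onI)
  fix d d' assume "d \<in> {d. mmf_derives d S h IBot T}" "d' \<in> {d. mmf_derives d S h IBot T}"
    "perm_class (underlying d) = perm_class (underlying d')"
  then show "d = d'"
    using perm_class_eq_iff[OF derives_underlying] underlying_inject by blast
next
  show "(\<lambda>d. perm_class (underlying d)) ` {d. mmf_derives d S h IBot T} = hom_over Bif Bif_proj S h T"
  proof (intro equalityI subsetI)
    fix F assume "F \<in> hom_over Bif Bif_proj S h T"
    then obtain \<alpha> where a: "derives \<alpha> S h T" "F = perm_class \<alpha>" by (auto simp: hom_over_Bif)
    from ex_mmf_derives[OF a(1)] obtain d where d: "mmf_derives d S h IBot T" "underlying d \<sim> \<alpha>" by blast
    then have "perm_class (underlying d) = F"
      using a perm_class_eq_iff[OF derives_underlying[OF d(1)]] by simp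
    with d(1) show "F \<in> (\<lambda>d. perm_class (underlying d)) ` {d. mmf_derives d S h IBot T}" by blast
  qed (auto simp: hom_over_Bif dest: derives_underlying)
qed

end

section \<open>Effective categories\<close>

definition coded_obj :: "('o, 'a) notat \<Rightarrow> 'o rep" where
  "coded_obj R n x \<longleftrightarrow> n \<in> ocode R \<and> oden R n = x"

definition coded_arr :: "('o, 'a) notat \<Rightarrow> 'a rep" where
  "coded_arr R n a \<longleftrightarrow> n \<in> acode R \<and> aden R n = a"

lemma computable_Dom:
  assumes "effective_category C R" "computable E (coded_arr R) f"
  shows "computable E (coded_obj R) (\<lambda>x. Dom C (f x))"
proof (rule computable_comp[OF assms(2)])
  have "solvable (acode R) id (\<lambda>m n. n \<in> ocode R \<and> oden R n = Dom C (aden R m))"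
    using assms(1) by (simp add: effective_category_def)
  then show "computable (coded_arr R) (coded_obj R) (Dom C)"
    by (rule computable_solvable) (auto simp: coded_obj_def coded_arr_def)
qed

lemma computable_Cod:
  assumes "effective_category C R" "computable E (coded_arr R) f"
  shows "computable E (coded_obj R) (\<lambda>x. Cod C (f x))"
proof (rule computable_comp[OF assms(2)])
  have "solvable (acode R) id (\<lambda>m n. n \<in> ocode R \<and> oden R n = Cod C (aden R m))"
    using assms(1) by (simp add: effective_category_def)
  then show "computable (coded_arr R) (coded_obj R) (Cod C)"
    by (rule computable_solvable) (auto simp: coded_obj_def coded_arr_def)
qed

lemma computable_Id:
  assumes "effective_category C R" "computable E (coded_obj R) f"
  shows "computable E (coded_arr R) (\<lambda>x. Id C (f x))"
proof (rule computable_comp[OF assms(2)])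
  have "solvable (ocode R) id (\<lambda>m n. n \<in> acode R \<and> aden R n = Id C (oden R m))"
    using assms(1) by (simp add: effective_category_def)
  then show "computable (coded_obj R) (coded_arr R) (Id C)"
    by (rule computable_solvable) (auto simp: coded_obj_def coded_arr_def)
qed

lemma computable_arr_eq:
  fixes C :: "('o, 'a) cat"
  assumes "effective_category C R" "computable E (coded_arr R) f" "computable E (coded_arr R) g"
  shows "computable E rbool (\<lambda>x. f x = g x)"
proof (rule computable_comp_pair[OF _ assms(2,3)])
  have "decidable (acode R \<times> acode R) prod_encode (\<lambda>(m, n). aden R m = aden R n)"
    using assms(1) by (simp add: effective_category_def)
  then show "computable (rprod (coded_arr R) (coded_arr R)) rbool (\<lambda>z. fst z = snd z)"
  proof (rule computable_decidable)
    fix n and z :: "'a \<times> 'a"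
    assume "rprod (coded_arr R) (coded_arr R) n z"
    then show "\<exists>i\<in>acode R \<times> acode R. prod_encode i = n \<and>
        (case i of (m, n) \<Rightarrow> aden R m = aden R n) = (fst z = snd z)"
      by (intro bexI[of _ "prod_decode n"])
        (auto simp: rprod_def coded_arr_def mem_Times_iff split: prod.split)
  qed
qed

text \<open>The hypotheses decide equality of arrows only; objects are compared through their
  identities.\<close>

lemma computable_obj_eq:
  fixes C :: "('o, 'a) cat"
  assumes "category C" and R: "effective_category C R"
    and "computable E (coded_obj R) f" "computable E (coded_obj R) g"
  shows "computable E rbool (\<lambda>x. f x = g x)"
proof (rule computable_comp_pair[OF _ assms(3,4)])
  interpret category C by fact
  have "computable (rprod (coded_obj R) (coded_obj R)) rbool (\<lambda>z. Id C (fst z) = Id C (snd z))"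
    by (rule computable_arr_eq[OF R] computable_Id[OF R] computable_intros)+
  then show "computable (rprod (coded_obj R) (coded_obj R)) rbool (\<lambda>z. fst z = snd z)"
  proof (rule computable_cong)
    fix n and z :: "'o \<times> 'o"
    assume z: "rprod (coded_obj R) (coded_obj R) n z"
    have "oden R ` ocode R = Obj C" using R by (simp add: effective_category_def)
    moreover have "fst z \<in> oden R ` ocode R" "snd z \<in> oden R ` ocode R"
      using z by (auto simp: rprod_def coded_obj_def intro: rev_image_eqI)
    ultimately have "fst z \<in> Obj C" "snd z \<in> Obj C" by simp_all
    then have "Id C (fst z) = Id C (snd z) \<longleftrightarrow> fst z = snd z" using Dom_Id by metis
    with z show "rprod (coded_obj R) (coded_obj R) n z \<and> (Id C (fst z) = Id C (snd z)) = (fst z = snd z)"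
      by simp
  qed
qed

text \<open>The composition algorithm is trusted only on composable pairs, so composability is
  decided first.\<close>

lemma computable_composite:
  fixes C :: "('o, 'a) cat"
  assumes "category C" and R: "effective_category C R"
    and "computable E (coded_arr R) f" "computable E (coded_arr R) g"
  shows "computable E (coded_arr R) (\<lambda>x. composite C (f x) (g x))"
proof (rule computable_comp_pair[OF _ assms(3,4)])
  let ?A = "rprod (coded_arr R) (coded_arr R)" and ?b = "\<lambda>z. Cod C (fst z) = Dom C (snd z)"
  have "solvable {(m, n). m \<in> acode R \<and> n \<in> acode R \<and> Cod C (aden R m) = Dom C (aden R n)} prod_encode
      (\<lambda>(m, n) k. k \<in> acode R \<and> aden R k = aden R m \<cdot>\<^bsub>C\<^esub> aden R n)"
    using R by (simp add: effective_category_def)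
  then have "computable (restrict ?A ?b) (coded_arr R) (\<lambda>z. fst z \<cdot>\<^bsub>C\<^esub> snd z)"
  proof (rule computable_solvable)
    fix n and z :: "'a \<times> 'a"
    assume "restrict ?A ?b n z"
    then show "\<exists>i\<in>{(m, n). m \<in> acode R \<and> n \<in> acode R \<and> Cod C (aden R m) = Dom C (aden R n)}.
        prod_encode i = n \<and> (\<forall>m. (case i of (m, n) \<Rightarrow> \<lambda>k. k \<in> acode R \<and> aden R k = aden R m \<cdot>\<^bsub>C\<^esub> aden R n) m
          \<longrightarrow> coded_arr R m (fst z \<cdot>\<^bsub>C\<^esub> snd z))"
      by (intro bexI[of _ "prod_decode n"]) (auto simp: restrict_def rprod_def coded_arr_def split: prod.split)
  qed
  moreover have "computable ?A rbool ?b"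
    by (rule computable_obj_eq[OF assms(1) R] computable_Dom[OF R] computable_Cod[OF R] computable_intros)+
  ultimately have "computable ?A (coded_arr R) (\<lambda>z. if ?b z then fst z \<cdot>\<^bsub>C\<^esub> snd z else fst z)"
    by (intro computable_if_restrict computable_restrict[OF computable_fst[OF computable_id]])
  then show "computable ?A (coded_arr R) (\<lambda>z. composite C (fst z) (snd z))"
    by (simp add: composite_def)
qed

lemma rset_enumerates: "enumerates R m X \<Longrightarrow> rset (coded_arr R) m X"
  unfolding enumerates_def rset_def rlist_def
  by (intro exI[of _ "map (aden R) (list_decode m)"])
    (auto simp: list_all2_conv_all_nth coded_arr_def subset_iff)


section \<open>Deciding permutation equivalence\<close>

locale effective_bifibration_data = preordered_bifibration_data C D p \<P> \<N>
  for C :: "('o, 'a) cat" (structure) and D :: "('x, 'd) cat" and p :: "('x, 'd, 'o, 'a) ftr"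
    and \<P> \<N> :: "'a set" +
  fixes RC :: "('o, 'a) notat" and RD :: "('x, 'd) notat"
  assumes effective_data: "effective_data C D p \<P> \<N> RC RD"
begin

abbreviation "rA \<equiv> coded_arr RC"
abbreviation "rD \<equiv> coded_arr RD"
abbreviation "rX \<equiv> coded_obj RD"
abbreviation "rF \<equiv> rfm rX rA"
abbreviation "rR \<equiv> rder rD rA"

lemma RC: "effective_category C RC" and RD: "effective_category D RD"
  using effective_data by (simp_all add: effective_data_def)

lemma computable_farr:
  assumes "computable E rD f" shows "computable E rA (\<lambda>x. farr p (f x))"
proof (rule computable_comp[OF assms])
  have "solvable (acode RD) id (\<lambda>m n. n \<in> acode RC \<and> aden RC n = farr p (aden RD m))"
    using effective_data by (simp add: effective_data_def effective_functor_def)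
  then show "computable rD rA (farr p)" by (rule computable_solvable) (auto simp: coded_arr_def)
qed

lemma computable_fobj:
  assumes "computable E rX f" shows "computable E (coded_obj RC) (\<lambda>x. fobj p (f x))"
proof (rule computable_comp[OF assms])
  have "solvable (ocode RD) id (\<lambda>m n. n \<in> ocode RC \<and> oden RC n = fobj p (oden RD m))"
    using effective_data by (simp add: effective_data_def effective_functor_def)
  then show "computable rX (coded_obj RC) (fobj p)"
    by (rule computable_solvable) (auto simp: coded_obj_def)
qed

lemma computable_N:
  assumes "computable E rA f" shows "computable E rbool (\<lambda>x. f x \<in> \<N>)"
proof (rule computable_comp[OF assms])
  have "decidable (acode RC) id (\<lambda>n. aden RC n \<in> \<N>)"
    using effective_data by (simp add: effective_data_def)
  then show "computable rA rbool (\<lambda>a. a \<in> \<N>)" by (rule computable_decidable) (auto simp: coded_arr_def)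
qed

lemmas computable_C = computable_Dom[OF RC] computable_Cod[OF RC] computable_Id[OF RC]
  computable_arr_eq[OF RC] computable_obj_eq[OF cod.category_axioms RC]
  computable_composite[OF cod.category_axioms RC]

lemmas computable_D = computable_arr_eq[OF RD] computable_composite[OF dom.category_axioms RD]
  computable_farr computable_fobj

text \<open>The given algorithm is specified only on commuting squares and may return any filler.
  Legality is decided beforehand, and uniqueness identifies the returned filler with the chosen
  one.\<close>

lemma computable_filler_tuple:
  "computable (rprod rA (rprod rA (rprod rA rA))) (roption rA)
    (\<lambda>z. filler (fst z) (fst (snd z)) (fst (snd (snd z))) (snd (snd (snd z))))"
  (is "computable ?A _ ?filler")
proof -
  let ?legal = "\<lambda>z. fst z \<in> \<N> \<and> snd (snd (snd z)) \<in> \<N> \<and> Cod C (fst z) = Dom C (fst (snd z))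
    \<and> Cod C (fst (snd (snd z))) = Dom C (snd (snd (snd z))) \<and> Dom C (fst z) = Dom C (fst (snd (snd z)))
    \<and> Cod C (fst (snd z)) = Cod C (snd (snd (snd z)))
    \<and> composite C (fst z) (fst (snd z)) = composite C (fst (snd (snd z))) (snd (snd (snd z)))"
  have legal: "computable ?A rbool ?legal"
    by (rule computable_N computable_C computable_intros)+
  have legal_case: "computable (restrict ?A ?legal) (roption rA) ?filler"
  proof (rule computable_solvable)
    show "solvable
      {(a, b, c, d). {a, b, c, d} \<subseteq> acode RC \<and>
         Cod C (aden RC a) = Dom C (aden RC b) \<and> Cod C (aden RC c) = Dom C (aden RC d) \<and>
         Dom C (aden RC a) = Dom C (aden RC c) \<and> Cod C (aden RC b) = Cod C (aden RC d) \<and>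
         aden RC a \<cdot> aden RC b = aden RC c \<cdot> aden RC d}
      enc4
      (\<lambda>(a, b, c, d) m.
         let fillers = {e \<in> hom C (Cod C (aden RC a)) (Dom C (aden RC d)).
                          aden RC c = aden RC a \<cdot> e \<and> aden RC b = e \<cdot> aden RC d}
         in if fillers = {} then m = 0 else \<exists>k \<in> acode RC. m = Suc k \<and> aden RC k \<in> fillers)"
      (is "solvable ?I enc4 ?Q")
      using effective_data by (simp add: effective_data_def effective_fillers_def)
    fix n z assume z: "restrict ?A ?legal n z"
    obtain f m k h where zz: "z = (f, m, k, h)" by (cases z)
    define a where "a = fst (prod_decode n)"
    define b where "b = fst (prod_decode (snd (prod_decode n)))"
    define c where "c = fst (prod_decode (snd (prod_decode (snd (prod_decode n)))))"
    define d where "d = snd (prod_decode (snd (prod_decode (snd (prod_decode n)))))"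
    have n: "enc4 (a, b, c, d) = n" by (simp add: enc4_def enc3_def a_def b_def c_def d_def)
    from z have abcd: "{a, b, c, d} \<subseteq> acode RC" "aden RC a = f" "aden RC b = m" "aden RC c = k" "aden RC d = h"
      by (simp_all add: restrict_def rprod_def coded_arr_def a_def b_def c_def d_def zz)
    from z have l: "f \<in> \<N>" "h \<in> \<N>" "Cod C f = Dom C m" "Cod C k = Dom C h" "Dom C f = Dom C k"
        "Cod C m = Cod C h" and eq: "cmp f m = cmp k h"
      by (simp_all add: restrict_def zz)
    then have "f \<cdot> m = k \<cdot> h" by simp
    note l = l this
    have "(a, b, c, d) \<in> ?I" using abcd l by simp
    moreover have "roption rA i (filler f m k h)" if "?Q (a, b, c, d) i" for i
    proof (cases "\<exists>e \<in> hom C (Cod C f) (Dom C h). k = f \<cdot> e \<and> m = e \<cdot> h")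
      case False
      with that abcd have "i = 0" by (auto simp: Let_def split: if_splits)
      with False show ?thesis by (simp add: filler_def roption_def)
    next
      case True
      with that abcd obtain j where j: "j \<in> acode RC" "i = Suc j"
          "aden RC j \<in> hom C (Cod C f) (Dom C h)" "k = f \<cdot> aden RC j" "m = aden RC j \<cdot> h"
        by (auto simp: Let_def split: if_splits)
      with l have "filler f m k h = Some (aden RC j)" using filler_eq[of f h "aden RC j"] by (simp add: hom_def)
      with j show ?thesis by (simp add: roption_def coded_arr_def)
    qed
    ultimately show "\<exists>i\<in>?I. enc4 i = n \<and> (\<forall>m. ?Q i m \<longrightarrow> roption rA m (?filler z))"
      using n unfolding zz by (intro bexI[of _ "(a, b, c, d)"]) simp_all
  qed
  have "computable ?A (roption rA) (\<lambda>z. if ?legal z then ?filler z else None)"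
    by (rule computable_if_restrict[OF legal legal_case computable_None])
  \<comment> \<open>A square with a filler is legal, so on illegal input the answer
    \<open>None\<close> is correct.\<close>
  moreover have "(if ?legal z then ?filler z else None) = ?filler z" for z
  proof -
    obtain f m k h where z: "z = (f, m, k, h)" by (cases z)
    show ?thesis
    proof (cases "filler f m k h")
      case (Some e)
      note e = filler_SomeD[OF Some]
      then have "?legal z" by (simp add: z cod.Dom_Comp cod.Cod_Comp cod.assoc N_Arr)
      then show ?thesis by simp
    qed (simp add: z)
  qed
  ultimately show ?thesis by simp
qed

lemma computable_filler:
  assumes "computable E rA f" "computable E rA m" "computable E rA k" "computable E rA h"
  shows "computable E (roption rA) (\<lambda>x. filler (f x) (m x) (k x) (h x))"
  using computable_comp[OF computable_pair[OF assms(1) computable_pair[OF assms(2) computable_pair[OF assms(3,4)]]]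
      computable_filler_tuple] by simp

definition tail :: "('d, 'a) der \<Rightarrow> ('d, 'a) der" where
  "tail \<alpha> = (case \<alpha> of Ax d \<Rightarrow> Ax d | LP f g \<beta> \<Rightarrow> \<beta> | RP f \<beta> \<Rightarrow> \<beta> | LN f \<beta> \<Rightarrow> \<beta> | RN f g \<beta> \<Rightarrow> \<beta>)"

lemma computable_tail: "computable E rR f \<Longrightarrow> computable E rR (\<lambda>x. tail (f x))"
  unfolding tail_def by (rule computable_tree_intros computable_intros | assumption)+

text \<open>The stopping value must be computable everywhere, so it also returns something at the
  constructors where the recursion goes on, and dually for the step function. These entries are mere
  placeholders, here and in the recursions below.\<close>

lemma computable_base:
  assumes "computable E rR f" shows "computable E rA (\<lambda>x. base (f x))"
proof (rule computable_comp[OF assms])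
  show "computable rR rA base"
  proof (rule computable_recursion[where \<mu> = size and d = tail
        and b = "\<lambda>\<alpha>. case \<alpha> of RP f \<beta> \<Rightarrow> False | LN f \<beta> \<Rightarrow> False | _ \<Rightarrow> True"
        and f = "\<lambda>\<alpha>. case \<alpha> of Ax d \<Rightarrow> farr p d | LP f g \<beta> \<Rightarrow> g | RP f \<beta> \<Rightarrow> f | LN f \<beta> \<Rightarrow> f | RN f g \<beta> \<Rightarrow> f"
        and g = "\<lambda>\<alpha> r. case \<alpha> of RP f \<beta> \<Rightarrow> cmp r f | LN f \<beta> \<Rightarrow> cmp f r | _ \<Rightarrow> r"])
  qed (rule computable_tree_intros computable_intros computable_C computable_D computable_tail
      | (auto simp: tail_def split: der.splits))+
qed

text \<open>The trees are taken apart in parallel, with the first one controlling the length. After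
  a mismatch unrelated subtrees are compared, but the answer at the mismatch ignores the recursive
  value.\<close>

lemma computable_der_eq:
  assumes "computable E rR f" "computable E rR g" shows "computable E rbool (\<lambda>x. f x = g x)"
proof (rule computable_comp_pair[OF _ assms])
  show "computable (rprod rR rR) rbool (\<lambda>z. fst z = snd z)"
  proof (rule computable_recursion[where \<mu> = "\<lambda>z. size (fst z)" and d = "\<lambda>z. (tail (fst z), tail (snd z))"
        and b = "\<lambda>z. case fst z of Ax d \<Rightarrow> True | _ \<Rightarrow> False"
        and f = "\<lambda>z. case fst z of Ax d \<Rightarrow> (case snd z of Ax d' \<Rightarrow> d = d' | _ \<Rightarrow> False) | _ \<Rightarrow> False"
        and g = "\<lambda>z r. case fst z of Ax d \<Rightarrow> False
          | LP f g \<beta> \<Rightarrow> (case snd z of LP f' g' \<beta>' \<Rightarrow> f = f' \<and> g = g' \<and> r | _ \<Rightarrow> False)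
          | RP f \<beta> \<Rightarrow> (case snd z of RP f' \<beta>' \<Rightarrow> f = f' \<and> r | _ \<Rightarrow> False)
          | LN f \<beta> \<Rightarrow> (case snd z of LN f' \<beta>' \<Rightarrow> f = f' \<and> r | _ \<Rightarrow> False)
          | RN f g \<beta> \<Rightarrow> (case snd z of RN f' g' \<beta>' \<Rightarrow> f = f' \<and> g = g' \<and> r | _ \<Rightarrow> False)"])
  qed (rule computable_tree_intros computable_intros computable_C computable_D computable_tail
      | (auto simp: tail_def split: der.splits))+
qed

lemma computable_insert_RP:
  assumes "computable E rA f" "computable E rR g"
  shows "computable E rR (\<lambda>x. insert_RP (f x) (g x))"
proof (rule computable_comp_pair[OF _ assms])
  show "computable (rprod rA rR) rR (\<lambda>z. insert_RP (fst z) (snd z))"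
  proof (rule computable_recursion[where \<mu> = "\<lambda>z. size (snd z)" and d = "\<lambda>z. (fst z, tail (snd z))"
        and b = "\<lambda>z. case snd z of LP f g \<beta> \<Rightarrow> False | LN f \<beta> \<Rightarrow> False | _ \<Rightarrow> True"
        and f = "\<lambda>z. RP (fst z) (snd z)"
        and g = "\<lambda>z r. case snd z of LP f g \<beta> \<Rightarrow> LP f (cmp g (fst z)) r | LN f \<beta> \<Rightarrow> LN f r | _ \<Rightarrow> r"])
  qed (rule computable_tree_intros computable_intros computable_C computable_tail
      | (auto simp: tail_def split: der.splits))+
qed

text \<open>The descent changes the arrow parameter as well as the tree, so it is not given by
  \<open>tail\<close>. An \<open>LN\<close> without filler stops it.\<close>

lemma computable_insert_RN:
  assumes "computable E rA k" "computable E rA h" "computable E rR g"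
  shows "computable E rR (\<lambda>x. insert_RN (k x) (h x) (g x))"
proof (rule computable_comp_triple[OF _ assms])
  show "computable (rprod rA (rprod rA rR)) rR (\<lambda>z. insert_RN (fst z) (fst (snd z)) (snd (snd z)))"
  proof (rule computable_recursion[where \<mu> = "\<lambda>z. size (snd (snd z))"
        and d = "\<lambda>z. case snd (snd z) of LP f g \<beta> \<Rightarrow> (cmp f (fst z), fst (snd z), \<beta>)
          | LN f \<beta> \<Rightarrow> (case filler f (base \<beta>) (fst z) (fst (snd z)) of None \<Rightarrow> z | Some e \<Rightarrow> (e, fst (snd z), \<beta>))
          | _ \<Rightarrow> z"
        and b = "\<lambda>z. case snd (snd z) of LP f g \<beta> \<Rightarrow> False
          | LN f \<beta> \<Rightarrow> (case filler f (base \<beta>) (fst z) (fst (snd z)) of None \<Rightarrow> True | Some e \<Rightarrow> False)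
          | _ \<Rightarrow> True"
        and f = "\<lambda>z. RN (fst z) (fst (snd z)) (snd (snd z))"
        and g = "\<lambda>z r. case snd (snd z) of LP f g \<beta> \<Rightarrow> LP f (fst z) r | LN f \<beta> \<Rightarrow> LN f r | _ \<Rightarrow> r"])
  qed (rule computable_tree_intros computable_intros computable_C computable_base computable_filler
      | (auto split: der.splits option.splits))+
qed

lemma computable_nf:
  assumes "computable E rR f" shows "computable E rR (\<lambda>x. nf (f x))"
proof (rule computable_comp[OF assms])
  show "computable rR rR nf"
  proof (rule computable_recursion[where \<mu> = size and d = tail and f = "\<lambda>\<alpha>. \<alpha>"
        and b = "\<lambda>\<alpha>. case \<alpha> of Ax d \<Rightarrow> True | _ \<Rightarrow> False"
        and g = "\<lambda>\<alpha> r. case \<alpha> of Ax d \<Rightarrow> r | LP f g \<beta> \<Rightarrow> LP f g r | RP f \<beta> \<Rightarrow> insert_RP f r | LN f \<beta> \<Rightarrow> LN f r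
          | RN f g \<beta> \<Rightarrow> insert_RN f g r"])
  qed (rule computable_tree_intros computable_intros computable_insert_RP computable_insert_RN computable_tail
      | (auto simp: tail_def split: der.splits))+
qed

theorem decidable_permeq: "permeq_decidable RC RD"
  unfolding permeq_decidable_def
proof (rule decidable_computable)
  show "computable (rprod rR rR) rbool (\<lambda>z. nf (fst z) = nf (snd z))"
    by (rule computable_der_eq computable_nf computable_intros)+
  have code: "rR (enc_der t) (map_der (aden RD) (aden RC) t)" if "t \<in> der_codes RC RD" for t
    using that by (intro rder_enc_der) (auto simp: der_codes_def coded_arr_def)
  fix i assume "i \<in> der_codes RC RD \<times> der_codes RC RD"
  then obtain t u where i: "i = (t, u)" "t \<in> der_codes RC RD" "u \<in> der_codes RC RD" by auto
  then have "nf (map_der (aden RD) (aden RC) t) = nf (map_der (aden RD) (aden RC) u)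
    \<longleftrightarrow> map_der (aden RD) (aden RC) t \<sim> map_der (aden RD) (aden RC) u"
    using permeq_iff_nf unfolding der_codes_def by blast
  with i code show "\<exists>x. rprod rR rR (case i of (t, u) \<Rightarrow> prod_encode (enc_der t, enc_der u)) x \<and>
      (nf (fst x) = nf (snd x)) =
      (case i of (t, u) \<Rightarrow> map_der (aden RD) (aden RC) t \<sim> map_der (aden RD) (aden RC) u)"
    by (intro exI[of _ "(map_der (aden RD) (aden RC) t, map_der (aden RD) (aden RC) u)"])
      (simp add: rprod_def)
qed

end

section \<open>Deciding logical equivalence\<close>

text \<open>Rules as labels; every number above 3 stands for no rule.\<close>

definition apply_rule :: "nat \<times> 'a \<times> 'a \<Rightarrow> ('d, 'a) der \<Rightarrow> ('d, 'a) der" where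
  "apply_rule l \<alpha> = (if fst l = 0 then LP (fst (snd l)) (snd (snd l)) \<alpha>
    else if fst l = 1 then RP (fst (snd l)) \<alpha> else if fst l = 2 then LN (fst (snd l)) \<alpha>
    else if fst l = 3 then RN (fst (snd l)) (snd (snd l)) \<alpha> else \<alpha>)"

lemma apply_rule_simps [simp]:
  "apply_rule (0, f, g) \<alpha> = LP f g \<alpha>" "apply_rule (1, f, g) \<alpha> = RP f \<alpha>"
  "apply_rule (Suc 0, f, g) \<alpha> = RP f \<alpha>"
  "apply_rule (2, f, g) \<alpha> = LN f \<alpha>" "apply_rule (3, f, g) \<alpha> = RN f g \<alpha>" "apply_rule (4, f, g) \<alpha> = \<alpha>"
  by (simp_all add: apply_rule_def)

section \<open>Enumerating derivations and cuts\<close>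

context bifibration_data
begin

text \<open>The guard is the domain on which \<open>effective_relative_homs\<close> promises an
  enumeration.\<close>

definition over_base :: "'x \<Rightarrow> 'a \<Rightarrow> 'x \<Rightarrow> 'd set" where
  "over_base X h Y = (if fobj p X = Dom C h \<and> fobj p Y = Cod C h then hom_over D p X h Y else {})"

definition sequent_done :: "('x, 'a) fm \<times> 'a \<times> ('x, 'a) fm \<Rightarrow> bool" where
  "sequent_done s = (case fst s of Atom X \<Rightarrow> (case snd (snd s) of Atom Y \<Rightarrow> True | _ \<Rightarrow> False) | _ \<Rightarrow> False)"

definition sequent_axioms :: "('x, 'a) fm \<times> 'a \<times> ('x, 'a) fm \<Rightarrow> ('d, 'a) der set" where
  "sequent_axioms s = (case fst s of
      Atom X \<Rightarrow> (case snd (snd s) of Atom Y \<Rightarrow> \<Union>\<delta>\<in>over_base X (fst (snd s)) Y. {Ax \<delta>} | _ \<Rightarrow> {})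
    | _ \<Rightarrow> {})"

definition sequent_steps :: "('x, 'a) fm \<times> 'a \<times> ('x, 'a) fm
    \<Rightarrow> ((nat \<times> 'a \<times> 'a) \<times> ('x, 'a) fm \<times> 'a \<times> ('x, 'a) fm) set" where
  "sequent_steps s =
    (case fst s of Atom X \<Rightarrow> {}
      | Pos f S \<Rightarrow> {((0, f, fst (snd s)), (S, cmp f (fst (snd s)), snd (snd s)))}
      | Neg f S \<Rightarrow> \<Union>e\<in>after f (fst (snd s)). {((2, f, f), (S, e, snd (snd s)))})
    \<union> (case snd (snd s) of Atom X \<Rightarrow> {}
      | Pos f T \<Rightarrow> \<Union>e\<in>before (fst (snd s)) f. {((1, f, f), (fst s, e, T))}
      | Neg f T \<Rightarrow> {((3, fst (snd s), f), (fst s, cmp (fst (snd s)) f, T))})"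

definition search :: "('x, 'a) fm \<times> 'a \<times> ('x, 'a) fm \<Rightarrow> ('d, 'a) der set" where
  "search s = {\<alpha>. run sequent_done sequent_axioms sequent_steps apply_rule s \<alpha>}"

text \<open>The steps test neither typing nor membership in \<P> and \<N>: both follow from the
  well-formedness of the root sequent, which is handed on to each premise.\<close>

lemma search_derives:
  assumes "run sequent_done sequent_axioms sequent_steps apply_rule s \<alpha>"
    and "fst (snd s) \<in> Arr C" "formula (fst s) (Dom C (fst (snd s)))" "formula (snd (snd s)) (Cod C (fst (snd s)))"
  shows "derives \<alpha> (fst s) (fst (snd s)) (snd (snd s))"
  using assms
proof induction
  case (leaf s \<alpha>)
  then obtain X Y \<delta> where "fst s = Atom X" "snd (snd s) = Atom Y" "\<alpha> = Ax \<delta>"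
      "\<delta> \<in> hom_over D p X (fst (snd s)) Y"
    by (auto simp: sequent_axioms_def over_base_def split: fm.splits if_splits)
  with derives.Ax[of \<delta>] show ?case by (auto simp: hom_over_def hom_def)
next
  case (node s l s' \<alpha>)
  obtain S h T where s: "s = (S, h, T)" by (cases s)
  note wf = node.prems[unfolded s, simplified]
  from node.hyps(2) consider
      (LP) f S' where "S = Pos f S'" "l = (0, f, h)" "s' = (S', cmp f h, T)"
    | (LN) f S' e where "S = Neg f S'" "e \<in> after f h" "l = (2, f, f)" "s' = (S', e, T)"
    | (RP) f T' e where "T = Pos f T'" "e \<in> before h f" "l = (1, f, f)" "s' = (S, e, T')"
    | (RN) f T' where "T = Neg f T'" "l = (3, h, f)" "s' = (S, cmp h f, T')"
    by (auto simp: s sequent_steps_def split: fm.splits)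
  then show ?case
  proof cases
    case LP
    with wf(2) have "f \<in> \<P>" "Cod C f = Dom C h" "formula S' (Dom C f)" by (auto elim: formula.cases)
    with LP wf node.IH show ?thesis
      by (simp add: s derives_LP_iff cod.Comp_in cod.Dom_Comp cod.Cod_Comp P_Arr)
  next
    case LN
    with wf(2) have "f \<in> \<N>" "formula S' (Cod C f)" by (auto elim: formula.cases)
    with LN wf node.IH show ?thesis
      by (auto simp add: s derives_LN_iff after_def cod.Cod_Comp N_Arr)
  next
    case RP
    with wf(3) have "f \<in> \<P>" "formula T' (Dom C f)" by (auto elim: formula.cases)
    with RP wf node.IH show ?thesis
      by (auto simp add: s derives_RP_iff before_def cod.Dom_Comp P_Arr)
  next
    case RN
    with wf(3) have "f \<in> \<N>" "Cod C h = Dom C f" "formula T' (Cod C f)" by (auto elim: formula.cases)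
    with RN wf node.IH show ?thesis
      by (simp add: s derives_RN_iff cod.Comp_in cod.Dom_Comp cod.Cod_Comp N_Arr)
  qed
qed

lemma derives_search:
  "derives \<alpha> S h T \<Longrightarrow> run sequent_done sequent_axioms sequent_steps apply_rule (S, h, T) \<alpha>"
proof (induction rule: derives.induct)
  case (Ax \<delta>)
  then show ?case
    by (intro run.leaf)
      (auto simp: sequent_done_def sequent_axioms_def over_base_def hom_over_def hom_def Dom_farr Cod_farr)
next
  case (LP f g S \<alpha> T)
  then have "((0, f, g), (S, f \<cdot> g, T)) \<in> sequent_steps (Pos f S, g, T)" by (simp add: sequent_steps_def)
  from run.node[OF _ this LP.IH] show ?case
    by (simp add: sequent_done_def)
next
  case (RP f f' \<alpha> S' S)
  then have "((1, f, f), (S', f', S)) \<in> sequent_steps (S', f' \<cdot> f, Pos f S)"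
    by (simp add: sequent_steps_def before_def derives_Arr)
  from run.node[OF _ this RP.IH] show ?case
    by (simp add: sequent_done_def split: fm.splits)
next
  case (LN g g' \<alpha> T T')
  then have "((2, g, g), (T, g', T')) \<in> sequent_steps (Neg g T, g \<cdot> g', T')"
    by (simp add: sequent_steps_def after_def derives_Arr)
  from run.node[OF _ this LN.IH] show ?case
    by (simp add: sequent_done_def)
next
  case (RN f g T \<alpha> S)
  then have "((3, f, g), (S, f \<cdot> g, T)) \<in> sequent_steps (S, f, Neg g T)" by (simp add: sequent_steps_def)
  from run.node[OF _ this RN.IH] show ?case
    by (simp add: sequent_done_def split: fm.splits)
qed

lemma search_eq:
  assumes "h \<in> Arr C" "formula S (Dom C h)" "formula T (Cod C h)"
  shows "search (S, h, T) = {\<alpha>. derives \<alpha> S h T}"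
  using search_derives[of "(S, h, T)"] derives_search assms by (auto simp: search_def)

definition cut_done :: "('d, 'a) der \<times> ('d, 'a) der \<Rightarrow> bool" where
  "cut_done z = (case fst z of Ax d \<Rightarrow> (case snd z of Ax e \<Rightarrow> True | _ \<Rightarrow> False) | _ \<Rightarrow> False)"

definition cut_axioms :: "('d, 'a) der \<times> ('d, 'a) der \<Rightarrow> ('d, 'a) der set" where
  "cut_axioms z = (case fst z of Ax d \<Rightarrow> (case snd z of Ax e \<Rightarrow> {Ax (composite D d e)} | _ \<Rightarrow> {}) | _ \<Rightarrow> {})"

text \<open>Label 4 belongs to the principal cuts, which leave no rule behind. All clauses that
  apply are kept, because \<open>cut\<close> is a relation and composition ranges over all of its
  results.\<close>

definition cut_steps :: "('d, 'a) der \<times> ('d, 'a) der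
    \<Rightarrow> ((nat \<times> 'a \<times> 'a) \<times> ('d, 'a) der \<times> ('d, 'a) der) set" where
  "cut_steps z =
    (case fst z of Ax d \<Rightarrow> {}
      | LP f g \<alpha> \<Rightarrow> {((0, f, cmp g (base (snd z))), (\<alpha>, snd z))}
      | RP f \<alpha> \<Rightarrow> (case snd z of LP f' h \<beta> \<Rightarrow> (if f = f' then {((4, f, f), (\<alpha>, \<beta>))} else {}) | _ \<Rightarrow> {})
      | LN f \<alpha> \<Rightarrow> {((2, f, f), (\<alpha>, snd z))}
      | RN g f \<alpha> \<Rightarrow> (case snd z of LN f' \<beta> \<Rightarrow> (if f = f' then {((4, f, f), (\<alpha>, \<beta>))} else {}) | _ \<Rightarrow> {}))
    \<union> (case snd z of RP f \<beta> \<Rightarrow> {((1, f, f), (fst z, \<beta>))}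
      | RN h f \<beta> \<Rightarrow> {((3, cmp (base (fst z)) h, f), (fst z, \<beta>))} | _ \<Rightarrow> {})"

definition cuts :: "('d, 'a) der \<times> ('d, 'a) der \<Rightarrow> ('d, 'a) der set" where
  "cuts z = {\<gamma>. run cut_done cut_axioms cut_steps apply_rule z \<gamma>}"

lemma derives_composable:
  "\<lbrakk>derives \<alpha> S g T; derives \<beta> T h U\<rbrakk> \<Longrightarrow> Cod C g = Dom C h"
  using derives_tgt derives_src formula_over by metis

lemma run_cut:
  assumes "run cut_done cut_axioms cut_steps apply_rule z \<gamma>" "derives (fst z) S g T" "derives (snd z) T h U"
  shows "cut (fst z) (snd z) \<gamma>"
  using assms
proof (induction arbitrary: S g T h U)
  case (leaf z \<gamma>)
  then obtain d e where "fst z = Ax d" "snd z = Ax e" "\<gamma> = Ax (composite D d e)"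
    by (auto simp: cut_axioms_def split: der.splits)
  moreover with leaf.prems have "Cod D d = Dom D e" by (auto elim!: derives_AxE)
  ultimately show ?case by (auto intro: cut.intros)
next
  case (node z l z' \<gamma>)
  obtain \<alpha> \<beta> where z: "z = (\<alpha>, \<beta>)" by (cases z)
  note d = node.prems[unfolded z, simplified]
  note c = derives_composable[OF d]
  from node.hyps(2) consider
      (LP) f k \<alpha>' where "\<alpha> = LP f k \<alpha>'" "l = (0, f, cmp k (base \<beta>))" "z' = (\<alpha>', \<beta>)"
    | (P) f k \<alpha>' \<beta>' where "\<alpha> = RP f \<alpha>'" "\<beta> = LP f k \<beta>'" "l = (4, f, f)" "z' = (\<alpha>', \<beta>')"
    | (LN) f \<alpha>' where "\<alpha> = LN f \<alpha>'" "l = (2, f, f)" "z' = (\<alpha>', \<beta>)"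
    | (N) f k \<alpha>' \<beta>' where "\<alpha> = RN k f \<alpha>'" "\<beta> = LN f \<beta>'" "l = (4, f, f)" "z' = (\<alpha>', \<beta>')"
    | (RP) f \<beta>' where "\<beta> = RP f \<beta>'" "l = (1, f, f)" "z' = (\<alpha>, \<beta>')"
    | (RN) f k \<beta>' where "\<beta> = RN k f \<beta>'" "l = (3, cmp (base \<alpha>) k, f)" "z' = (\<alpha>, \<beta>')"
    unfolding z cut_steps_def by (cases \<alpha>; cases \<beta>; auto split: if_splits)
  then show ?case
  proof cases
    case LP
    with d(1) obtain S' where "derives \<alpha>' S' (f \<cdot> g) T" "k = g" by (auto simp: derives_LP_iff)
    with node.IH[of S' "f \<cdot> g" T h U] LP d c cut.intros(5)[OF d(2)] show ?thesis
      by (simp add: z derives_base)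
  next
    case P
    with d obtain S' g' where "derives \<alpha>' S g' S'" "derives \<beta>' S' (f \<cdot> h) U"
      by (auto simp: derives_LP_iff derives_RP_iff)
    with node.IH[of S g' S' "f \<cdot> h" U] P show ?thesis by (simp add: z cut.intros)
  next
    case LN
    with d(1) obtain S' g' where "derives \<alpha>' S' g' T" by (auto simp: derives_LN_iff)
    with node.IH[of S' g' T h U] LN d show ?thesis by (simp add: z cut.intros)
  next
    case N
    with d obtain T' h' where "derives \<alpha>' S (g \<cdot> f) T'" "derives \<beta>' T' h' U"
      by (auto simp: derives_LN_iff derives_RN_iff)
    with node.IH[of S "g \<cdot> f" T' h' U] N show ?thesis by (simp add: z cut.intros)
  next
    case RP
    with d(2) obtain U' h' where "derives \<beta>' T h' U'" by (auto simp: derives_RP_iff)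
    with node.IH[of S g T h' U'] RP d show ?thesis by (simp add: z cut.intros)
  next
    case RN
    with d(2) obtain U' where "derives \<beta>' T (h \<cdot> f) U'" "k = h" by (auto simp: derives_RN_iff)
    with node.IH[of S g T "h \<cdot> f" U'] RN d c cut.intros(7)[OF d(1)] show ?thesis
      by (simp add: z derives_base)
  qed
qed

lemma cut_run:
  "\<lbrakk>cut \<alpha> \<beta> \<gamma>; derives \<alpha> S g T; derives \<beta> T h U\<rbrakk>
    \<Longrightarrow> run cut_done cut_axioms cut_steps apply_rule (\<alpha>, \<beta>) \<gamma>"
proof (induction arbitrary: S g T h U rule: cut.induct)
  case (1 \<delta> \<epsilon>)
  then have "Cod D \<delta> = Dom D \<epsilon>" by (auto elim!: derives_AxE)
  then show ?case by (intro run.leaf) (simp_all add: cut_done_def cut_axioms_def)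
next
  case (2 \<alpha> \<beta> \<gamma> f k)
  then have "run cut_done cut_axioms cut_steps apply_rule (\<alpha>, \<beta>) \<gamma>"
    by (auto simp: derives_RP_iff derives_LP_iff)
  moreover have "\<not> cut_done (RP f \<alpha>, LP f k \<beta>)" "((4, f, f), (\<alpha>, \<beta>)) \<in> cut_steps (RP f \<alpha>, LP f k \<beta>)"
    by (simp_all add: cut_done_def cut_steps_def)
  ultimately show ?case
    using run.node[of cut_done "(RP f \<alpha>, LP f k \<beta>)" "(4, f, f)" "(\<alpha>, \<beta>)" cut_steps cut_axioms apply_rule \<gamma>]
    by simp
next
  case (3 \<alpha> \<beta> \<gamma> k f)
  then have "run cut_done cut_axioms cut_steps apply_rule (\<alpha>, \<beta>) \<gamma>"
    by (auto simp: derives_RN_iff derives_LN_iff)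
  moreover have "\<not> cut_done (RN k f \<alpha>, LN f \<beta>)" "((4, f, f), (\<alpha>, \<beta>)) \<in> cut_steps (RN k f \<alpha>, LN f \<beta>)"
    by (simp_all add: cut_done_def cut_steps_def)
  ultimately show ?case
    using run.node[of cut_done "(RN k f \<alpha>, LN f \<beta>)" "(4, f, f)" "(\<alpha>, \<beta>)" cut_steps cut_axioms apply_rule \<gamma>]
    by simp
next
  case (4 \<alpha> \<beta> \<gamma> f)
  then have "run cut_done cut_axioms cut_steps apply_rule (\<alpha>, \<beta>) \<gamma>"
    by (auto simp: derives_LN_iff)
  moreover have "\<not> cut_done (LN f \<alpha>, \<beta>)" "((2, f, f), (\<alpha>, \<beta>)) \<in> cut_steps (LN f \<alpha>, \<beta>)"
    by (simp_all add: cut_done_def cut_steps_def)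
  ultimately show ?case
    using run.node[of cut_done "(LN f \<alpha>, \<beta>)" "(2, f, f)" "(\<alpha>, \<beta>)" cut_steps cut_axioms apply_rule \<gamma>]
    by simp
next
  case (5 \<beta> S0 h0 T0 \<alpha> \<gamma> f k)
  then have "run cut_done cut_axioms cut_steps apply_rule (\<alpha>, \<beta>) \<gamma>" "k = g"
    by (auto simp: derives_LP_iff)
  moreover have c: "cmp k (base \<beta>) = k \<cdot> h0"
    using derives_composable[OF 5(4,5)] \<open>k = g\<close> derives_base[OF 5(1)] derives_base[OF 5(5)] by simp
  moreover from c have "\<not> cut_done (LP f k \<alpha>, \<beta>)" "((0, f, k \<cdot> h0), (\<alpha>, \<beta>)) \<in> cut_steps (LP f k \<alpha>, \<beta>)"
    by (simp_all add: cut_done_def cut_steps_def)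
  ultimately show ?case
    using run.node[of cut_done "(LP f k \<alpha>, \<beta>)" "(0, f, k \<cdot> h0)" "(\<alpha>, \<beta>)" cut_steps cut_axioms apply_rule \<gamma>]
    by simp
next
  case (6 \<alpha> \<beta> \<gamma> f)
  then have "run cut_done cut_axioms cut_steps apply_rule (\<alpha>, \<beta>) \<gamma>"
    by (auto simp: derives_RP_iff)
  moreover have "\<not> cut_done (\<alpha>, RP f \<beta>)" "((1, f, f), (\<alpha>, \<beta>)) \<in> cut_steps (\<alpha>, RP f \<beta>)"
    by (simp_all add: cut_done_def cut_steps_def split: der.split)
  ultimately show ?case
    using run.node[of cut_done "(\<alpha>, RP f \<beta>)" "(1, f, f)" "(\<alpha>, \<beta>)" cut_steps cut_axioms apply_rule \<gamma>]
    by simp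
next
  case (7 \<alpha> S0 g0 T0 \<beta> \<gamma> k f)
  then have "run cut_done cut_axioms cut_steps apply_rule (\<alpha>, \<beta>) \<gamma>" "k = h"
    by (auto simp: derives_RN_iff)
  moreover have c: "cmp (base \<alpha>) k = g0 \<cdot> k"
    using derives_composable[OF 7(4,5)] \<open>k = h\<close> derives_base[OF 7(1)] derives_base[OF 7(4)] by simp
  moreover from c have "\<not> cut_done (\<alpha>, RN k f \<beta>)" "((3, g0 \<cdot> k, f), (\<alpha>, \<beta>)) \<in> cut_steps (\<alpha>, RN k f \<beta>)"
    by (simp_all add: cut_done_def cut_steps_def split: der.split)
  ultimately show ?case
    using run.node[of cut_done "(\<alpha>, RN k f \<beta>)" "(3, g0 \<cdot> k, f)" "(\<alpha>, \<beta>)" cut_steps cut_axioms apply_rule \<gamma>]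
    by simp
qed

lemma cuts_eq:
  "\<lbrakk>derives \<alpha> S g T; derives \<beta> T h U\<rbrakk> \<Longrightarrow> cuts (\<alpha>, \<beta>) = {\<gamma>. cut \<alpha> \<beta> \<gamma>}"
  using run_cut[of "(\<alpha>, \<beta>)"] cut_run by (auto simp: cuts_def)

end

context preordered_bifibration_data
begin

text \<open>\<open>L\<close> and \<open>M\<close> enumerate the derivations of the sequents of \<open>\<alpha>\<close> and \<open>\<beta>\<close>.\<close>

definition composites ::
    "('d, 'a) der set \<Rightarrow> ('d, 'a) der set \<Rightarrow> ('d, 'a) der \<Rightarrow> ('d, 'a) der \<Rightarrow> ('d, 'a) der set" where
  "composites L M \<alpha> \<beta> = (\<Union>\<alpha>'\<in>L. \<Union>\<beta>'\<in>M. if nf \<alpha> = nf \<alpha>' \<and> nf \<beta> = nf \<beta>' then cuts (\<alpha>', \<beta>') else {})"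

text \<open>Nonemptiness is written as a bounded existential, the form covered by
  \<open>computable_Bex\<close>.\<close>

definition left_inverse ::
    "('d, 'a) der set \<Rightarrow> ('d, 'a) der set \<Rightarrow> ('x, 'a) fm \<Rightarrow> ('d, 'a) der \<Rightarrow> ('d, 'a) der \<Rightarrow> bool" where
  "left_inverse L M S \<alpha> \<beta> \<longleftrightarrow> (\<exists>\<gamma>\<in>composites L M \<alpha> \<beta>. True) \<and> (\<forall>\<gamma>\<in>composites L M \<alpha> \<beta>. nf \<gamma> = nf (ident S))"

text \<open>Among the derivations of the sequent of \<alpha>, the representatives of its class are
  those with the same normal form. So ranging over the enumerated sets covers all representatives,
  as composition in \<open>Bif\<close> requires.\<close>

lemma left_inverse_iff:
  assumes "formula S A" "derives \<alpha> S g T" "derives \<beta> T h S"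
  shows "left_inverse {\<alpha>. derives \<alpha> S g T} {\<beta>. derives \<beta> T h S} S \<alpha> \<beta>
    \<longleftrightarrow> perm_class \<alpha> \<cdot>\<^bsub>Bif\<^esub> perm_class \<beta> = Id Bif S"
proof -
  have a: "\<alpha> \<sim> \<alpha>' \<longleftrightarrow> derives \<alpha>' S g T \<and> nf \<alpha> = nf \<alpha>'" for \<alpha>'
    using assms(2) permeq_derives_iff permeq_iff_nf by blast
  have b: "\<beta> \<sim> \<beta>' \<longleftrightarrow> derives \<beta>' T h S \<and> nf \<beta> = nf \<beta>'" for \<beta>'
    using assms(3) permeq_derives_iff permeq_iff_nf by blast
  have "\<gamma> \<in> composites {\<alpha>. derives \<alpha> S g T} {\<beta>. derives \<beta> T h S} \<alpha> \<beta>
      \<longleftrightarrow> (\<exists>\<alpha>' \<beta>'. (derives \<alpha>' S g T \<and> nf \<alpha> = nf \<alpha>') \<and> (derives \<beta>' T h S \<and> nf \<beta> = nf \<beta>') \<and> \<gamma> \<in> cuts (\<alpha>', \<beta>'))" for \<gamma>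
    unfolding composites_def by (auto simp only: UN_iff mem_Collect_eq split: if_splits)
  then have c: "\<gamma> \<in> composites {\<alpha>. derives \<alpha> S g T} {\<beta>. derives \<beta> T h S} \<alpha> \<beta>
      \<longleftrightarrow> (\<exists>\<alpha>' \<beta>'. \<alpha> \<sim> \<alpha>' \<and> \<beta> \<sim> \<beta>' \<and> cut \<alpha>' \<beta>' \<gamma>)" for \<gamma>
    unfolding a b using cuts_eq by blast
  have "nf \<gamma> = nf (ident S) \<longleftrightarrow> \<gamma> \<sim> ident S" if "\<alpha> \<sim> \<alpha>'" "\<beta> \<sim> \<beta>'" "cut \<alpha>' \<beta>' \<gamma>" for \<alpha>' \<beta>' \<gamma>
  proof -
    have "derives \<gamma> S (g \<cdot> h) S"
      using cut_derives[OF that(3)] permeq_derives_iff[OF that(1)] permeq_derives_iff[OF that(2)] assms by blast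
    then show ?thesis using permeq_iff_nf derives_ident[OF assms(1)] by blast
  qed
  then show ?thesis
    unfolding left_inverse_def Bif_Comp_eq_Id_iff[OF assms] by (simp only: c Bex_def Ball_def) blast
qed

text \<open>Arrows over the identity are replaced by derivations; an arrow may then be tried several
  times, through different representatives. Comparing the objects first ensures that both search
  problems are well formed.\<close>

lemma logically_equivalent_iff:
  assumes S: "formula S A" and T: "formula T B"
  shows "logically_equivalent S T \<longleftrightarrow> over S = over T \<and>
    (\<exists>\<alpha>\<in>search (S, Id C (over S), T). \<exists>\<beta>\<in>search (T, Id C (over S), S).
      left_inverse (search (S, Id C (over S), T)) (search (T, Id C (over S), S)) S \<alpha> \<beta> \<and>
      left_inverse (search (T, Id C (over S), S)) (search (S, Id C (over S), T)) T \<beta> \<alpha>)"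
proof (cases "A = B")
  case True
  have A: "over S = A" "over T = A" using S T True formula_over by auto
  have "A \<in> Obj C" using S by (rule formula_Obj)
  then have "search (S, Id C A, T) = {\<alpha>. derives \<alpha> S (Id C A) T}" "search (T, Id C A, S) = {\<alpha>. derives \<alpha> T (Id C A) S}"
    using S T True by (simp_all add: search_eq cod.Id_in cod.Dom_Id cod.Cod_Id)
  moreover have "logically_equivalent S T \<longleftrightarrow> (\<exists>\<alpha>. derives \<alpha> S (Id C A) T \<and> (\<exists>\<beta>. derives \<beta> T (Id C A) S \<and>
      perm_class \<alpha> \<cdot>\<^bsub>Bif\<^esub> perm_class \<beta> = Id Bif S \<and> perm_class \<beta> \<cdot>\<^bsub>Bif\<^esub> perm_class \<alpha> = Id Bif T))"
    unfolding logically_equivalent_def hom_over_Bif using S T True formula_over by blast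
  ultimately show ?thesis
    using left_inverse_iff[OF S] left_inverse_iff[OF T] by (auto simp: A)
next
  case False
  then show ?thesis using S T formula_over unfolding logically_equivalent_def by metis
qed

end

locale finitely_effective_bifibration_data = effective_bifibration_data C D p \<P> \<N> RC RD
  for C :: "('o, 'a) cat" (structure) and D :: "('x, 'd) cat" and p :: "('x, 'd, 'o, 'a) ftr"
    and \<P> \<N> :: "'a set" and RC :: "('o, 'a) notat" and RD :: "('x, 'd) notat" +
  assumes relative_homs: "effective_relative_homs C D p RC RD"
    and slices: "effective_slices C RC" and coslices: "effective_coslices C RC"
begin

lemma coded_arr_in: "rA n f \<Longrightarrow> f \<in> Arr C"
  using RC by (auto simp: effective_category_def coded_arr_def)

lemma computable_after:
  assumes "computable E rA f" "computable E rA h"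
  shows "computable E (rset rA) (\<lambda>x. after (f x) (h x))"
proof (rule computable_comp_pair[OF _ assms])
  let ?A = "rprod rA rA" and ?b = "\<lambda>z. Dom C (fst z) = Dom C (snd z)"
  let ?h = "\<lambda>z. {e. (fst z, e, snd z) \<in> hom (coslice C (Dom C (fst z))) (fst z) (snd z)}"
  have "computable (restrict ?A ?b) (rset rA) ?h"
  proof (rule computable_solvable[OF coslices[unfolded effective_coslices_def]])
    fix n z assume "restrict ?A ?b n z"
    then show "\<exists>i\<in>{(f, g). f \<in> acode RC \<and> g \<in> acode RC \<and> Dom C (aden RC f) = Dom C (aden RC g)}.
        prod_encode i = n \<and> (\<forall>m. (case i of (f, g) \<Rightarrow> \<lambda>m. enumerates RC m
         {e. (aden RC f, e, aden RC g) \<in> hom (coslice C (Dom C (aden RC f))) (aden RC f) (aden RC g)}) m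
         \<longrightarrow> rset rA m (?h z))"
      by (intro bexI[of _ "prod_decode n"])
        (auto simp: restrict_def rprod_def coded_arr_def split: prod.split dest: rset_enumerates)
  qed
  then have "computable ?A (rset rA) (\<lambda>z. if ?b z then ?h z else {})"
    by (intro computable_if_restrict computable_empty)
      ((rule computable_C computable_intros)+)
  then show "computable ?A (rset rA) (\<lambda>z. after (fst z) (snd z))"
    by (rule computable_cong) (auto simp: coslice_after rprod_def coded_arr_in)
qed

lemma computable_before:
  assumes "computable E rA h" "computable E rA f"
  shows "computable E (rset rA) (\<lambda>x. before (h x) (f x))"
proof (rule computable_comp_pair[OF _ assms])
  let ?A = "rprod rA rA" and ?b = "\<lambda>z. Cod C (fst z) = Cod C (snd z)"
  let ?h = "\<lambda>z. {e. (fst z, e, snd z) \<in> hom (slice C (Cod C (fst z))) (fst z) (snd z)}"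
  have "computable (restrict ?A ?b) (rset rA) ?h"
  proof (rule computable_solvable[OF slices[unfolded effective_slices_def]])
    fix n z assume "restrict ?A ?b n z"
    then show "\<exists>i\<in>{(f, g). f \<in> acode RC \<and> g \<in> acode RC \<and> Cod C (aden RC f) = Cod C (aden RC g)}.
        prod_encode i = n \<and> (\<forall>m. (case i of (f, g) \<Rightarrow> \<lambda>m. enumerates RC m
         {e. (aden RC f, e, aden RC g) \<in> hom (slice C (Cod C (aden RC f))) (aden RC f) (aden RC g)}) m
         \<longrightarrow> rset rA m (?h z))"
      by (intro bexI[of _ "prod_decode n"])
        (auto simp: restrict_def rprod_def coded_arr_def split: prod.split dest: rset_enumerates)
  qed
  then have "computable ?A (rset rA) (\<lambda>z. if ?b z then ?h z else {})"
    by (intro computable_if_restrict computable_empty)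
      ((rule computable_C computable_intros)+)
  then show "computable ?A (rset rA) (\<lambda>z. before (fst z) (snd z))"
    by (rule computable_cong) (auto simp: slice_before rprod_def coded_arr_in)
qed

lemma computable_over_base:
  assumes "computable E rX X" "computable E rA h" "computable E rX Y"
  shows "computable E (rset rD) (\<lambda>x. over_base (X x) (h x) (Y x))"
proof (rule computable_comp_triple[OF _ assms])
  let ?A = "rprod rX (rprod rA rX)"
  let ?b = "\<lambda>z. fobj p (fst z) = Dom C (fst (snd z)) \<and> fobj p (snd (snd z)) = Cod C (fst (snd z))"
  let ?h = "\<lambda>z. hom_over D p (fst z) (fst (snd z)) (snd (snd z))"
  have "computable (restrict ?A ?b) (rset rD) ?h"
  proof (rule computable_solvable[OF relative_homs[unfolded effective_relative_homs_def]])
    fix n z assume z: "restrict ?A ?b n z"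
    define i where "i = (fst (prod_decode n), prod_decode (snd (prod_decode n)))"
    have "enc3 i = n" by (simp add: i_def enc3_def split: prod.split)
    with z show "\<exists>i\<in>{(x, f, y). x \<in> ocode RD \<and> f \<in> acode RC \<and> y \<in> ocode RD \<and>
         fobj p (oden RD x) = Dom C (aden RC f) \<and> fobj p (oden RD y) = Cod C (aden RC f)}.
        enc3 i = n \<and> (\<forall>m. (case i of (x, f, y) \<Rightarrow> \<lambda>m. enumerates RD m
          (hom_over D p (oden RD x) (aden RC f) (oden RD y))) m \<longrightarrow> rset rD m (?h z))"
      by (intro bexI[of _ i])
        (auto simp: i_def restrict_def rprod_def coded_arr_def coded_obj_def split: prod.split dest: rset_enumerates)
  qed
  then have "computable ?A (rset rD) (\<lambda>z. if ?b z then ?h z else {})"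
    by (intro computable_if_restrict computable_empty)
      ((rule computable_C computable_D computable_intros)+)
  then show "computable ?A (rset rD) (\<lambda>z. over_base (fst z) (fst (snd z)) (snd (snd z)))"
    by (simp add: over_base_def)
qed

lemma computable_apply_rule:
  "computable (rprod (rprod rnat (rprod rA rA)) rR) rR (\<lambda>z. apply_rule (fst z) (snd z))"
  unfolding apply_rule_def by (rule computable_tree_intros computable_intros)+

lemma computable_search:
  assumes "computable E (rprod rF (rprod rA rF)) s"
  shows "computable E (rset rR) (\<lambda>x. search (s x))"
proof (rule computable_comp[OF assms])
  show "computable (rprod rF (rprod rA rF)) (rset rR) search"
    unfolding search_def
  proof (rule computable_run[where L = "rprod rnat (rprod rA rA)"
        and \<mu> = "\<lambda>s. connectives (fst s) + connectives (snd (snd s))"])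
    show "computable (rprod rF (rprod rA rF)) rbool sequent_done"
      unfolding sequent_done_def by (rule computable_tree_intros computable_intros)+
    show "computable (rprod rF (rprod rA rF)) (rset rR) sequent_axioms"
      unfolding sequent_axioms_def
      by (rule computable_tree_intros computable_intros computable_set_intros computable_over_base)+
    show "computable (rprod rF (rprod rA rF)) (rset (rprod (rprod rnat (rprod rA rA)) (rprod rF (rprod rA rF))))
        sequent_steps"
      unfolding sequent_steps_def
      by (rule computable_tree_intros computable_intros computable_set_intros computable_C computable_after
          computable_before)+
  qed (auto simp: sequent_steps_def split: fm.splits intro: computable_apply_rule)
qed

lemma computable_cuts:
  assumes "computable E (rprod rR rR) z"
  shows "computable E (rset rR) (\<lambda>x. cuts (z x))"
proof (rule computable_comp[OF assms])
  show "computable (rprod rR rR) (rset rR) cuts"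
    unfolding cuts_def
  proof (rule computable_run[where L = "rprod rnat (rprod rA rA)" and \<mu> = "\<lambda>z. size (fst z) + size (snd z)"])
    show "computable (rprod rR rR) rbool cut_done"
      unfolding cut_done_def by (rule computable_tree_intros computable_intros)+
    show "computable (rprod rR rR) (rset rR) cut_axioms"
      unfolding cut_axioms_def
      by (rule computable_tree_intros computable_intros computable_set_intros computable_D)+
    show "computable (rprod rR rR) (rset (rprod (rprod rnat (rprod rA rA)) (rprod rR rR))) cut_steps"
      unfolding cut_steps_def
      by (rule computable_tree_intros computable_intros computable_set_intros computable_C computable_base)+
  qed (auto simp: cut_steps_def split: der.splits if_splits intro: computable_apply_rule)
qed

lemma computable_over:
  assumes "computable E rF f" shows "computable E (coded_obj RC) (\<lambda>x. over (f x))"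
proof -
  have "over S = (case S of Atom X \<Rightarrow> fobj p X | Pos f S' \<Rightarrow> Cod C f | Neg f S' \<Rightarrow> Dom C f)" for S
    by (cases S) simp_all
  then show ?thesis
    by (simp only:) (rule computable_tree_intros computable_intros computable_C computable_D assms)+
qed

text \<open>The recursion needs a computable stopping value on every formula, and outside the atoms
  no derivation is at hand. Computing the singleton of the result instead makes \<open>{}\<close>
  available as default.\<close>

lemma computable_ident:
  assumes "computable E rF f" shows "computable E rR (\<lambda>x. ident (f x))"
proof (rule computable_comp[OF assms], rule computable_the_elem)
  have "computable rX rD (Id D)" using computable_Id[OF RD computable_id] .
  note IdD = computable_comp[OF _ this]
  show "computable rF (rset rR) (\<lambda>S. {ident S})"
  proof (rule computable_recursion[where \<mu> = connectives
        and b = "\<lambda>S. case S of Atom X \<Rightarrow> True | _ \<Rightarrow> False"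
        and d = "\<lambda>S. case S of Atom X \<Rightarrow> S | Pos f S' \<Rightarrow> S' | Neg f S' \<Rightarrow> S'"
        and f = "\<lambda>S. case S of Atom X \<Rightarrow> {Ax (Id D X)} | _ \<Rightarrow> {}"
        and g = "\<lambda>S R. case S of Atom X \<Rightarrow> R | Pos f S' \<Rightarrow> \<Union>r\<in>R. {LP f (Id C (Cod C f)) (RP f r)}
          | Neg f S' \<Rightarrow> \<Union>r\<in>R. {RN (Id C (Dom C f)) f (LN f r)}"])
  qed (rule computable_tree_intros computable_intros computable_set_intros computable_C IdD
      | (auto split: fm.splits))+
qed

theorem decidable_logical_equivalence: "logical_equivalence_decidable RC RD"
  unfolding logical_equivalence_decidable_def
proof (rule decidable_computable)
  let ?P = "\<lambda>z. search (fst z, Id C (over (fst z)), snd z)"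
  let ?Q = "\<lambda>z. search (snd z, Id C (over (fst z)), fst z)"
  let ?dec = "\<lambda>z. over (fst z) = over (snd z) \<and>
    (\<exists>\<alpha>\<in>?P z. \<exists>\<beta>\<in>?Q z. left_inverse (?P z) (?Q z) (fst z) \<alpha> \<beta> \<and> left_inverse (?Q z) (?P z) (snd z) \<beta> \<alpha>)"
  show "computable (rprod rF rF) rbool ?dec"
    unfolding left_inverse_def composites_def
    by (rule computable_set_intros computable_intros computable_search computable_cuts computable_der_eq
        computable_nf computable_ident computable_C computable_over)+
  have code: "rF (enc_fm s) (map_fm (oden RD) (aden RC) s)" if "s \<in> fm_codes RC RD" for s
    using that by (intro rfm_enc_fm) (auto simp: fm_codes_def coded_arr_def coded_obj_def)
  fix i assume "i \<in> fm_codes RC RD \<times> fm_codes RC RD"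
  then obtain s t where i: "i = (s, t)" "s \<in> fm_codes RC RD" "t \<in> fm_codes RC RD" by auto
  let ?z = "(map_fm (oden RD) (aden RC) s, map_fm (oden RD) (aden RC) t)"
  have "?dec ?z \<longleftrightarrow> logically_equivalent (fst ?z) (snd ?z)"
    using logically_equivalent_iff i(2,3) unfolding fm_codes_def fst_conv snd_conv by blast
  with i code show "\<exists>x. rprod rF rF (case i of (s, t) \<Rightarrow> prod_encode (enc_fm s, enc_fm t)) x \<and> ?dec x =
      (case i of (s, t) \<Rightarrow> logically_equivalent (map_fm (oden RD) (aden RC) s) (map_fm (oden RD) (aden RC) t))"
    by (intro exI[of _ ?z]) (simp add: rprod_def)
qed

end

theorem theorem4p7:
  fixes C :: "('o, 'a) cat" and D :: "('x, 'd) cat" and p :: "('x, 'd, 'o, 'a) ftr"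
    and \<P> \<N> :: "'a set"
    and RC :: "('o, 'a) notat" and RD :: "('x, 'd) notat"
  assumes "cat_functor D C p"
    and "\<P> \<subseteq> Arr C" and "\<N> \<subseteq> Arr C"
    and "factorization_preordered C \<P>" and "factorization_preordered C \<N>"
  shows
    "(\<forall>A B S T f. bif.formula C D p \<P> \<N> S A \<longrightarrow> bif.formula C D p \<P> \<N> T B \<longrightarrow> f \<in> hom C A B \<longrightarrow>
        bij_betw
          (\<lambda>d. bif.perm_class C D p \<P> \<N> (bif.underlying C d))
          {d. bif.mmf_derives C D p \<P> \<N> d S f IBot T}
          (hom_over (bif.Bif C D p \<P> \<N>) (bif.Bif_proj C D p \<P> \<N>) S f T))
     \<and> (effective_data C D p \<P> \<N> RC RD \<longrightarrow> bif.permeq_decidable C D p \<P> \<N> RC RD)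
     \<and> (relatively_locally_finite C D p \<longrightarrow> locally_finite_slices C \<longrightarrow> locally_finite_coslices C \<longrightarrow>
          relatively_locally_finite C (bif.Bif C D p \<P> \<N>) (bif.Bif_proj C D p \<P> \<N>)
          \<and> (effective_data C D p \<P> \<N> RC RD \<longrightarrow> effective_relative_homs C D p RC RD \<longrightarrow>
               effective_slices C RC \<longrightarrow> effective_coslices C RC \<longrightarrow>
               bif.logical_equivalence_decidable C D p \<P> \<N> RC RD))"
proof -
  interpret cat_functor D C p by fact
  interpret preordered_bifibration_data C D p \<P> \<N> by unfold_locales fact+
  have effective: "effective_bifibration_data C D p \<P> \<N> RC RD" if "effective_data C D p \<P> \<N> RC RD"
    using that by unfold_locales
  have "finitely_effective_bifibration_data C D p \<P> \<N> RC RD"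
    if "effective_data C D p \<P> \<N> RC RD" "effective_relative_homs C D p RC RD"
      "effective_slices C RC" "effective_coslices C RC"
    using that by unfold_locales
  then show ?thesis
    using bij_betw_mmf relatively_locally_finite_Bif
      effective_bifibration_data.decidable_permeq[OF effective]
      finitely_effective_bifibration_data.decidable_logical_equivalence by blast
qed

end
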